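(* For every toroidal map $G$, there is a bijection between the Schnyder woods of $G$ and the Schnyder woods of its dual $G^*$.
   Context: A toroidal map is a graph embedded on the torus with no contractible loop, no two edges with the same endpoints whose union is a contractible cycle, and all faces homeomorphic to open disks; $G^*$ is its (toroidal) dual map. A Schnyder wood of a map $H$ embedded on the torus is an orientation and coloring of its edges with colors $0,1,2$ (indices modulo 3), each edge oriented in one direction or in two opposite directions (with distinct colors), such that (T1) every vertex $v$ has out-degree exactly one in each color, the edges $e_0(v),e_1(v),e_2(v)$ leaving $v$ in colors $0,1,2$ occur in counterclockwise order, and each edge entering $v$ in color $i$ enters in the counterclockwise sector from $e_{i+1}(v)$ to $e_{i-1}(v)$; (T2) every monochromatic cycle of color $i$ (directed cycle of edges colored $i$, oriented by color $i$) intersects at least one monochromatic cycle of color $i-1$ and at least one of color $i+1$. *)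

theory Defs
  imports "HOL-Combinatorics.Combinatorics" "HOL-Library.Numeral_Type"
begin

text \<open>
  A graph embedded with disk faces in a closed oriented surface is represented by its rotation
  system. A dart is an edge together with one of its two directions, or equivalently a half-edge at
  the vertex that the dart leaves; loops thus have two darts at the same vertex. \<open>opp\<close> reverses a
  dart, and \<open>rot\<close> sends a dart to the next one in counterclockwise order around its origin.
\<close>

record 'd cmap =
  darts :: "'d set"
  rot :: "'d \<Rightarrow> 'd"
  opp :: "'d \<Rightarrow> 'd"

definition combinatorial_map :: "'d cmap \<Rightarrow> bool" where
  "combinatorial_map M \<longleftrightarrow>
     finite (darts M) \<and> rot M permutes darts M \<and> opp M permutes darts M \<and>
     (\<forall>d\<in>darts M. opp M d \<noteq> d \<and> opp M (opp M d) = d)"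

text \<open>A vertex is identified with the set of darts leaving it.\<close>

definition origin :: "'d cmap \<Rightarrow> 'd \<Rightarrow> 'd set" where
  "origin M d = orbit (rot M) d"

definition target :: "'d cmap \<Rightarrow> 'd \<Rightarrow> 'd set" where
  "target M d = origin M (opp M d)"

text \<open>
  \<open>face_next\<close> leads from a dart to the next one on the boundary of the face to its left:
  on arriving at the target, one takes the dart just clockwise of the reversed one. This traverses
  the face boundary counterclockwise as seen from inside the face.
\<close>

definition face_next :: "'d cmap \<Rightarrow> 'd \<Rightarrow> 'd" where
  "face_next M = inv (rot M) \<circ> opp M"

definition vertices :: "'d cmap \<Rightarrow> 'd set set" where
  "vertices M = origin M ` darts M"

definition edges :: "'d cmap \<Rightarrow> 'd set set" where
  "edges M = (\<lambda>d. {d, opp M d}) ` darts M"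

definition faces :: "'d cmap \<Rightarrow> 'd set set" where
  "faces M = (\<lambda>d. orbit (face_next M) d) ` darts M"

definition walk :: "'d cmap \<Rightarrow> 'd list \<Rightarrow> bool" where
  "walk M ds \<longleftrightarrow> set ds \<subseteq> darts M \<and> successively (\<lambda>d e. target M d = origin M e) ds"

definition closed_walk :: "'d cmap \<Rightarrow> 'd list \<Rightarrow> bool" where
  "closed_walk M ds \<longleftrightarrow> walk M ds \<and> ds \<noteq> [] \<and> target M (last ds) = origin M (hd ds)"

definition connected_map :: "'d cmap \<Rightarrow> bool" where
  "connected_map M \<longleftrightarrow> darts M \<noteq> {} \<and>
     (\<forall>u\<in>vertices M. \<forall>v\<in>vertices M. u = v \<or>
        (\<exists>ds. walk M ds \<and> ds \<noteq> [] \<and> origin M (hd ds) = u \<and> target M (last ds) = v))"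

text \<open>
  Gluing a disk along each face walk of a connected map yields a closed connected oriented surface.
  It is the torus exactly if its Euler characteristic is 0.
\<close>

definition map_on_torus :: "'d cmap \<Rightarrow> bool" where
  "map_on_torus M \<longleftrightarrow> combinatorial_map M \<and> connected_map M \<and>
     int (card (vertices M)) - int (card (edges M)) + int (card (faces M)) = 0"

definition face_walk :: "'d cmap \<Rightarrow> 'd \<Rightarrow> 'd list" where
  "face_walk M d = map (\<lambda>k. (face_next M ^^ k) d) [0..<card (orbit (face_next M) d)]"

text \<open>
  Homotopy of walks with fixed endpoints: as all faces are disks, it is generated by inserting and
  deleting spurs (an edge traversed back and forth) and face boundaries.
\<close>

inductive homotopic_walks :: "'d cmap \<Rightarrow> 'd list \<Rightarrow> 'd list \<Rightarrow> bool" for M where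
  refl: "walk M u \<Longrightarrow> homotopic_walks M u u"
| sym: "homotopic_walks M u v \<Longrightarrow> homotopic_walks M v u"
| trans: "homotopic_walks M u v \<Longrightarrow> homotopic_walks M v w \<Longrightarrow> homotopic_walks M u w"
| spur: "walk M (u @ [d, opp M d] @ v) \<Longrightarrow> homotopic_walks M (u @ [d, opp M d] @ v) (u @ v)"
| face: "walk M (u @ face_walk M d @ v) \<Longrightarrow> d \<in> darts M \<Longrightarrow>
           homotopic_walks M (u @ face_walk M d @ v) (u @ v)"

definition contractible_walk :: "'d cmap \<Rightarrow> 'd list \<Rightarrow> bool" where
  "contractible_walk M ds \<longleftrightarrow> closed_walk M ds \<and> homotopic_walks M ds []"

text \<open>
  In the last condition, \<open>d\<close> and \<open>e\<close> may be loops at the same vertex: homotopic loops are excluded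
  just as other homotopic multiple edges are.
\<close>

definition toroidal_map :: "'d cmap \<Rightarrow> bool" where
  "toroidal_map M \<longleftrightarrow> map_on_torus M \<and>
     (\<forall>d\<in>darts M. target M d = origin M d \<longrightarrow> \<not> contractible_walk M [d]) \<and>
     (\<forall>d\<in>darts M. \<forall>e\<in>darts M.
        {d, opp M d} \<noteq> {e, opp M e} \<and> origin M d = origin M e \<and> target M d = target M e \<longrightarrow>
        \<not> contractible_walk M [d, opp M e])"

text \<open>
  Read in the dual, a dart \<open>d\<close> is the dual edge directed from the face to the left of \<open>d\<close> to the
  face to its right. The counterclockwise order of the dual darts around a face is the
  order of the boundary darts given by \<open>face_next\<close>, so both maps refer to the same orientation of
  the torus.
\<close>

definition dual_map :: "'d cmap \<Rightarrow> 'd cmap" where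
  "dual_map M = \<lparr>darts = darts M, rot = face_next M, opp = opp M\<rparr>"

text \<open>Colors live in the ring of integers modulo 3, so \<open>i + 1\<close> and \<open>i - 1\<close> are cyclic.\<close>

type_synonym color = 3

text \<open>
  \<open>c d = Some i\<close> means that the edge of \<open>d\<close> is oriented in the direction of \<open>d\<close> with color \<open>i\<close>;
  \<open>c d = None\<close> means that it is not oriented in that direction. The value outside the darts is
  fixed, so that distinct functions are distinct colored orientations. The inequality says that
  each edge is oriented in at least one direction and, if in both, then with distinct colors.
\<close>

definition colored_orientation :: "'d cmap \<Rightarrow> ('d \<Rightarrow> color option) \<Rightarrow> bool" where
  "colored_orientation M c \<longleftrightarrow>
     (\<forall>d. d \<notin> darts M \<longrightarrow> c d = None) \<and>
     (\<forall>d\<in>darts M. c d \<noteq> c (opp M d))"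

text \<open>The darts met when turning counterclockwise from \<open>a\<close> to \<open>b\<close>, both included.\<close>

definition ccw_sector :: "'d cmap \<Rightarrow> 'd \<Rightarrow> 'd \<Rightarrow> 'd set" where
  "ccw_sector M a b = {(rot M ^^ k) a | k. \<forall>j<k. (rot M ^^ j) a \<noteq> b}"

text \<open>
  Sectors are closed: an edge entering a vertex in color \<open>i\<close> and leaving it in another color lies
  on the border of the sector.
\<close>

definition schnyder_T1 :: "'d cmap \<Rightarrow> ('d \<Rightarrow> color option) \<Rightarrow> bool" where
  "schnyder_T1 M c \<longleftrightarrow>
     (\<forall>v\<in>vertices M. \<exists>e.
        (\<forall>i. {d \<in> v. c d = Some i} = {e i}) \<and>
        e 1 \<in> ccw_sector M (e 0) (e 2) \<and>
        (\<forall>i. \<forall>d\<in>v. c (opp M d) = Some i \<longrightarrow> d \<in> ccw_sector M (e (i + 1)) (e (i - 1))))"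

definition mono_cycle :: "'d cmap \<Rightarrow> ('d \<Rightarrow> color option) \<Rightarrow> color \<Rightarrow> 'd list \<Rightarrow> bool" where
  "mono_cycle M c i ds \<longleftrightarrow>
     closed_walk M ds \<and> distinct (map (origin M) ds) \<and> (\<forall>d\<in>set ds. c d = Some i)"

definition cycles_intersect :: "'d cmap \<Rightarrow> 'd list \<Rightarrow> 'd list \<Rightarrow> bool" where
  "cycles_intersect M ds es \<longleftrightarrow> origin M ` set ds \<inter> origin M ` set es \<noteq> {}"

definition schnyder_T2 :: "'d cmap \<Rightarrow> ('d \<Rightarrow> color option) \<Rightarrow> bool" where
  "schnyder_T2 M c \<longleftrightarrow>
     (\<forall>i ds. mono_cycle M c i ds \<longrightarrow>
        (\<exists>es. mono_cycle M c (i - 1) es \<and> cycles_intersect M ds es) \<and>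
        (\<exists>es. mono_cycle M c (i + 1) es \<and> cycles_intersect M ds es))"

definition schnyder_wood :: "'d cmap \<Rightarrow> ('d \<Rightarrow> color option) \<Rightarrow> bool" where
  "schnyder_wood M c \<longleftrightarrow> colored_orientation M c \<and> schnyder_T1 M c \<and> schnyder_T2 M c"

end

theory Submission
  imports Defs
begin

text \<open>
  Call \<open>i\<close> the label of the corner between the outgoing edges of colors \<open>i + 1\<close> and \<open>i - 1\<close>. Around a
  vertex counterclockwise, and around a face counterclockwise, consecutive labels are equal or
  increase by 1; around a vertex there are three increments, so a face has a multiple of three.
  A face without increments would be bounded by a monochromatic cycle of some color \<open>i\<close> that no cycle
  of color \<open>i - 1\<close> meets, contradicting (T2). As each edge accounts for three increments in
  all and the Euler characteristic is 0, every face has exactly three. So the same labels define a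
  coloring of the dual that satisfies (T1); applying this construction twice only reverses darts.

  For (T2) in the dual, cut the torus along \<open>r\<close> disjoint cycles, primal or dual: at least \<open>r\<close>
  components arise, since capping the boundaries adds \<open>2 r\<close> to the Euler characteristic, which is
  at most 2 for each component. Edges of
  color \<open>i - 1\<close> cross dual cycles of color \<open>i\<close> only from right to left, edges of color \<open>i + 1\<close> only
  from left to right, edges of color \<open>i\<close> never, and similar restrictions hold for primal cycles of
  color \<open>i\<close>. If some primal cycle of color \<open>i + s\<close>, where \<open>s\<close> is 1 or -1, crosses one of color \<open>i\<close>,
  it also crosses every dual cycle of color \<open>i\<close> and never a dual cycle of color \<open>i + s\<close>, so these two
  dual cycles meet. Otherwise all primal cycles of color \<open>i\<close> are reversed cycles of color \<open>i + s\<close>, and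
  the same follows for the dual cycles.
\<close>

section \<open>Cycles of permutations and the Euler inequality\<close>

text \<open>A rotation system offers no homology classes; the only global information on the surface
  is its Euler characteristic. So every topological claim becomes a count of components: disjoint
  cycles force many of them, while colored paths show that the two sides of some cut cycle are still
  joined, so that undoing this cut does not change connectivity. Components are classes of darts
  under a relation \<open>R A B\<close> indexed by the cut edges. The obstacle is that (T2) asks for
  cycles that intersect, not for cycles that cross: a cycle of color \<open>i\<close> and one of
  color \<open>i + s\<close> may share all edges of the first in opposite directions. Only one edge
  of a cycle enters a given vertex, and its reverse has at most one color, so this happens for at
  most one sign \<open>s\<close>. Hence a crossing of one of the two signs is always available, but
  the intersection of dual cycles for a prescribed \<open>s\<close> needs a case distinction. The
  bijection needs no explicit inverse formula: four dualizations return to the same map and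
  coloring, so three further ones invert the first.\<close>

definition conn :: "('a \<times> 'a) set \<Rightarrow> ('a \<times> 'a) set" where
  "conn R = (R \<union> R\<inverse>)\<^sup>*"

definition classes :: "'a set \<Rightarrow> ('a \<times> 'a) set \<Rightarrow> 'a set set" where
  "classes X R = (\<lambda>x. conn R `` {x}) ` X"

definition fgraph :: "'a set \<Rightarrow> ('a \<Rightarrow> 'a) \<Rightarrow> ('a \<times> 'a) set" where
  "fgraph X f = (\<lambda>x. (x, f x)) ` X"

lemma fgraphI: "x \<in> X \<Longrightarrow> (x, f x) \<in> fgraph X f"
  by (auto simp: fgraph_def)

lemma conn_refl [simp]: "(x, x) \<in> conn R"
  by (simp add: conn_def)

lemma conn_sym: "(x, y) \<in> conn R \<Longrightarrow> (y, x) \<in> conn R"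
  by (metis conn_def converse_Un converse_converse converse_iff rtrancl_converseI sup_commute)

lemma conn_trans [trans]: "(x, y) \<in> conn R \<Longrightarrow> (y, z) \<in> conn R \<Longrightarrow> (x, z) \<in> conn R"
  by (auto simp: conn_def)

lemma conn_base: "(x, y) \<in> R \<Longrightarrow> (x, y) \<in> conn R"
  by (auto simp: conn_def)

lemma conn_fgraph: "x \<in> X \<Longrightarrow> (x, f x) \<in> conn (fgraph X f \<union> R)"
  by (auto simp: fgraphI intro!: conn_base)

lemma conn_least:
  assumes "R \<subseteq> conn R'"
  shows "conn R \<subseteq> conn R'"
proof
  fix p assume "p \<in> conn R"
  then obtain x y where "p = (x, y)" and "(x, y) \<in> (R \<union> R\<inverse>)\<^sup>*"
    by (cases p) (auto simp: conn_def)
  from this(2) have "(x, y) \<in> conn R'"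
  proof induction
    case (step y z)
    then have "(y, z) \<in> conn R'" using assms conn_sym[of z y R'] by auto
    with step.IH show ?case by (rule conn_trans)
  qed simp
  then show "p \<in> conn R'" using \<open>p = (x, y)\<close> by simp
qed

lemma conn_mono: "R \<subseteq> R' \<Longrightarrow> conn R \<subseteq> conn R'"
  by (meson conn_base conn_least subrelI subset_iff)

lemma conn_class_eq: "conn R `` {x} = conn R `` {y} \<longleftrightarrow> (x, y) \<in> conn R"
proof
  assume "conn R `` {x} = conn R `` {y}"
  then have "y \<in> conn R `` {x}" by simp
  then show "(x, y) \<in> conn R" by simp
next
  assume xy: "(x, y) \<in> conn R"
  have "(x, z) \<in> conn R \<longleftrightarrow> (y, z) \<in> conn R" for z
    using xy conn_sym[OF xy] by (meson conn_trans)
  then show "conn R `` {x} = conn R `` {y}" by auto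
qed

lemma conn_closed:
  assumes "(x, y) \<in> conn R" "x \<in> P" "\<And>u v. (u, v) \<in> R \<Longrightarrow> u \<in> P \<longleftrightarrow> v \<in> P"
  shows "y \<in> P"
  using assms(1) unfolding conn_def
  by (induction) (use assms(2,3) in auto)

lemma finite_classes: "finite X \<Longrightarrow> finite (classes X R)"
  by (simp add: classes_def)

text \<open>Only generators have to be compared, so later comparisons of component counts reduce to
  checking single pairs of darts.\<close>

lemma card_classes_antimono:
  assumes "finite X" "R \<subseteq> conn R'"
  shows "card (classes X R') \<le> card (classes X R)"
proof -
  have "conn R \<subseteq> conn R'" using assms(2) by (rule conn_least)
  have "classes X R' = (\<lambda>K. conn R' `` K) ` classes X R"
  proof -
    have "conn R' `` (conn R `` {x}) = conn R' `` {x}" for x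
      using \<open>conn R \<subseteq> conn R'\<close> conn_refl[of x R] by (auto dest: conn_trans)
    then show ?thesis by (simp add: classes_def image_image)
  qed
  then show ?thesis using assms(1) by (metis card_image_le finite_classes)
qed

lemma conn_insert:
  "conn (insert (a, b) R) `` {x} =
     (if (x, a) \<in> conn R \<or> (x, b) \<in> conn R then conn R `` {a} \<union> conn R `` {b} else conn R `` {x})"
  (is "_ = ?K x")
proof -
  let ?R = "insert (a, b) R"
  have le: "conn R \<subseteq> conn ?R" by (intro conn_mono) auto
  have ab: "(a, b) \<in> conn ?R" by (auto intro: conn_base)
  have "y \<in> ?K x" if "(x, y) \<in> conn ?R" for y
  proof (rule conn_closed[OF that])
    have "(z, u) \<in> conn R \<longleftrightarrow> (z, v) \<in> conn R" if "(u, v) \<in> R" for u v z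
      using that by (meson conn_base conn_sym conn_trans)
    then show "u \<in> ?K x \<longleftrightarrow> v \<in> ?K x" if "(u, v) \<in> ?R" for u v
      using that by auto
  qed (auto intro: conn_sym)
  moreover have "(x, y) \<in> conn ?R" if "y \<in> ?K x" for y
  proof (cases "(x, a) \<in> conn R \<or> (x, b) \<in> conn R")
    case True
    then have "(x, a) \<in> conn ?R"
      using le conn_sym[OF ab] by (blast dest: conn_trans)
    moreover have "(a, y) \<in> conn ?R"
      using that True le ab by (auto dest: conn_trans)
    ultimately show ?thesis by (rule conn_trans)
  qed (use that le in auto)
  ultimately show ?thesis by blast
qed

lemma card_classes_insert:
  assumes "finite X" "a \<in> X" "b \<in> X" "(a, b) \<notin> conn R"
  shows "card (classes X (insert (a, b) R)) + 1 = card (classes X R)"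
proof -
  let ?A = "conn R `` {a}" and ?B = "conn R `` {b}"
  have ne: "?A \<noteq> ?B" using assms(4) by (simp add: conn_class_eq)
  have AB: "?A \<in> classes X R" "?B \<in> classes X R" using assms by (auto simp: classes_def)
  have not: "?A \<union> ?B \<notin> classes X R"
  proof
    assume "?A \<union> ?B \<in> classes X R"
    then obtain x where x: "?A \<union> ?B = conn R `` {x}" unfolding classes_def by blast
    have "a \<in> ?A \<union> ?B" "b \<in> ?A \<union> ?B" by auto
    then have "(x, a) \<in> conn R" "(x, b) \<in> conn R" unfolding x by simp_all
    then show False using assms(4) conn_trans[OF conn_sym[of x a R], of b] by blast
  qed
  have "classes X (insert (a, b) R) = insert (?A \<union> ?B) (classes X R - {?A, ?B})" (is "?L = ?R")
  proof (intro subset_antisym subsetI)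
    fix K assume "K \<in> ?L"
    then obtain x where x: "x \<in> X" "K = conn (insert (a, b) R) `` {x}" by (auto simp: classes_def)
    show "K \<in> ?R"
    proof (cases "(x, a) \<in> conn R \<or> (x, b) \<in> conn R")
      case False
      then have "K = conn R `` {x}" using x by (simp add: conn_insert)
      then show ?thesis using x False by (auto simp: classes_def conn_class_eq)
    qed (use x in \<open>simp add: conn_insert\<close>)
  next
    fix K assume "K \<in> ?R"
    then consider "K = ?A \<union> ?B" | x where "x \<in> X" "K = conn R `` {x}" "K \<noteq> ?A" "K \<noteq> ?B"
      by (auto simp: classes_def)
    then show "K \<in> ?L"
    proof cases
      case 1
      then have "K = conn (insert (a, b) R) `` {a}" by (simp add: conn_insert)
      then show ?thesis using assms(2) by (auto simp: classes_def)
    next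
      case 2
      then have "K = conn (insert (a, b) R) `` {x}" by (simp add: conn_insert conn_class_eq)
      then show ?thesis using 2 by (auto simp: classes_def)
    qed
  qed
  moreover have "card {?A, ?B} \<le> card (classes X R)"
    using AB assms(1) by (intro card_mono finite_classes) auto
  ultimately show ?thesis using ne AB not assms(1) finite_classes[of X R]
    by (simp add: card_Diff_subset)
qed

lemma card_classes_insert_le:
  assumes "finite X" "a \<in> X" "b \<in> X"
  shows "card (classes X R) \<le> card (classes X (insert (a, b) R)) + 1"
proof (cases "(a, b) \<in> conn R")
  case True
  then have "insert (a, b) R \<subseteq> conn R" by (auto intro: conn_base)
  then have "conn (insert (a, b) R) = conn R"
    using conn_mono[of R "insert (a, b) R"] by (simp add: conn_least subset_antisym subset_insertI)
  then show ?thesis by (simp add: classes_def)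
qed (use card_classes_insert[OF assms, of R] in simp)

lemma conn_funpow:
  assumes "f ` X \<subseteq> X" "x \<in> X"
  shows "(x, (f ^^ n) x) \<in> conn (fgraph X f)"
proof (induction n)
  case (Suc n)
  have "(f ^^ n) x \<in> X" by (induction n) (use assms in auto)
  then have "((f ^^ n) x, (f ^^ Suc n) x) \<in> conn (fgraph X f)"
    by (auto intro!: conn_base fgraphI)
  with Suc show ?case by (rule conn_trans)
qed simp

lemma orbit_eq_iff:
  assumes "permutation f"
  shows "orbit f x = orbit f y \<longleftrightarrow> y \<in> orbit f x"
proof
  assume "y \<in> orbit f x"
  then show "orbit f x = orbit f y"
    using orbit_cyclic_eq3[OF cyclic_on_orbit'[OF assms, of x]] by simp
qed (use permutation_self_in_orbit[OF assms, of y] in simp)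

lemma conn_perm:
  assumes "finite X" "f permutes X" "x \<in> X"
  shows "(x, y) \<in> conn (fgraph X f) \<longleftrightarrow> y \<in> orbit f x"
proof -
  have perm: "permutation f" using assms permutation_permutes by blast
  show ?thesis
  proof
    assume "(x, y) \<in> conn (fgraph X f)"
    then show "y \<in> orbit f x"
    proof (rule conn_closed)
      show "x \<in> orbit f x" using perm by (rule permutation_self_in_orbit)
      show "u \<in> orbit f x \<longleftrightarrow> v \<in> orbit f x" if "(u, v) \<in> fgraph X f" for u v
        using that orbit_eq_iff[OF perm, of x] permutation_orbit_step[OF perm, of u]
        by (auto simp: fgraph_def)
    qed
  next
    assume "y \<in> orbit f x"
    then obtain n where "y = (f ^^ n) x" by (auto simp: orbit_altdef)
    then show "(x, y) \<in> conn (fgraph X f)"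
      using assms by (auto intro!: conn_funpow simp: permutes_in_image)
  qed
qed

lemma classes_perm:
  assumes "finite X" "f permutes X"
  shows "classes X (fgraph X f) = orbit f ` X"
proof -
  have "conn (fgraph X f) `` {x} = orbit f x" if "x \<in> X" for x
    using conn_perm[OF assms that] by auto
  then show ?thesis by (simp add: classes_def)
qed

section \<open>Adding edges to a map: merging of cycles and the Euler inequality\<close>

lemma funpow_closed:
  assumes "\<And>x. x \<in> P \<Longrightarrow> f x \<in> P" "x \<in> P"
  shows "(f ^^ n) x \<in> P"
  by (induction n) (use assms in auto)

text \<open>The new permutation sends \<open>a\<close> to \<open>f b\<close> and then follows
  \<open>f\<close> around the cycle of \<open>b\<close>, which avoids \<open>a\<close>, until it
  reaches \<open>b\<close>. So a transposition of points on different cycles merges these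
  cycles.\<close>

lemma orbit_comp_transpose:
  assumes f: "permutation f" and ab: "b \<notin> orbit f a"
  shows "b \<in> orbit (f \<circ> transpose a b) a"
proof -
  obtain n where n: "n > 0" "(f ^^ n) b = b" and least: "\<And>m. 0 < m \<Longrightarrow> m < n \<Longrightarrow> (f ^^ m) b \<noteq> b"
  proof (rule that)
    show "(f ^^ funpow_dist1 f b b) b = b"
      using f by (intro funpow_dist1_prop permutation_self_in_orbit)
    show "(f ^^ m) b \<noteq> b" if "0 < m" "m < funpow_dist1 f b b" for m
      using that by (rule funpow_dist1_least)
  qed simp
  have nota: "(f ^^ m) b \<noteq> a" for m
  proof
    assume "(f ^^ m) b = a"
    then have "a \<in> orbit f b"
      using funpow_in_orbit[OF permutation_self_in_orbit[OF f], of m b] by simp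
    then show False
      using ab f orbit_swap permutation_self_in_orbit by metis
  qed
  define g where "g = f \<circ> transpose a b"
  have ga: "g a = f b" and g: "x \<noteq> a \<Longrightarrow> x \<noteq> b \<Longrightarrow> g x = f x" for x
    by (auto simp: g_def)
  have "(f ^^ m) b \<in> orbit g a" if "0 < m" "m \<le> n" for m
    using that
  proof (induction m)
    case (Suc m)
    show ?case
    proof (cases "m = 0")
      case True
      have "g a \<in> orbit g a" by (rule orbit.base)
      then show ?thesis by (simp add: True ga)
    next
      case False
      then have "g ((f ^^ m) b) \<in> orbit g a" using Suc by (intro orbit.step) auto
      moreover have "g ((f ^^ m) b) = f ((f ^^ m) b)"
        using nota[of m] least[of m] False Suc.prems by (intro g) auto
      ultimately show ?thesis by simp
    qed
  qed simp
  from this[of n] show ?thesis using n by (simp add: g_def)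
qed

text \<open>With \<open>h = opp M\<close> and \<open>S\<close> a union of edges, this is both the
  edge involution of the map that keeps only the edges of \<open>S\<close> and the factor by which a
  cut modifies a vertex or face permutation.\<close>

definition swap_on :: "('a \<Rightarrow> 'a) \<Rightarrow> 'a set \<Rightarrow> 'a \<Rightarrow> 'a" where
  "swap_on h S x = (if x \<in> S then h x else x)"

lemma swap_on_permutes:
  assumes "S \<subseteq> X" "h ` S \<subseteq> S" "\<And>x. x \<in> X \<Longrightarrow> h (h x) = x"
  shows "swap_on h S permutes X"
proof (rule bij_imp_permutes)
  have inv: "swap_on h S (swap_on h S x) = x" if "x \<in> X" for x
    using assms that by (auto simp: swap_on_def)
  have "swap_on h S x \<in> X" if "x \<in> X" for x
    using assms that by (auto simp: swap_on_def)
  then show "bij_betw (swap_on h S) X X"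
    by (intro bij_betwI[of _ _ _ "swap_on h S"]) (use inv in auto)
qed (use assms in \<open>auto simp: swap_on_def\<close>)

text \<open>
  Add the edges one by one: an edge between two components merges two faces, and any other edge
  changes the number of faces by at most one.
\<close>

lemma euler_inequality:
  assumes X: "finite X" and s: "s permutes X"
    and h: "\<And>x. x \<in> X \<Longrightarrow> h (h x) = x \<and> h x \<noteq> x"
    and S: "S \<subseteq> X" "h ` S \<subseteq> S"
  shows "2 * (card (classes X (fgraph X s)) + card (classes X (fgraph X (inv s \<circ> swap_on h S))))
    \<le> card S + 4 * card (classes X (fgraph X s \<union> fgraph X (swap_on h S)))"
  using S
proof (induction "card S" arbitrary: S rule: less_induct)
  case less
  have fin: "finite S" using less.prems X finite_subset by blast
  show ?case
  proof (cases "S = {}")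
    case True
    \<comment> \<open>Without edges the faces are the vertex cycles run backwards and the components
      are the vertex cycles, so both sides are four times their number.\<close>
    have id: "swap_on h S = id" by (auto simp: True swap_on_def)
    have "fgraph X s \<union> fgraph X id \<subseteq> conn (fgraph X s)"
      by (auto simp: fgraph_def intro: conn_base)
    moreover have "fgraph X (inv s) \<subseteq> conn (fgraph X s)"
      using conn_fgraph[of "inv s _" X s "{}"] s permutes_in_image[OF permutes_inv[OF s]]
      by (auto simp: fgraph_def permutes_inverses dest: conn_sym)
    moreover have "fgraph X s \<subseteq> conn (fgraph X (inv s))"
      using conn_fgraph[of "s _" X "inv s" "{}"] s permutes_in_image[OF s]
      by (auto simp: fgraph_def permutes_inverses dest: conn_sym)
    ultimately show ?thesis
      using card_classes_antimono[OF X, of "fgraph X (inv s)" "fgraph X s"]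
        card_classes_antimono[OF X, of "fgraph X s" "fgraph X (inv s)"]
        card_classes_antimono[OF X, of "fgraph X s \<union> fgraph X id" "fgraph X s"]
      unfolding id by simp
  next
    case False
    then obtain a where a: "a \<in> S" by auto
    define b where "b = h a"
    have aX: "a \<in> X" and b: "b \<in> S" "b \<in> X" "b \<noteq> a" "h b = a"
      using a less.prems h by (auto simp: b_def)
    define S' where "S' = S - {a, b}"
    have S': "S' \<subseteq> X" "h ` S' \<subseteq> S'"
    proof -
      show "S' \<subseteq> X" using less.prems by (auto simp: S'_def)
      show "h ` S' \<subseteq> S'" 
      proof clarify
        fix x assume x: "x \<in> S'"
        then have "h x \<in> S" "h (h x) = x" using less.prems h by (auto simp: S'_def)
        then show "h x \<in> S'" using x b by (auto simp: S'_def b_def)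
      qed
    qed
    have card: "card S = card S' + 2"
    proof -
      have "card {a, b} \<le> card S" using a b fin by (intro card_mono) auto
      then show ?thesis using a b fin by (simp add: S'_def card_Diff_subset)
    qed
    let ?e = "swap_on h S" and ?e' = "swap_on h S'"
    let ?f = "inv s \<circ> ?e" and ?f' = "inv s \<circ> ?e'"
    let ?G = "fgraph X s \<union> fgraph X ?e" and ?G' = "fgraph X s \<union> fgraph X ?e'"
    have e: "?e = ?e' \<circ> transpose a b"
      using a b by (auto simp: swap_on_def S'_def b_def transpose_def fun_eq_iff)
    have f: "?f = ?f' \<circ> transpose a b" by (simp add: e comp_assoc)
    have f': "?f' permutes X" 
      using s S' h by (intro permutes_compose[of _ X] swap_on_permutes permutes_inv) auto
    have perm: "permutation ?f'" using f' X permutation_permutes by blast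
    have fp: "?f permutes X"
      unfolding f using permutes_compose[OF permutes_swap_id[OF aX b(2)] f'] .
    have IH: "2 * (card (classes X (fgraph X s)) + card (classes X (fgraph X ?f')))
        \<le> card S' + 4 * card (classes X ?G')"
      using less.hyps[of S'] S' card by simp
    have G: "insert (a, b) ?G' \<subseteq> conn ?G" "?G \<subseteq> conn (insert (a, b) ?G')"
    proof -
      have 1: "(x, ?e' x) \<in> conn ?G" if "x \<in> X" for x
        using that by (cases "x = a \<or> x = b")
          (auto simp: S'_def swap_on_def fgraph_def intro!: conn_base)
      have 2: "(a, b) \<in> conn ?G"
        using a aX by (auto simp: swap_on_def fgraph_def b_def intro!: conn_base)
      show "insert (a, b) ?G' \<subseteq> conn ?G" 
        using 1 2 by (auto simp: fgraph_def intro: conn_base)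
      have 3: "(a, b) \<in> conn (insert (a, b) ?G')" by (auto intro: conn_base)
      have "(x, ?e x) \<in> conn (insert (a, b) ?G')" if "x \<in> X" for x
      proof -
        consider "x = a" | "x = b" | "x \<noteq> a" "x \<noteq> b" by auto
        then show ?thesis
        proof cases
          case 3
          then have "(x, ?e x) \<in> insert (a, b) ?G'"
            using that by (auto simp: S'_def swap_on_def fgraph_def)
          then show ?thesis by (rule conn_base)
        qed (use a b 3 conn_sym[OF 3] in \<open>auto simp: swap_on_def b_def\<close>)
      qed
      then show "?G \<subseteq> conn (insert (a, b) ?G')"
        by (auto simp: fgraph_def intro: conn_base)
    qed
    have eqG: "card (classes X ?G) = card (classes X (insert (a, b) ?G'))"
      using G[THEN card_classes_antimono[OF X]] by simp
    have F: "fgraph X ?f' \<subseteq> conn (insert (a, b) (fgraph X ?f))"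
    proof -
      let ?C = "conn (insert (a, b) (fgraph X ?f))"
      have ab: "(a, b) \<in> ?C" by (auto intro: conn_base)
      have st: "(x, ?f x) \<in> ?C" if "x \<in> X" for x using conn_fgraph[OF that, of ?f "{(a, b)}"] by simp
      have "(x, ?f' x) \<in> ?C" if "x \<in> X" for x
      proof -
        have "?f (transpose a b x) = ?f' x" by (simp add: f)
        moreover have "(x, transpose a b x) \<in> ?C"
          using ab conn_sym[OF ab] by (auto simp: transpose_def)
        moreover have "transpose a b x \<in> X" using that aX b by (auto simp: transpose_def)
        ultimately show ?thesis using st[of "transpose a b x"] by (metis conn_trans)
      qed
      then show ?thesis by (auto simp: fgraph_def)
    qed
    have F1: "card (classes X (insert (a, b) (fgraph X ?f))) \<le> card (classes X (fgraph X ?f'))"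
      using F by (rule card_classes_antimono[OF X])
    show ?thesis
    proof (cases "(a, b) \<in> conn ?G'")
      \<comment> \<open>Inside one component, the new edge keeps the components and creates at most
        one more face; the two additional darts pay for it.\<close>
      case True
      then have "insert (a, b) ?G' \<subseteq> conn ?G'" by (auto intro: conn_base)
      then have "card (classes X ?G') \<le> card (classes X ?G)"
        unfolding eqG by (rule card_classes_antimono[OF X])
      moreover have "card (classes X (fgraph X ?f)) \<le> card (classes X (fgraph X ?f')) + 1"
        by (rule order_trans[OF card_classes_insert_le[OF X aX b(2)] add_right_mono[OF F1]])
      moreover have "2 * (v + f) \<le> m + 4 * k"
        if "k' \<le> k" "f \<le> f' + 1" "2 * (v + f') \<le> m' + 4 * k'" "m = m' + 2" for v f f' m m' k k' :: nat
        using that unfolding distrib_left by linarith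
      ultimately show ?thesis using IH card by blast
    next
      \<comment> \<open>Between two components, the new edge merges two faces: one face fewer lowers
        the left side by 2, and the right side changes by 2 for the darts and by -4 for the lost
        component.\<close>
      case ne: False
      have sub: "fgraph X ?f' \<subseteq> conn ?G'"
      proof -
        have "(x, ?f' x) \<in> conn ?G'" if "x \<in> X" for x
        proof -
          have "?e' x \<in> X" using that swap_on_permutes[OF S'] h permutes_in_image by metis
          then have "?f' x \<in> X" using s by (simp add: permutes_in_image permutes_inv)
          then have "(?f' x, ?e' x) \<in> conn ?G'"
            using s fgraphI[of "?f' x" X s] by (auto simp: permutes_inverses intro!: conn_base)
          moreover have "(x, ?e' x) \<in> conn ?G'" using that by (auto intro!: conn_base fgraphI)
          ultimately show ?thesis by (meson conn_sym conn_trans)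
        qed
        then show ?thesis by (auto simp: fgraph_def)
      qed
      have nf': "(a, b) \<notin> conn (fgraph X ?f')" using ne conn_least[OF sub] by auto
      then have "b \<notin> orbit ?f' a" using conn_perm[OF X f' aX] by simp
      then have "b \<in> orbit ?f a" unfolding f by (rule orbit_comp_transpose[OF perm])
      then have ab: "(a, b) \<in> conn (fgraph X ?f)" using conn_perm[OF X fp aX] by simp
      have "insert (a, b) (fgraph X ?f) \<subseteq> conn (fgraph X ?f)" using ab by (auto intro: conn_base)
      then have "insert (a, b) (fgraph X ?f') \<subseteq> conn (fgraph X ?f)"
        using subset_trans[OF F conn_least] ab by simp
      then have "card (classes X (fgraph X ?f)) \<le> card (classes X (insert (a, b) (fgraph X ?f')))"
        by (rule card_classes_antimono[OF X])
      then have "card (classes X (fgraph X ?f)) + 1 \<le> card (classes X (fgraph X ?f'))"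
        unfolding card_classes_insert[OF X aX b(2) nf', symmetric] by (rule add_right_mono)
      moreover have "card (classes X ?G') = card (classes X ?G) + 1"
        unfolding eqG card_classes_insert[OF X aX b(2) ne] ..
      moreover have "2 * (v + f) \<le> m + 4 * k"
        if "k' = k + 1" "f + 1 \<le> f'" "2 * (v + f') \<le> m' + 4 * k'" "m = m' + 2" for v f f' m m' k k' :: nat
        using that unfolding distrib_left by linarith
      ultimately show ?thesis using IH card by blast
    qed
  qed
qed

text \<open>Cutting a permutation along a cyclic sequence \<open>W\<close> of edges: each \<open>d \<in> W\<close> lies on a different
  cycle, and the other half of \<open>d\<close> lies on the cycle of the successor of \<open>d\<close>. The cycles met by
  \<open>W\<close> are rearranged into a left and a right side.\<close>

locale cut =
  fixes X :: "'a set" and r h nx :: "'a \<Rightarrow> 'a" and W :: "'a set"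
  assumes finX: "finite X" and r: "r permutes X"
    and h: "\<And>x. x \<in> X \<Longrightarrow> h (h x) = x" "\<And>x. x \<in> X \<Longrightarrow> h x \<in> X"
    and W: "W \<subseteq> X" "\<And>d. d \<in> W \<Longrightarrow> h d \<notin> W"
    and nx: "nx ` W = W"
    and h_orbit: "\<And>d. d \<in> W \<Longrightarrow> h d \<in> orbit r (nx d)"
    and inj: "\<And>d d'. d \<in> W \<Longrightarrow> d' \<in> W \<Longrightarrow> d' \<in> orbit r d \<Longrightarrow> d' = d"
begin

abbreviation "cutset \<equiv> W \<union> h ` W"
abbreviation "cut_perm \<equiv> r \<circ> swap_on h cutset"

lemma perm: "permutation r"
  using finX r permutation_permutes by blast

lemma cut_perm_permutes: "cut_perm permutes X"
proof (rule permutes_compose[OF swap_on_permutes r])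
  show "h ` cutset \<subseteq> cutset" using W h by auto
qed (use W h in auto)

lemma inj_nx: "d \<in> W \<Longrightarrow> d' \<in> W \<Longrightarrow> nx d = nx d' \<Longrightarrow> d = d'"
proof -
  have "finite W" using finX W finite_subset by blast
  then have "inj_on nx W" using nx by (simp add: eq_card_imp_inj_on)
  then show "d \<in> W \<Longrightarrow> d' \<in> W \<Longrightarrow> nx d = nx d' \<Longrightarrow> d = d'" by (meson inj_onD)
qed

lemma nx_in: "d \<in> W \<Longrightarrow> nx d \<in> W"
  using nx by auto

text \<open>If \<open>h d'\<close> lies on this cycle, so does \<open>nx d'\<close>; as
  \<open>W\<close> meets a cycle only once and \<open>nx\<close> is injective, \<open>d'\<close> is
  \<open>d\<close>. Hence \<open>nx d\<close> and \<open>h d\<close> divide the cycle into two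
  arcs.\<close>

lemma cutset_orbit:
  assumes "d \<in> W" "x \<in> orbit r (nx d)" "x \<in> cutset"
  shows "x = nx d \<or> x = h d"
proof (cases "x \<in> W")
  case True
  then show ?thesis using assms inj nx_in by blast
next
  case False
  then obtain d' where d': "d' \<in> W" "x = h d'" using assms by auto
  then have "orbit r (nx d) = orbit r x" "orbit r (nx d') = orbit r x"
    using assms(2) h_orbit[OF d'(1)] orbit_eq_iff[OF perm] by auto
  then have "nx d' \<in> orbit r (nx d)" using orbit_eq_iff[OF perm] by metis
  then have "nx d' = nx d" using inj nx_in assms d' by blast
  then show ?thesis using inj_nx assms d' by blast
qed

lemma swap_cutset:
  assumes "d \<in> W"
  shows "cut_perm d = r (h d)" "cut_perm (h d) = r d"
  using assms W h by (auto simp: swap_on_def)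

text \<open>One side of the cut: on the cycle of \<open>nx d\<close> it is the arc that starts just
  after \<open>nx d\<close> and includes its end \<open>h d\<close>. With these half-open arcs it is
  invariant under \<open>cut_perm\<close>, which sends \<open>h d\<close> to \<open>r d\<close>, the
  start of the arc after \<open>d\<close>.\<close>

definition "side = {x. \<exists>d\<in>W. \<exists>n>0. x = (r ^^ n) d \<and> (\<forall>m. 0 < m \<and> m < n \<longrightarrow> (r ^^ m) d \<notin> cutset)}"

lemma between:
  assumes "y \<in> orbit r x" "x \<noteq> y" "\<And>z. z \<in> orbit r x \<Longrightarrow> z \<in> cutset \<Longrightarrow> z = x \<or> z = y"
  obtains n where "n > 0" "y = (r ^^ n) x" "\<And>m. 0 < m \<Longrightarrow> m < n \<Longrightarrow> (r ^^ m) x \<notin> cutset"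
proof
  let ?n = "funpow_dist1 r x y"
  show y: "y = (r ^^ ?n) x" using funpow_dist1_prop[OF assms(1)] by simp
  show "(r ^^ m) x \<notin> cutset" if m: "0 < m" "m < ?n" for m
  proof
    assume "(r ^^ m) x \<in> cutset"
    moreover have "(r ^^ m) x \<in> orbit r x" using m by (auto simp: orbit_altdef)
    moreover have "(r ^^ m) x \<noteq> y" using m by (rule funpow_dist1_least)
    ultimately have "(r ^^ m) x = x" using assms(3) by blast
    then have "(r ^^ (?n - m)) x = (r ^^ (?n - m)) ((r ^^ m) x)" by simp
    also have "\<dots> = (r ^^ ?n) x" using m by (simp flip: funpow_add comp_apply[of "r ^^ _"])
    finally have "(r ^^ (?n - m)) x = y" using y by simp
    then show False using funpow_dist1_least[of "?n - m" r x y] m by simp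
  qed
qed simp

lemma chain:
  assumes "x \<in> X" "n > 0" "\<And>m. 0 < m \<Longrightarrow> m < n \<Longrightarrow> (r ^^ m) x \<notin> cutset"
  shows "(r x, (r ^^ n) x) \<in> conn (fgraph X cut_perm)"
  using assms(2,3)
proof (induction n)
  case (Suc n)
  show ?case
  proof (cases "n = 0")
    case False
    have "(r x, (r ^^ n) x) \<in> conn (fgraph X cut_perm)"
      by (rule Suc.IH) (use Suc.prems False in auto)
    also have "(r ^^ n) x \<in> X" using assms(1) r by (simp add: funpow_closed permutes_in_image)
    then have "((r ^^ n) x, cut_perm ((r ^^ n) x)) \<in> conn (fgraph X cut_perm)"
      by (rule conn_base[OF fgraphI])
    also have "cut_perm ((r ^^ n) x) = (r ^^ Suc n) x"
      using False Suc.prems(2)[of n] by (simp add: swap_on_def)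
    finally show ?thesis .
  qed simp
qed simp

text \<open>The cut sends \<open>d\<close> onto the arc that ends in \<open>nx d\<close>, and
  \<open>h (nx d)\<close> onto the arc that ends in \<open>h d\<close>. Iterated along a cyclic
  sequence, this keeps all darts of one side together.\<close>

lemma same_side:
  assumes d: "d \<in> W"
  shows "(d, nx d) \<in> conn (fgraph X cut_perm)" "(h d, h (nx d)) \<in> conn (fgraph X cut_perm)"
proof -
  have dX: "d \<in> X" "h d \<in> X" "nx d \<in> X" "h (nx d) \<in> X" using d W h nx_in[OF d] by auto
  have ne: "nx d \<noteq> h d" using d W nx_in by metis
  have orb: "orbit r (nx d) = orbit r (h d)" using h_orbit[OF d] orbit_eq_iff[OF perm] by auto
  then have nxh: "nx d \<in> orbit r (h d)" using orbit_eq_iff[OF perm] by metis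
  obtain n where n: "n > 0" "h d = (r ^^ n) (nx d)" "\<And>m. 0 < m \<Longrightarrow> m < n \<Longrightarrow> (r ^^ m) (nx d) \<notin> cutset"
    using between[OF h_orbit[OF d] ne cutset_orbit[OF d]] by blast
  obtain k where k: "k > 0" "nx d = (r ^^ k) (h d)" "\<And>m. 0 < m \<Longrightarrow> m < k \<Longrightarrow> (r ^^ m) (h d) \<notin> cutset"
    using between[OF nxh ne[symmetric]] cutset_orbit[OF d] unfolding orb by blast
  have "(d, r (h d)) \<in> conn (fgraph X cut_perm)"
    using conn_fgraph[OF dX(1), of cut_perm "{}"] swap_cutset[OF d] by simp
  also have "(r (h d), nx d) \<in> conn (fgraph X cut_perm)"
    using chain[OF dX(2) k(1,3)] k(2) by simp
  finally show "(d, nx d) \<in> conn (fgraph X cut_perm)" .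
  have "(h (nx d), r (nx d)) \<in> conn (fgraph X cut_perm)"
    using conn_fgraph[OF dX(4), of cut_perm "{}"] swap_cutset[OF nx_in[OF d]] by simp
  also have "(r (nx d), h d) \<in> conn (fgraph X cut_perm)"
    using chain[OF dX(3) n(1,3)] n(2) by simp
  finally show "(h d, h (nx d)) \<in> conn (fgraph X cut_perm)" by (rule conn_sym)
qed

lemma side_W: "d \<in> W \<Longrightarrow> h d \<in> side"
proof -
  assume d: "d \<in> W"
  have ne: "nx d \<noteq> h d" using d W nx_in by metis
  show "h d \<in> side"
  proof (rule between[OF h_orbit[OF d] ne cutset_orbit[OF d]])
    fix n assume "n > 0" "h d = (r ^^ n) (nx d)" "\<And>m. 0 < m \<Longrightarrow> m < n \<Longrightarrow> (r ^^ m) (nx d) \<notin> cutset"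
    then show "h d \<in> side" using nx_in[OF d] unfolding side_def by blast
  qed
qed

text \<open>A dart of \<open>W\<close> could lie in \<open>side\<close> only after a full turn
  around its own cycle, but the arc stops before that, at \<open>h d\<close> for the predecessor
  \<open>d\<close>.\<close>

lemma side_W': "x \<in> W \<Longrightarrow> x \<notin> side"
proof
  assume "x \<in> W" "x \<in> side"
  then obtain e n where e: "e \<in> W" "n > 0" "x = (r ^^ n) e"
    "\<And>m. 0 < m \<Longrightarrow> m < n \<Longrightarrow> (r ^^ m) e \<notin> cutset" by (auto simp: side_def)
  then have "x \<in> orbit r e" by (auto simp: orbit_altdef)
  then have "x = e" using \<open>x \<in> W\<close> e inj by blast
  obtain d where d: "d \<in> W" "nx d = e" using e(1) nx by (metis imageE)
  obtain k where k: "0 < k" "k \<le> n" "(r ^^ k) e = h d"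
  proof (rule that)
    show "funpow_dist1 r e (h d) \<le> n"
      using e \<open>x = e\<close> h_orbit[OF d(1)] d(2) by (intro funpow_dist1_le_self) auto
    show "(r ^^ funpow_dist1 r e (h d)) e = h d"
      using h_orbit[OF d(1)] d(2) by (intro funpow_dist1_prop) simp
  qed simp
  have "h d \<noteq> e" using W d e by metis
  then have "k \<noteq> n" using k(3) e(3) \<open>x = e\<close> by auto
  then have "(r ^^ k) e \<notin> cutset" using k(1,2) by (intro e(4)) auto
  then show False using k(3) d(1) by simp
qed

lemma side_invariant: "x \<in> side \<Longrightarrow> cut_perm x \<in> side"
proof -
  assume x: "x \<in> side"
  then obtain e n where e: "e \<in> W" "n > 0" "x = (r ^^ n) e"
    "\<And>m. 0 < m \<Longrightarrow> m < n \<Longrightarrow> (r ^^ m) e \<notin> cutset" by (auto simp: side_def)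
  show "cut_perm x \<in> side"
  proof (cases "x \<in> cutset")
    case True
    then obtain d where d: "d \<in> W" "x = h d" using side_W' x by auto
    then have "cut_perm x = (r ^^ 1) d" using swap_cutset by simp
    then show ?thesis using d(1) unfolding side_def
      by (intro CollectI bexI[of _ d] exI[of _ 1]) auto
  next
    case False
    then have "cut_perm x = (r ^^ Suc n) e" using e(3) by (simp add: swap_on_def)
    moreover have "(r ^^ m) e \<notin> cutset" if "0 < m" "m < Suc n" for m
      using that e False by (cases "m = n") auto
    ultimately show ?thesis using e(1) unfolding side_def by blast
  qed
qed

lemma orbit_cut_perm:
  assumes "orbit r x \<inter> W = {}"
  shows "orbit cut_perm x = orbit r x"
proof (rule orbit_cong)
  show "x \<in> orbit r x" by (rule permutation_self_in_orbit[OF perm])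
  fix s assume s: "s \<in> orbit r x"
  have "s \<notin> h ` W"
  proof
    assume "s \<in> h ` W"
    then obtain d where d: "d \<in> W" "s = h d" by auto
    then have "orbit r x = orbit r (nx d)"
      using s h_orbit[OF d(1)] orbit_eq_iff[OF perm] by metis
    then have "nx d \<in> orbit r x" using orbit_eq_iff[OF perm] by metis
    then show False using assms nx_in d by blast
  qed
  then show "cut_perm s = r s" using s assms by (auto simp: swap_on_def)
qed

text \<open>The cycles through \<open>W\<close>, one for each of its elements, are replaced by at
  least two, those of \<open>d\<close> and \<open>h d\<close>, which \<open>side\<close> keeps
  apart; all others survive. Since a cut also removes \<open>card W\<close> edges, the Euler
  characteristic grows by at least 2.\<close>

lemma card_cut:
  assumes "W \<noteq> {}"
  shows "card (classes X (fgraph X r)) + 2 \<le> card (classes X (fgraph X cut_perm)) + card W"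
proof -
  let ?O = "orbit r ` X" and ?OW = "orbit r ` W" and ?O' = "orbit cut_perm ` X"
  have perm': "permutation cut_perm" using cut_perm_permutes finX permutation_permutes by blast
  have "inj_on (orbit r) W"
    using inj orbit_eq_iff[OF perm] by (auto intro!: inj_onI)
  then have cardW: "card ?OW = card W" by (rule card_image)
  obtain d where d: "d \<in> W" using assms by auto
  have dX: "d \<in> X" "h d \<in> X" using d W h by auto
  have sub: "?O - ?OW \<subseteq> ?O'"
  proof clarify
    fix x assume "orbit r x \<notin> ?OW" "x \<in> X"
    then have "orbit r x \<inter> W = {}" using orbit_eq_iff[OF perm] by auto
    then show "orbit r x \<in> ?O'" using orbit_cut_perm \<open>x \<in> X\<close> by (metis imageI)
  qed
  have no: "K \<inter> cutset = {}" if K: "K \<in> ?O - ?OW" for K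
  proof -
    obtain x where x: "K = orbit r x" using K by auto
    have "orbit r e \<in> ?OW" if e: "e \<in> cutset" for e
    proof (cases "e \<in> W")
      case False
      then obtain d where d: "d \<in> W" "e = h d" using e by auto
      then have "orbit r e = orbit r (nx d)" using h_orbit orbit_eq_iff[OF perm] by metis
      then show ?thesis using nx_in d by auto
    qed simp
    then have "e \<notin> K" if "e \<in> cutset" for e
      using K that orbit_eq_iff[OF perm, of x e] unfolding x by auto
    then show ?thesis by blast
  qed
  have self: "e \<in> orbit cut_perm e" for e by (rule permutation_self_in_orbit[OF perm'])
  have ne: "orbit cut_perm d \<noteq> orbit cut_perm (h d)"
  proof
    assume "orbit cut_perm d = orbit cut_perm (h d)"
    then have "d \<in> orbit cut_perm (h d)" using self by metis
    then obtain n where "d = (cut_perm ^^ n) (h d)" by (auto simp: orbit_altdef)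
    then have "d \<in> side"
      using funpow_closed[of side cut_perm "h d" n] side_W[OF d] side_invariant by simp
    then show False using side_W' d by blast
  qed
  have "card (insert (orbit cut_perm d) (insert (orbit cut_perm (h d)) (?O - ?OW))) = card (?O - ?OW) + 2"
  proof -
    have "d \<in> orbit cut_perm d \<inter> cutset" "h d \<in> orbit cut_perm (h d) \<inter> cutset"
      using self d by auto
    then have "orbit cut_perm d \<notin> ?O - ?OW" "orbit cut_perm (h d) \<notin> ?O - ?OW"
      using no[of "orbit cut_perm d"] no[of "orbit cut_perm (h d)"] by auto
    then show ?thesis
      using ne finX
      by (simp add: card_insert_disjoint del: comp_apply)
  qed
  moreover have "card (insert (orbit cut_perm d) (insert (orbit cut_perm (h d)) (?O - ?OW))) \<le> card ?O'"
    using sub dX finX by (intro card_mono) auto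
  moreover have "card (?O - ?OW) = card ?O - card ?OW"
    using W(1) finX finite_subset by (intro card_Diff_subset) auto
  moreover have "card ?OW \<le> card ?O" using W(1) finX by (intro card_mono) auto
  ultimately show ?thesis
    unfolding classes_perm[OF finX r] classes_perm[OF finX cut_perm_permutes] cardW by linarith
qed

end

section \<open>Corner labels\<close>

lemma color_cases:
  fixes i j :: color
  obtains "j = i" | "j = i + 1" | "j = i - 1"
proof -
  have *: "x = 0 \<or> x = 1 \<or> x = 2" for x :: color
  proof (induct x)
    case (of_int z)
    then have "z = 0 \<or> z = 1 \<or> z = 2" by fastforce
    then show ?case by auto
  qed
  have "j = i \<or> j = i + 1 \<or> j = i - 1"
    using *[of i] *[of j] by auto
  then show thesis using that by blast
qed

lemma color_ne [simp]:
  fixes i :: color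
  shows "i + 1 \<noteq> i - 1" "i - 1 \<noteq> i + 1" "i - 1 \<noteq> i" "i \<noteq> i - 1" "i + 1 \<noteq> i" "i \<noteq> i + 1"
  by simp_all

locale comb_map =
  fixes M :: "'d cmap"
  assumes comb: "combinatorial_map M"
begin

abbreviation "X \<equiv> darts M"

lemma finX: "finite X"
  and rot_perm: "rot M permutes X"
  and opp_perm: "opp M permutes X"
  and opp_ne: "x \<in> X \<Longrightarrow> opp M x \<noteq> x"
  using comb by (auto simp: combinatorial_map_def)

lemma opp_opp [simp]: "opp M (opp M x) = x"
proof (cases "x \<in> X")
  case True
  then show ?thesis using comb by (auto simp: combinatorial_map_def)
qed (use opp_perm in \<open>simp add: permutes_not_in\<close>)

lemma opp_in [simp]: "opp M x \<in> X \<longleftrightarrow> x \<in> X"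
  using opp_perm by (rule permutes_in_image)

lemma rot_in [simp]: "rot M x \<in> X \<longleftrightarrow> x \<in> X"
  using rot_perm by (rule permutes_in_image)

lemma inv_rot_in [simp]: "inv (rot M) x \<in> X \<longleftrightarrow> x \<in> X"
  using permutes_inv[OF rot_perm] by (rule permutes_in_image)

lemma rot_inv [simp]: "rot M (inv (rot M) x) = x" "inv (rot M) (rot M x) = x"
  using rot_perm by (simp_all add: permutes_inverses)

lemma perm_rot: "permutation (rot M)"
  using finX rot_perm permutation_permutes by blast

lemma face_next_perm: "face_next M permutes X"
  unfolding face_next_def by (intro permutes_compose opp_perm permutes_inv rot_perm)

lemma face_next_in [simp]: "face_next M x \<in> X \<longleftrightarrow> x \<in> X"
  using face_next_perm by (rule permutes_in_image)

lemma rot_face_next [simp]: "rot M (face_next M x) = opp M x"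
  by (simp add: face_next_def)

lemma comb_dual: "combinatorial_map (dual_map M)"
  using comb face_next_perm by (auto simp: combinatorial_map_def dual_map_def)

lemma origin_self [simp]: "x \<in> origin M x"
  unfolding origin_def by (rule permutation_self_in_orbit[OF perm_rot])

lemma origin_eq: "y \<in> origin M x \<longleftrightarrow> origin M y = origin M x"
  unfolding origin_def using orbit_eq_iff[OF perm_rot, of x y] by auto

lemma origin_rot [simp]: "origin M (rot M x) = origin M x"
  unfolding origin_def by (rule permutation_orbit_step[OF perm_rot])

lemma origin_funpow [simp]: "origin M ((rot M ^^ n) x) = origin M x"
  by (induction n) auto

lemma origin_inv_rot [simp]: "origin M (inv (rot M) x) = origin M x"
  using origin_rot[of "inv (rot M) x"] by simp

lemma origin_face_next [simp]: "origin M (face_next M x) = origin M (opp M x)"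
  by (simp add: face_next_def)

lemma origin_sub: "x \<in> X \<Longrightarrow> y \<in> origin M x \<Longrightarrow> y \<in> X"
  unfolding origin_def using permutes_orbit_subset[OF rot_perm] by blast

lemma origin_funpowE:
  assumes "origin M y = origin M x"
  obtains n where "y = (rot M ^^ n) x"
proof -
  have "y \<in> orbit (rot M) x" using assms origin_eq by (simp add: origin_def)
  then show thesis using that by (auto simp: orbit_altdef)
qed

lemma vertices_eq: "v \<in> vertices M \<longleftrightarrow> (\<exists>x\<in>X. v = origin M x)"
  by (auto simp: vertices_def)

end

text \<open>The label of a dart belongs to the corner on its left: the corner between the outgoing edges of
  colors \<open>i + 1\<close> and \<open>i - 1\<close>, in which the edges of color \<open>i\<close> enter, has label \<open>i\<close>.\<close>

locale labelled_map = comb_map M for M :: "'d cmap" +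
  fixes c :: "'d \<Rightarrow> color option" and lab :: "'d \<Rightarrow> color"
  assumes co: "colored_orientation M c"
    and unique: "\<And>x i. x \<in> X \<Longrightarrow> \<exists>!y. y \<in> origin M x \<and> c y = Some i"
    and lab_None: "\<And>x. x \<in> X \<Longrightarrow> c (rot M x) = None \<Longrightarrow> lab (rot M x) = lab x"
    and lab_Some: "\<And>x i. x \<in> X \<Longrightarrow> c (rot M x) = Some i \<Longrightarrow> lab x = i + 1 \<and> lab (rot M x) = i - 1"
    and lab_enter: "\<And>x i. x \<in> X \<Longrightarrow> c x = None \<Longrightarrow> c (opp M x) = Some i \<Longrightarrow> lab x = i"

definition out :: "'d cmap \<Rightarrow> ('d \<Rightarrow> color option) \<Rightarrow> color \<Rightarrow> 'd \<Rightarrow> 'd" where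
  "out M c i x = (THE y. y \<in> origin M x \<and> c y = Some i)"

definition step :: "'d cmap \<Rightarrow> ('d \<Rightarrow> color option) \<Rightarrow> color \<Rightarrow> 'd \<Rightarrow> 'd" where
  "step M c i x = out M c i (opp M x)"

text \<open>A vertex has one outgoing edge of each color, so following color \<open>i\<close> is the
  function \<open>step\<close>, and the monochromatic cycles are its periodic orbits. Iteration thus
  replaces lists of darts.\<close>

definition recurrent :: "'d cmap \<Rightarrow> ('d \<Rightarrow> color option) \<Rightarrow> color \<Rightarrow> 'd \<Rightarrow> bool" where
  "recurrent M c i x \<longleftrightarrow> x \<in> darts M \<and> c x = Some i \<and> (\<exists>n>0. (step M c i ^^ n) x = x)"

text \<open>This is (T2) in terms of periodic orbits. Writing both neighbouring colors as
  \<open>i + s\<close> lets all later arguments treat them at once.\<close>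

definition cycles_meet :: "'d cmap \<Rightarrow> ('d \<Rightarrow> color option) \<Rightarrow> bool" where
  "cycles_meet M c \<longleftrightarrow> (\<forall>i s x. s \<noteq> 0 \<and> recurrent M c i x \<longrightarrow>
     (\<exists>n. recurrent M c (i + s) (out M c (i + s) ((step M c i ^^ n) x))))"

section \<open>From (T1) to corner labels\<close>

context comb_map
begin

lemma labelled_map_exists:
  assumes co: "colored_orientation M c" and T1: "schnyder_T1 M c"
  shows "\<exists>lab. labelled_map M c lab"
proof -
  let ?r = "rot M"
  define Q where "Q lab x \<longleftrightarrow>
      (c (?r x) = None \<longrightarrow> lab (?r x) = lab x) \<and>
      (\<forall>i. c (?r x) = Some i \<longrightarrow> lab x = i + 1 \<and> lab (?r x) = i - (1::color)) \<and>
      (\<forall>i. c x = None \<and> c (opp M x) = Some i \<longrightarrow> lab x = i)" for lab x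
  have local: "\<exists>lab. \<forall>x\<in>v. Q lab x"
    if v: "v \<in> vertices M" for v
  proof -
    obtain e where E: "(\<forall>i. {d \<in> v. c d = Some i} = {e i}) \<and> e 1 \<in> ccw_sector M (e 0) (e 2) \<and>
        (\<forall>i. \<forall>d\<in>v. c (opp M d) = Some i \<longrightarrow> d \<in> ccw_sector M (e (i + 1)) (e (i - 1)))"
      using bspec[OF T1[unfolded schnyder_T1_def] v] by (rule exE)
    have e: "{d \<in> v. c d = Some i} = {e i}" for i using E by blast
    have e1: "e 1 \<in> ccw_sector M (e 0) (e 2)" using E by blast
    have enter: "d \<in> ccw_sector M (e (i + 1)) (e (i - 1))" if "d \<in> v" "c (opp M d) = Some i" for i d
      using E that by blast
    have ev: "e i \<in> v" "c (e i) = Some i" for i using e[of i] by auto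
    have eu: "x = e i" if "x \<in> v" "c x = Some i" for x i using e[of i] that by auto
    have v0: "v = origin M (e 0)"
      using v ev(1)[of 0] by (auto simp: vertices_eq origin_eq)
    have self: "e 0 \<in> orbit ?r (e 0)" by (rule permutation_self_in_orbit[OF perm_rot])
    define N where "N = funpow_dist1 ?r (e 0) (e 0)"
    have N0: "N > 0" by (simp add: N_def)
    have vN: "v = (\<lambda>n. (?r ^^ n) (e 0)) ` {0..<N}"
      unfolding v0 origin_def N_def by (rule orbit_conv_funpow_dist1[OF self])
    have inj: "m = n" if "(?r ^^ m) (e 0) = (?r ^^ n) (e 0)" "m < N" "n < N" for m n
      using inj_on_funpow_dist1[OF self] that unfolding N_def[symmetric] by (auto dest: inj_onD)
    have rN: "(?r ^^ N) (e 0) = e 0" unfolding N_def by (rule funpow_dist1_prop[OF self])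
    obtain b where b: "b < N" "e 2 = (?r ^^ b) (e 0)" using ev(1)[of 2] vN by auto
    obtain a where a: "e 1 = (?r ^^ a) (e 0)" "\<And>j. j < a \<Longrightarrow> (?r ^^ j) (e 0) \<noteq> e 2"
      using e1 by (auto simp: ccw_sector_def)
    have "e 1 \<noteq> e 2" "e 1 \<noteq> e 0" "e 2 \<noteq> e 0" using ev(2)[of 1] ev(2)[of 2] ev(2)[of 0] by auto
    then have "a \<noteq> b" and ab: "0 < a" using a(1) b(2) by (auto intro: gr0I)
    \<comment> \<open>The sector from \<open>e 0\<close> to \<open>e 1\<close> does not pass
      \<open>e 2\<close>, which is at position \<open>b\<close>.\<close>
    then have ab: "0 < a" "a < b" using a(2)[of b] b(2) ab by (cases a b rule: linorder_cases; simp)+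
    have "\<forall>x\<in>v. \<exists>n. n < N \<and> (?r ^^ n) (e 0) = x" using vN by auto
    then obtain pos where pos: "\<And>x. x \<in> v \<Longrightarrow> pos x < N \<and> (?r ^^ pos x) (e 0) = x" by metis
    have pos_eq: "pos ((?r ^^ n) (e 0)) = n" if "n < N" for n
      using pos[of "(?r ^^ n) (e 0)"] that inj vN by auto
    \<comment> \<open>The outgoing edges of colors 0, 1, 2 stand at positions 0, \<open>a\<close>,
      \<open>b\<close>; the corners that follow them have labels 2, 0, 1, as corner \<open>i\<close>
      follows the edge of color \<open>i + 1\<close>.\<close>
    define lab :: "'d \<Rightarrow> color" where
      "lab x = (if pos x < a then 2 else if pos x < b then 0 else 1)" for x
    have pos_e: "pos (e 0) = 0" "pos (e 1) = a" "pos (e 2) = b"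
      using pos_eq[of 0] pos_eq[of a] pos_eq[of b] N0 ab b a by auto
    have r_in: "?r x \<in> v" if "x \<in> v" for x using that unfolding v0 origin_eq by simp
    have next_pos: "(?r x = e 0 \<and> Suc (pos x) = N) \<or> (?r x \<noteq> e 0 \<and> pos (?r x) = Suc (pos x))"
      if x: "x \<in> v" for x
    proof -
      have rx: "?r x = (?r ^^ Suc (pos x)) (e 0)" using pos[OF x] by simp
      show ?thesis
      proof (cases "Suc (pos x) = N")
        case True
        then show ?thesis using rx rN by simp
      next
        case False
        then have "Suc (pos x) < N" using pos[OF x] by auto
        then have "pos (?r x) = Suc (pos x)" using pos_eq rx by metis
        then show ?thesis using pos_e(1) by auto
      qed
    qed
    have 1: "lab (?r x) = lab x" if x: "x \<in> v" and "c (?r x) = None" for x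
    proof -
      have ne: "?r x \<noteq> e i" for i using ev(2)[of i] that by auto
      have "e 1 = ?r x" if "pos (?r x) = a" using pos[OF r_in[OF x]] a(1) unfolding that by metis
      moreover have "e 2 = ?r x" if "pos (?r x) = b" using pos[OF r_in[OF x]] b(2) unfolding that by metis
      ultimately have "pos (?r x) \<noteq> a" "pos (?r x) \<noteq> b" "?r x \<noteq> e 0"
        using ne[of 0] ne[of 1] ne[of 2] by metis+
      then show ?thesis using next_pos[OF x] by (auto simp: lab_def)
    qed
    have 2: "lab x = i + 1 \<and> lab (?r x) = i - 1" if x: "x \<in> v" and "c (?r x) = Some i" for x i
    proof -
      have rx: "?r x = e i" using eu r_in that by blast
      have ne: "e 1 \<noteq> e 0" "e 2 \<noteq> e 0" by fact+
      have two: "(0::color) - 1 = 2" by simp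
      consider "i = 0" | "i = 0 + 1" | "i = 0 - 1" by (rule color_cases[of i 0])
      then show ?thesis
      proof cases
        case 1
        then have "Suc (pos x) = N" "pos (?r x) = 0" using next_pos[OF x] rx pos_e by auto
        then show ?thesis using 1 ab b(1) by (auto simp: lab_def)
      next
        case 2
        then have "Suc (pos x) = a" "pos (?r x) = a" using next_pos[OF x] rx pos_e ne by auto
        then show ?thesis using 2 ab by (auto simp: lab_def)
      next
        case 3
        then have "Suc (pos x) = b" "pos (?r x) = b"
          using next_pos[OF x] rx pos_e ne unfolding two by auto
        then show ?thesis using 3 ab by (auto simp: lab_def)
      qed
    qed
    have 3: "lab x = i" if x: "x \<in> v" and cx: "c x = None" "c (opp M x) = Some i" for x i
    proof -
      obtain k where k: "x = (?r ^^ k) (e (i + 1))" "\<And>j. j < k \<Longrightarrow> (?r ^^ j) (e (i + 1)) \<noteq> e (i - 1)"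
        using enter[OF x cx(2)] by (auto simp: ccw_sector_def)
      have in_v: "(?r ^^ j) (e (i + 1)) \<in> v" for j
        using ev(1)[of "i + 1"] unfolding v0 origin_eq by simp
      have "lab ((?r ^^ j) (e (i + 1))) = i" if "j \<le> k" for j
        using that
      proof (induction j)
        case 0
        let ?y = "inv ?r (e (i + 1))"
        have "?y \<in> v" using ev(1)[of "i + 1"] unfolding v0 origin_eq by simp
        then show ?case using 2[of ?y "i + 1"] ev(2) by simp
      next
        case (Suc j)
        let ?y = "(?r ^^ j) (e (i + 1))"
        have y: "lab ?y = i" "?y \<in> v" using Suc in_v by auto
        \<comment> \<open>The sector is closed, so its condition says nothing about the last dart
          \<open>x\<close>; that one is not \<open>e (i - 1)\<close> because it carries no
          color.\<close>
        have ne: "?r ?y \<noteq> e (i - 1)"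
          using k(2)[of "Suc j"] Suc.prems cx(1) k(1) ev(2)[of "i - 1"] 
          by (cases "Suc j = k") auto
        show ?case
        proof (cases "c (?r ?y)")
          case None
          then show ?thesis using 1[OF y(2)] y by simp
        next
          case (Some m)
          then have "i = m + 1" using 2[OF y(2)] y by auto
          then show ?thesis using eu[OF r_in[OF y(2)] Some] ne by simp
        qed
      qed
      then show ?thesis using k by auto
    qed
    show ?thesis using 1 2 3 unfolding Q_def by (intro exI[of _ lab]) simp
  qed
  then have "\<forall>v\<in>vertices M. \<exists>lab. \<forall>x\<in>v. Q lab x" by blast
  then obtain L where L: "\<forall>v\<in>vertices M. \<forall>x\<in>v. Q (L v) x" by (rule bchoice[THEN exE])
  have L': "Q (L (origin M x)) x" if "x \<in> X" for x
  proof -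
    have "origin M x \<in> vertices M" using that by (auto simp: vertices_eq)
    then show ?thesis using L origin_self by blast
  qed
  have "\<exists>!y. y \<in> origin M x \<and> c y = Some i" if xX: "x \<in> X" for x i
  proof -
    obtain e where e: "\<forall>i. {d \<in> origin M x. c d = Some i} = {e i}"
      using bspec[OF T1[unfolded schnyder_T1_def], OF imageI[OF xX, of "origin M", folded vertices_def]]
      by (elim exE conjE)
    have "y \<in> origin M x \<and> c y = Some i \<longleftrightarrow> y = e i" for y using spec[OF e, of i] by blast
    then show ?thesis by simp
  qed
  then have "labelled_map M c (\<lambda>x. L (origin M x) x)"
  proof unfold_locales
    fix x i assume x: "x \<in> X"
    note q = L'[OF x, unfolded Q_def]
    show "L (origin M (rot M x)) (rot M x) = L (origin M x) x" if "c (rot M x) = None"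
      using q that by simp
    show "L (origin M x) x = i + 1 \<and> L (origin M (rot M x)) (rot M x) = i - 1" if "c (rot M x) = Some i"
      using q that by simp
    show "L (origin M x) x = i" if "c x = None" "c (opp M x) = Some i"
      using q that by simp
  qed (use co in simp)
  then show ?thesis by blast
qed

end

lemma ccw_sectorI:
  "y = (rot M ^^ k) a \<Longrightarrow> (\<And>j. j < k \<Longrightarrow> (rot M ^^ j) a \<noteq> b) \<Longrightarrow> y \<in> ccw_sector M a b"
  unfolding ccw_sector_def by blast

section \<open>From corner labels back to (T1)\<close>

context labelled_map
begin

abbreviation "out_dart \<equiv> out M c"
abbreviation "nxt \<equiv> step M c"
abbreviation "rec \<equiv> recurrent M c"

lemma out:
  assumes "x \<in> X"
  shows "origin M (out_dart i x) = origin M x" "c (out_dart i x) = Some i" "out_dart i x \<in> X"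
proof -
  have "out_dart i x \<in> origin M x \<and> c (out_dart i x) = Some i"
    unfolding out_def using unique[OF assms] by (rule theI')
  then show "origin M (out_dart i x) = origin M x" "c (out_dart i x) = Some i" "out_dart i x \<in> X"
    using origin_eq origin_sub assms by auto
qed

lemma out_unique:
  assumes "x \<in> X" "origin M y = origin M x" "c y = Some i"
  shows "y = out_dart i x"
  using unique[OF assms(1), of i] out[OF assms(1), of i] assms(2,3) unfolding origin_eq by blast

lemma out_eqI: "x \<in> X \<Longrightarrow> origin M x = origin M y \<Longrightarrow> c x = Some i \<Longrightarrow> c y = Some i \<Longrightarrow> x = y"
  using out_unique origin_sub by (metis origin_self)

lemma lab_self: "x \<in> X \<Longrightarrow> c x = Some i \<Longrightarrow> lab x = i - 1"
  using lab_Some[of "inv (rot M) x" i] by simp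

lemma c_opp_ne: "x \<in> X \<Longrightarrow> c x = Some i \<Longrightarrow> c (opp M x) \<noteq> Some i"
  using co by (auto simp: colored_orientation_def)

lemma c_not_both_None: "x \<in> X \<Longrightarrow> c x = None \<Longrightarrow> c (opp M x) \<noteq> None"
  using co unfolding colored_orientation_def by metis

text \<open>The label becomes \<open>i\<close> only at the outgoing edge of color
  \<open>i + 1\<close>. In the induction on the number of rotations the count restarts whenever this
  edge is passed. This translates labels back into sectors.\<close>

lemma lab_sector:
  assumes "x \<in> X" "lab x = i"
  shows "\<exists>k. x = (rot M ^^ k) (out_dart (i + 1) x) \<and> (\<forall>j\<le>k. lab ((rot M ^^ j) (out_dart (i + 1) x)) = i)"
proof -
  let ?e = "out_dart (i + 1) x"
  obtain n where n: "x = (rot M ^^ n) ?e"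
    using origin_funpowE[of x ?e] out[OF assms(1)] by metis
  have eX: "(rot M ^^ m) ?e \<in> X" for m
    using out(3)[OF assms(1), of "i + 1"] by (simp add: funpow_closed)
  have "\<exists>k. (rot M ^^ m) ?e = (rot M ^^ k) ?e \<and> (\<forall>j\<le>k. lab ((rot M ^^ j) ?e) = i)"
    if "lab ((rot M ^^ m) ?e) = i" for m
    using that
  proof (induction m)
    case 0
    then show ?case by (intro exI[of _ 0]) auto
  next
    case (Suc m)
    let ?y = "(rot M ^^ m) ?e"
    show ?case
    proof (cases "c (rot M ?y)")
      case None
      then have "lab ?y = i" using lab_None[OF eX[of m]] Suc.prems by simp
      then obtain k where k: "?y = (rot M ^^ k) ?e" "\<forall>j\<le>k. lab ((rot M ^^ j) ?e) = i"
        using Suc.IH by blast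
      have eq: "(rot M ^^ Suc m) ?e = (rot M ^^ Suc k) ?e" using k(1) by simp
      have "lab ((rot M ^^ j) ?e) = i" if "j \<le> Suc k" for j
        using k(2) Suc.prems that unfolding eq by (cases "j = Suc k") auto
      then show ?thesis using eq by blast
    next
      case (Some m')
      then have "i = m' - 1" using lab_Some[OF eX[of m]] Suc.prems by auto
      then have "c (rot M ?y) = Some (i + 1)" using Some by simp
      then have "rot M ?y = ?e"
        by (intro out_unique[OF assms(1)]) (simp_all add: out(1)[OF assms(1)])
      then have eq: "(rot M ^^ Suc m) ?e = (rot M ^^ 0) ?e" by simp
      show ?thesis
        using Suc.prems unfolding eq by (intro exI[of _ "0::nat"]) auto
    qed
  qed
  from this[of n] show ?thesis using n assms(2) by simp
qed

text \<open>The three versions serve, in this order, edges that only enter, edges in two directions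
  on the far border of a sector, and the cyclic order of the outgoing edges.\<close>

lemma lab_sector_ccw:
  assumes "x \<in> X" "lab x = i"
  shows "x \<in> ccw_sector M (out_dart (i + 1) x) (out_dart (i - 1) x)"
    "rot M x \<in> ccw_sector M (out_dart (i + 1) x) (out_dart (i - 1) x)"
    "rot M x \<in> ccw_sector M (out_dart (i + 1) x) (out_dart i x)"
proof -
  let ?e = "out_dart (i + 1) x"
  obtain k where k: "x = (rot M ^^ k) ?e" "\<And>j. j \<le> k \<Longrightarrow> lab ((rot M ^^ j) ?e) = i"
    using lab_sector[OF assms] by blast
  have ne: "(rot M ^^ j) ?e \<noteq> out_dart (i - 1) x \<and> (rot M ^^ j) ?e \<noteq> out_dart i x" if "j \<le> k" for j
    using k(2)[OF that] lab_self out(2,3)[OF assms(1)] by auto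
  have "rot M x = (rot M ^^ Suc k) ?e" using arg_cong[OF k(1), of "rot M"] by simp
  then show "rot M x \<in> ccw_sector M ?e (out_dart (i - 1) x)" "rot M x \<in> ccw_sector M ?e (out_dart i x)"
    by (rule ccw_sectorI; use ne in simp)+
  show "x \<in> ccw_sector M ?e (out_dart (i - 1) x)"
    using k(1) by (rule ccw_sectorI) (use ne in simp)
qed

lemma out_cong: "origin M x = origin M y \<Longrightarrow> out_dart i x = out_dart i y"
  by (simp add: out_def)

lemma schnyder_T1: "schnyder_T1 M c"
  unfolding schnyder_T1_def
proof
  fix v assume "v \<in> vertices M"
  then obtain x where x: "x \<in> X" "v = origin M x" by (auto simp: vertices_eq)
  let ?e = "\<lambda>i. out_dart i x"
  have vX: "y \<in> X \<and> origin M y = origin M x" if "y \<in> v" for y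
    using that x origin_sub origin_eq by auto
  show "\<exists>e. (\<forall>i. {d \<in> v. c d = Some i} = {e i}) \<and> e 1 \<in> ccw_sector M (e 0) (e 2) \<and>
    (\<forall>i. \<forall>d\<in>v. c (opp M d) = Some i \<longrightarrow> d \<in> ccw_sector M (e (i + 1)) (e (i - 1)))"
  proof (intro exI[of _ ?e] conjI allI ballI impI)
    have "y \<in> v \<and> c y = Some i \<longleftrightarrow> y = ?e i" for i y
      using out[OF x(1), of i] out_unique[OF x(1), of y i] x(2) by (auto simp: origin_eq)
    then show "{d \<in> v. c d = Some i} = {?e i}" for i by auto
    let ?y = "inv (rot M) (?e 1)"
    have y: "?y \<in> X" "origin M ?y = origin M x" using out[OF x(1)] by auto
    then have laby: "lab ?y = 2" using lab_Some[of ?y 1] out[OF x(1)] by simp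
    have "(2::color) + 1 = 0" by simp
    from lab_sector_ccw(3)[OF y(1) laby, unfolded this]
    show "?e 1 \<in> ccw_sector M (?e 0) (?e 2)" by (simp add: out_cong[OF y(2)])
    fix i d assume d: "d \<in> v" "c (opp M d) = Some i"
    then have dX: "d \<in> X" "origin M d = origin M x" using vX by auto
    show "d \<in> ccw_sector M (?e (i + 1)) (?e (i - 1))"
    proof (cases "c d")
      case None
      then show ?thesis
        using lab_sector_ccw(1)[OF dX(1), of i] lab_enter[OF dX(1) None d(2)] by (simp add: out_cong[OF dX(2)])
    next
      case (Some j)
      have dj: "d = ?e j" using out_unique[OF x(1) dX(2) Some] .
      consider "j = i" | "j = i + 1" | "j = i - 1" by (rule color_cases)
      then show ?thesis
      proof cases
        case 1
        then show ?thesis using c_opp_ne[OF dX(1) Some] d(2) by simp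
      next
        case 2
        then show ?thesis using dj unfolding ccw_sector_def by (auto intro!: exI[of _ 0])
      next
        case 3
        let ?z = "inv (rot M) d"
        have z: "?z \<in> X" "origin M ?z = origin M x" using dX by auto
        have "lab ?z = i" using lab_Some[of ?z j] Some 3 z by simp
        then show ?thesis
          using lab_sector_ccw(2)[OF z(1), of i] by (simp add: out_cong[OF z(2)])
      qed
    qed
  qed
qed

end

section \<open>Monochromatic cycles as recurrent darts\<close>

context labelled_map
begin

lemma nxt:
  assumes "x \<in> X"
  shows "nxt i x \<in> X" "c (nxt i x) = Some i" "origin M (nxt i x) = origin M (opp M x)"
  using out[of "opp M x" i] assms by (simp_all add: step_def)

lemma nxt_eqI: "x \<in> X \<Longrightarrow> c y = Some i \<Longrightarrow> origin M y = origin M (opp M x) \<Longrightarrow> nxt i x = y"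
  using out_unique[of "opp M x" y i] by (simp add: step_def)

lemma nxt_funpow:
  assumes "x \<in> X" "c x = Some i"
  shows "(nxt i ^^ n) x \<in> X" "c ((nxt i ^^ n) x) = Some i"
proof -
  have "(nxt i ^^ n) x \<in> X \<and> c ((nxt i ^^ n) x) = Some i"
    by (induction n) (use assms nxt in auto)
  then show "(nxt i ^^ n) x \<in> X" "c ((nxt i ^^ n) x) = Some i" by auto
qed

lemma rec_in: "rec i x \<Longrightarrow> x \<in> X" "rec i x \<Longrightarrow> c x = Some i"
  by (simp_all add: recurrent_def)

lemma rec_funpow: "rec i x \<Longrightarrow> rec i ((nxt i ^^ n) x)"
proof -
  assume x: "rec i x"
  then obtain k where k: "k > 0" "(nxt i ^^ k) x = x" by (auto simp: recurrent_def)
  have "(nxt i ^^ k) ((nxt i ^^ n) x) = (nxt i ^^ n) ((nxt i ^^ k) x)"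
    by (simp add: add.commute flip: funpow_add comp_apply[of "nxt i ^^ _"])
  then show ?thesis using k nxt_funpow rec_in[OF x] unfolding recurrent_def by auto
qed

text \<open>A path of color \<open>i\<close> in a finite map repeats a dart, and from then on it
  runs around a cycle.\<close>

lemma eventually_rec:
  assumes "x \<in> X" "c x = Some i"
  shows "\<exists>n. rec i ((nxt i ^^ n) x)"
proof -
  have "range (\<lambda>n. (nxt i ^^ n) x) \<subseteq> X" using nxt_funpow[OF assms] by auto
  then have "finite (range (\<lambda>n. (nxt i ^^ n) x))" using finX finite_subset by blast
  then have "\<not> inj (\<lambda>n. (nxt i ^^ n) x)" using finite_imageD by blast
  then obtain m n where mn: "m < n" "(nxt i ^^ m) x = (nxt i ^^ n) x"
    by (metis (mono_tags, lifting) injI linorder_cases)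
  have "(nxt i ^^ (n - m)) ((nxt i ^^ m) x) = (nxt i ^^ (n - m + m)) x"
    by (simp only: funpow_add comp_apply)
  also have "\<dots> = (nxt i ^^ m) x" using mn by simp
  finally have "(nxt i ^^ (n - m)) ((nxt i ^^ m) x) = (nxt i ^^ m) x" .
  then have "rec i ((nxt i ^^ m) x)"
    using mn(1) nxt_funpow[OF assms] unfolding recurrent_def by (auto intro!: exI[of _ "n - m"])
  then show ?thesis by blast
qed

definition cyc :: "color \<Rightarrow> 'd \<Rightarrow> 'd set" where
  "cyc i x = range (\<lambda>n. (nxt i ^^ n) x)"

lemma cyc_self [simp]: "x \<in> cyc i x"
  unfolding cyc_def by (rule range_eqI[of _ _ 0]) simp

lemma cyc_rec: "rec i x \<Longrightarrow> y \<in> cyc i x \<Longrightarrow> rec i y"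
  by (auto simp: cyc_def rec_funpow)

lemma cyc_back:
  assumes "rec i x" "y \<in> cyc i x"
  obtains n where "x = (nxt i ^^ n) y"
proof -
  obtain k where k: "k > 0" "(nxt i ^^ k) x = x" using assms by (auto simp: recurrent_def)
  obtain m where m: "y = (nxt i ^^ m) x" using assms by (auto simp: cyc_def)
  have per: "(nxt i ^^ (k * m)) x = x"
    by (induction m) (use k in \<open>simp_all add: funpow_add\<close>)
  \<comment> \<open>Going back \<open>m\<close> steps is the same as going on to the end of the
    \<open>m\<close>-th period of length \<open>k\<close>.\<close>
  have "(nxt i ^^ (k * m - m)) y = (nxt i ^^ (k * m)) x"
    using k(1) unfolding m by (simp flip: funpow_add comp_apply[of "nxt i ^^ _"])
  then show thesis using that per by metis
qed

lemma cyc_eq: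
  assumes "rec i x" "y \<in> cyc i x"
  shows "cyc i y = cyc i x"
proof -
  have sub: "cyc i b \<subseteq> cyc i a" if "b = (nxt i ^^ n) a" for a b n
    unfolding cyc_def that by (auto simp flip: funpow_add comp_apply[of "nxt i ^^ _"])
  obtain m where "y = (nxt i ^^ m) x" using assms by (auto simp: cyc_def)
  moreover obtain n where "x = (nxt i ^^ n) y" using assms by (rule cyc_back)
  ultimately show ?thesis using sub by blast
qed

lemma nxt_cyc: "rec i x \<Longrightarrow> nxt i ` cyc i x = cyc i x"
proof
  assume x: "rec i x"
  show "nxt i ` cyc i x \<subseteq> cyc i x"
    unfolding cyc_def by (auto intro: range_eqI[of _ _ "Suc _"])
  show "cyc i x \<subseteq> nxt i ` cyc i x"
  proof
    fix y assume y: "y \<in> cyc i x"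
    obtain k where k: "k > 0" "(nxt i ^^ k) y = y" using cyc_rec[OF x y] by (auto simp: recurrent_def)
    then have "y = nxt i ((nxt i ^^ (k - 1)) y)" by (cases k) auto
    moreover have "(nxt i ^^ (k - 1)) y \<in> cyc i y" by (auto simp: cyc_def)
    ultimately show "y \<in> nxt i ` cyc i x" using cyc_eq[OF x y] by auto
  qed
qed

lemma rec_pred:
  assumes "rec i x"
  obtains y where "rec i y" "nxt i y = x"
proof -
  have "x \<in> nxt i ` cyc i x" using nxt_cyc[OF assms] by simp
  then show thesis using that cyc_rec[OF assms] by auto
qed

lemma mono_cycle_nth:
  assumes "mono_cycle M c i ds" "k < length ds"
  shows "(nxt i ^^ n) (ds ! k) = ds ! ((k + n) mod length ds)"
proof (induction n)
  case (Suc n)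
  let ?k = "(k + n) mod length ds"
  have len: "?k < length ds" using assms(2) by (intro mod_less_divisor) auto
  have len': "Suc ?k mod length ds < length ds" using assms(2) by (intro mod_less_divisor) auto
  have set: "d \<in> X" "c d = Some i" if "d \<in> set ds" for d
    using assms(1) that by (auto simp: mono_cycle_def closed_walk_def walk_def)
  have "target M (ds ! ?k) = origin M (ds ! (Suc ?k mod length ds))"
  proof (cases "Suc ?k = length ds")
    case True
    then have "ds ! ?k = last ds" using assms(2) by (metis diff_Suc_1 last_conv_nth list.size(3) not_less_zero)
    moreover have "ds ! (Suc ?k mod length ds) = hd ds"
      using True assms(2) by (metis hd_conv_nth length_0_conv mod_self not_less_zero)
    ultimately show ?thesis using assms(1) by (simp add: mono_cycle_def closed_walk_def)
  next
    case False
    then have "Suc ?k < length ds" using len by simp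
    then show ?thesis
      using assms(1) by (simp add: mono_cycle_def closed_walk_def walk_def successively_conv_nth)
  qed
  then have "nxt i (ds ! ?k) = ds ! (Suc ?k mod length ds)"
    using set[OF nth_mem[OF len]] set[OF nth_mem[OF len']]
    by (intro nxt_eqI) (auto simp: target_def)
  then show ?case using Suc by (simp add: mod_Suc_eq)
qed (use assms in simp)

lemma mono_cycle_rec:
  assumes "mono_cycle M c i ds" "d \<in> set ds"
  shows "rec i d" "set ds \<subseteq> cyc i d"
proof -
  obtain k where k: "k < length ds" "d = ds ! k" using assms(2) by (auto simp: in_set_conv_nth)
  have len: "length ds > 0" using k(1) by linarith
  have "(nxt i ^^ length ds) d = d" using mono_cycle_nth[OF assms(1) k(1)] k by simp
  moreover have "d \<in> X" "c d = Some i"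
    using assms by (auto simp: mono_cycle_def closed_walk_def walk_def)
  ultimately show "rec i d" using len unfolding recurrent_def by blast
  show "set ds \<subseteq> cyc i d"
  proof
    fix e assume "e \<in> set ds"
    then obtain m where m: "m < length ds" "e = ds ! m" by (auto simp: in_set_conv_nth)
    have "(k + (length ds - k + m)) mod length ds = m" using m k by simp
    then have "e = (nxt i ^^ (length ds - k + m)) d"
      using mono_cycle_nth[OF assms(1) k(1)] m(2) k(2) by metis
    then show "e \<in> cyc i d" by (auto simp: cyc_def)
  qed
qed

lemma mono_cycle_exists:
  assumes x: "rec i x"
  obtains ds where "mono_cycle M c i ds" "set ds = cyc i x"
proof -
  let ?f = "nxt i"
  have orb: "x \<in> orbit ?f x" using x unfolding recurrent_def orbit_altdef by (metis (mono_tags, lifting) mem_Collect_eq)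
  define N where "N = funpow_dist1 ?f x x"
  have N: "N > 0" "(?f ^^ N) x = x" and inj: "inj_on (\<lambda>n. (?f ^^ n) x) {0..<N}"
    and orbN: "orbit ?f x = (\<lambda>n. (?f ^^ n) x) ` {0..<N}"
    unfolding N_def
    using funpow_dist1_prop[OF orb] inj_on_funpow_dist1[OF orb] orbit_conv_funpow_dist1[OF orb] by simp_all
  define ds where "ds = map (\<lambda>n. (?f ^^ n) x) [0..<N]"
  have set: "set ds = cyc i x"
  proof -
    have "set ds = orbit ?f x" by (simp add: ds_def orbN)
    also have "\<dots> = cyc i x" using orbit_altdef_self_in[OF orb] by (auto simp: cyc_def)
    finally show ?thesis .
  qed
  have col: "d \<in> X \<and> c d = Some i" if "d \<in> set ds" for d
    using that cyc_rec[OF x] rec_in unfolding set by blast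
  have len: "length ds = N" and nth: "n < N \<Longrightarrow> ds ! n = (?f ^^ n) x" for n by (simp_all add: ds_def)
  have tgt: "target M ((?f ^^ n) x) = origin M ((?f ^^ Suc n) x)" for n
    using nxt(3)[OF nxt_funpow(1)[OF rec_in(1)[OF x] rec_in(2)[OF x]]] by (simp add: target_def)
  have dist: "distinct ds" using inj by (simp add: ds_def distinct_map)
  have "mono_cycle M c i ds"
    unfolding mono_cycle_def closed_walk_def walk_def successively_conv_nth
  proof (intro conjI allI impI ballI)
    show "set ds \<subseteq> X" using col by blast
    show "ds \<noteq> []" using N len by auto
    then show "target M (last ds) = origin M (hd ds)"
      using tgt[of "N - 1"] N len nth by (simp add: last_conv_nth hd_conv_nth)
    \<comment> \<open>Two darts of color \<open>i\<close> with the same origin are equal, so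
      distinct darts give distinct vertices.\<close>
    have "inj_on (origin M) (set ds)"
      using col out_eqI by (intro inj_onI) blast
    then show "distinct (map (origin M) ds)" using dist by (simp add: distinct_map)
    show "target M (ds ! n) = origin M (ds ! Suc n)" if "Suc n < length ds" for n
      using that tgt[of n] len nth by simp
    show "c d = Some i" if "d \<in> set ds" for d using col that by blast
  qed
  then show thesis using that set by blast
qed

lemma cycles_meetI:
  assumes "schnyder_T2 M c"
  shows "cycles_meet M c"
  unfolding cycles_meet_def
proof (intro allI impI, elim conjE)
  fix i s :: color and x assume s: "s \<noteq> 0" and x: "rec i x"
  obtain ds where ds: "mono_cycle M c i ds" "set ds = cyc i x" using x by (rule mono_cycle_exists)
  have "(\<exists>es. mono_cycle M c (i - 1) es \<and> cycles_intersect M ds es) \<and>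
     (\<exists>es. mono_cycle M c (i + 1) es \<and> cycles_intersect M ds es)"
    using assms ds(1) unfolding schnyder_T2_def by blast
  moreover have "i + s = i + 1 \<or> i + s = i - 1" using s by (cases rule: color_cases[of s 0]) auto
  ultimately obtain es where es: "mono_cycle M c (i + s) es" "cycles_intersect M ds es" by metis
  then obtain d e where de: "d \<in> set ds" "e \<in> set es" "origin M d = origin M e"
    unfolding cycles_intersect_def by blast
  have "rec (i + s) e" using mono_cycle_rec[OF es(1) de(2)] by blast
  moreover obtain n where n: "d = (nxt i ^^ n) x" using de(1) ds(2) by (auto simp: cyc_def)
  moreover have "e = out_dart (i + s) d"
  proof (rule out_unique)
    show "d \<in> X" using de(1) ds(2) cyc_rec[OF x] rec_in(1) by blast
    show "c e = Some (i + s)" using \<open>rec (i + s) e\<close> by (rule rec_in(2))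
  qed (use de in simp)
  ultimately show "\<exists>n. rec (i + s) (out_dart (i + s) ((nxt i ^^ n) x))" by auto
qed

lemma cycles_meetD:
  assumes "cycles_meet M c"
  shows "schnyder_T2 M c"
proof -
  have "\<exists>es. mono_cycle M c (i + s) es \<and> cycles_intersect M ds es"
    if ds: "mono_cycle M c i ds" and s: "s \<noteq> 0" for i s ds
  proof -
    have "ds \<noteq> []" using ds by (simp add: mono_cycle_def closed_walk_def)
    then have hd: "hd ds \<in> set ds" by simp
    let ?x = "hd ds"
    have x: "rec i ?x" using mono_cycle_rec[OF ds hd] by blast
    then obtain n where n: "rec (i + s) (out_dart (i + s) ((nxt i ^^ n) ?x))"
      using assms s unfolding cycles_meet_def by blast
    obtain k where k: "k < length ds" "?x = ds ! k" using hd by (metis in_set_conv_nth)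
    have "(k + n) mod length ds < length ds" using k by (intro mod_less_divisor) auto
    then have d: "(nxt i ^^ n) ?x \<in> set ds" using mono_cycle_nth[OF ds k(1), of n] k(2) by simp
    then have dX: "(nxt i ^^ n) ?x \<in> X" using ds by (auto simp: mono_cycle_def closed_walk_def walk_def)
    obtain es where es: "mono_cycle M c (i + s) es"
      "set es = cyc (i + s) (out_dart (i + s) ((nxt i ^^ n) ?x))" using n by (rule mono_cycle_exists)
    then have "out_dart (i + s) ((nxt i ^^ n) ?x) \<in> set es" by simp
    then have "cycles_intersect M ds es"
      using d out(1)[OF dX, of "i + s"] unfolding cycles_intersect_def by (metis IntI empty_iff imageI)
    then show ?thesis using es by blast
  qed
  from this[where s = 1] this[where s = "- 1"] show ?thesis
    unfolding schnyder_T2_def by simp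
qed

end

section \<open>The dual coloring\<close>

text \<open>Vertices and faces are counted as cycles of permutations, and Euler's formula is doubled
  so that edges are counted by their darts. This form is symmetric in vertices and faces and so
  passes to the dual, also repeatedly.\<close>

definition torus :: "'d cmap \<Rightarrow> bool" where
  "torus M \<longleftrightarrow> combinatorial_map M \<and>
     (\<forall>x\<in>darts M. \<forall>y\<in>darts M.
        (x, y) \<in> conn (fgraph (darts M) (rot M) \<union> fgraph (darts M) (opp M))) \<and>
     2 * (card (classes (darts M) (fgraph (darts M) (rot M))) +
          card (classes (darts M) (fgraph (darts M) (face_next M)))) = card (darts M)"

text \<open>An edge and its dual together carry each of the three colors once: a one-way edge of
  color \<open>i\<close> has a dual in two directions with the colors \<open>i + 1\<close> and
  \<open>i - 1\<close>, and a two-way edge has a one-way dual of the third color. The directions are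
  those in which the corner label advances.\<close>

definition dual_coloring :: "'d cmap \<Rightarrow> ('d \<Rightarrow> color option) \<Rightarrow> 'd \<Rightarrow> color option" where
  "dual_coloring M c d =
     (if d \<notin> darts M then None
      else case c d of
        None \<Rightarrow> map_option (\<lambda>b. b - 1) (c (opp M d))
      | Some a \<Rightarrow> if c (opp M d) = Some (a + 1) then None else Some (a + 1))"

lemma card_filter_orbits:
  assumes "finite X" "f permutes X"
  shows "card {x \<in> X. P x} = (\<Sum>K\<in>classes X (fgraph X f). card {x \<in> K. P x})"
proof -
  have perm: "permutation f" using assms permutation_permutes by blast
  have sub: "K \<subseteq> X" if "K \<in> orbit f ` X" for K
    using that permutes_orbit_subset[OF assms(2)] by blast
  have "{x \<in> X. P x} = (\<Union>K\<in>orbit f ` X. {x \<in> K. P x})"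
    using sub permutation_self_in_orbit[OF perm] by blast
  also have "card \<dots> = (\<Sum>K\<in>orbit f ` X. card {x \<in> K. P x})"
  proof (rule card_UN_disjoint)
    show "\<forall>K\<in>orbit f ` X. finite {x \<in> K. P x}"
      using finite_subset[OF sub assms(1)] by simp
    show "\<forall>K\<in>orbit f ` X. \<forall>L\<in>orbit f ` X. K \<noteq> L \<longrightarrow> {x \<in> K. P x} \<inter> {x \<in> L. P x} = {}"
    proof (intro ballI impI)
      fix K L assume "K \<in> orbit f ` X" "L \<in> orbit f ` X" "K \<noteq> L"
      then obtain x y where "K = orbit f x" "L = orbit f y" "orbit f x \<noteq> orbit f y" by auto
      moreover have "orbit f x = orbit f y" if "z \<in> orbit f x" "z \<in> orbit f y" for z
        using that orbit_eq_iff[OF perm] by metis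
      ultimately show "{x \<in> K. P x} \<inter> {x \<in> L. P x} = {}" by auto
    qed
  qed (use assms in simp)
  finally show ?thesis using classes_perm[OF assms] by simp
qed

context comb_map
begin

lemma face_next_dual: "face_next (dual_map M) = opp M \<circ> rot M \<circ> opp M"
proof -
  have "inv (face_next M) = opp M \<circ> rot M"
    by (rule inv_unique_comp) (simp_all add: face_next_def fun_eq_iff)
  then show ?thesis by (simp add: face_next_def[of "dual_map M"]) (simp add: dual_map_def)
qed

text \<open>\<open>opp M\<close> carries the cycles of \<open>rot M\<close> to the faces of the
  dual. For connectedness, \<open>rot M x\<close> is reached from \<open>x\<close> by a face step
  backwards and a reversal.\<close>

lemma torus_dual:
  assumes "torus M"
  shows "torus (dual_map M)"
proof -
  let ?g = "opp M \<circ> rot M \<circ> opp M"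
  have g: "?g permutes X" by (intro permutes_compose opp_perm rot_perm)
  have "orbit ?g ` X = (\<lambda>x. orbit ?g (opp M x)) ` X"
    using opp_perm by (simp add: permutes_image flip: image_image)
  also have "\<dots> = (\<lambda>x. opp M ` orbit (rot M) x) ` X"
  proof (rule image_cong)
    fix x
    show "orbit ?g (opp M x) = opp M ` orbit (rot M) x"
      by (rule orbit_inverse[symmetric]) (simp_all add: permutation_self_in_orbit[OF perm_rot])
  qed simp
  finally have "orbit ?g ` X = image (opp M) ` (orbit (rot M) ` X)" by (simp add: image_image)
  moreover have "inj (opp M)" using opp_perm by (rule permutes_inj)
  ultimately have "card (orbit ?g ` X) = card (orbit (rot M) ` X)"
    by (simp add: card_image inj_on_image_iff inj_on_def inj_image_eq_iff)
  then have F: "card (classes X (fgraph X ?g)) = card (classes X (fgraph X (rot M)))"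
    by (simp only: classes_perm[OF finX g] classes_perm[OF finX rot_perm])
  have "fgraph X (rot M) \<union> fgraph X (opp M) \<subseteq> conn (fgraph X (face_next M) \<union> fgraph X (opp M))"
    (is "_ \<subseteq> ?C")
  proof -
    have opp: "(x, opp M x) \<in> ?C" if "x \<in> X" for x
      using that by (auto intro!: conn_base fgraphI)
    have "(x, rot M x) \<in> ?C" if x: "x \<in> X" for x
    proof -
      let ?y = "opp M (rot M x)"
      have "(?y, face_next M ?y) \<in> ?C" using x by (auto intro!: conn_base fgraphI)
      then have "(x, ?y) \<in> ?C" by (auto simp: face_next_def dest: conn_sym)
      also have "(?y, rot M x) \<in> ?C" using opp[of "rot M x"] x by (auto dest: conn_sym)
      finally show ?thesis .
    qed
    then show ?thesis using opp by (auto simp: fgraph_def)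
  qed
  then have "conn (fgraph X (rot M) \<union> fgraph X (opp M)) \<subseteq> ?C" by (rule conn_least)
  then show ?thesis
    using assms F comb_dual unfolding torus_def face_next_dual
    by (auto simp: dual_map_def)
qed

lemma torusI:
  assumes "map_on_torus M"
  shows "torus M"
proof -
  let ?C = "conn (fgraph X (rot M) \<union> fgraph X (opp M))"
  have rot_conn: "(x, y) \<in> ?C" if "x \<in> X" "y \<in> origin M x" for x y
  proof -
    have "(x, y) \<in> conn (fgraph X (rot M))"
      using that conn_perm[OF finX rot_perm] by (simp add: origin_def)
    then show ?thesis using conn_mono[of "fgraph X (rot M)"] by blast
  qed
  have opp_conn: "(x, opp M x) \<in> ?C" if "x \<in> X" for x
    using that by (auto intro!: conn_base fgraphI)
  have walk_conn: "(hd ds, opp M (last ds)) \<in> ?C" if "walk M ds" "ds \<noteq> []" for ds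
    using that
  proof (induction ds rule: induct_list012)
    case (2 d)
    then show ?case using opp_conn by (simp add: walk_def)
  next
    case (3 d e ds)
    have d: "d \<in> X" "target M d = origin M e" and w: "walk M (e # ds)"
      using 3(3) by (auto simp: walk_def)
    have "(d, opp M d) \<in> ?C" using d opp_conn by blast
    also have "(opp M d, e) \<in> ?C" using d by (intro rot_conn) (auto simp: target_def)
    also have "(e, opp M (last (e # ds))) \<in> ?C" using 3(2) w by simp
    finally show ?case by simp
  qed simp
  have "(x, y) \<in> ?C" if x: "x \<in> X" and y: "y \<in> X" for x y
  proof (cases "origin M x = origin M y")
    case True
    then show ?thesis using rot_conn x by simp
  next
    case False
    then obtain ds where ds: "walk M ds" "ds \<noteq> []" "origin M (hd ds) = origin M x"
      "target M (last ds) = origin M y"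
      using assms x y unfolding map_on_torus_def connected_map_def vertices_def by blast
    have "hd ds \<in> set ds" "last ds \<in> set ds" using ds by auto
    then have "hd ds \<in> X" "last ds \<in> X" using ds(1) unfolding walk_def by blast+
    have "(x, hd ds) \<in> ?C" using ds x by (intro rot_conn) (auto simp: origin_eq)
    also have "(hd ds, opp M (last ds)) \<in> ?C" using ds walk_conn by blast
    also have "(opp M (last ds), y) \<in> ?C"
      using ds \<open>last ds \<in> X\<close> by (intro rot_conn) (auto simp: origin_eq target_def)
    finally show ?thesis .
  qed
  moreover have "2 * card (edges M) = card X"
  proof -
    have "2 * card (edges M) = card (\<Union> (edges M))"
    proof (rule card_partition)
      show "finite (edges M)" "finite (\<Union> (edges M))" using finX by (auto simp: edges_def)
      show "card K = 2" if "K \<in> edges M" for K using that opp_ne by (fastforce simp: edges_def)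
      show "K \<inter> L = {}" if KL: "K \<in> edges M" "L \<in> edges M" "K \<noteq> L" for K L
      proof -
        have "K = {z, opp M z}" if "K \<in> edges M" "z \<in> K" for K z
          using that by (auto simp: edges_def)
        then have "K = L" if "z \<in> K" "z \<in> L" for z using that KL(1,2) by metis
        then show ?thesis using KL(3) by blast
      qed
    qed
    moreover have "\<Union> (edges M) = X" by (auto simp: edges_def)
    ultimately show ?thesis by simp
  qed
  moreover have "card (vertices M) = card (classes X (fgraph X (rot M)))"
    "card (faces M) = card (classes X (fgraph X (face_next M)))"
    using classes_perm[OF finX rot_perm] classes_perm[OF finX face_next_perm]
    by (simp_all add: vertices_def faces_def origin_def[abs_def])
  ultimately show ?thesis using assms comb unfolding torus_def map_on_torus_def by auto
qed

end

section \<open>Corner labels around faces\<close>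

locale torus_wood = labelled_map M c lab for M :: "'d cmap" and c lab +
  assumes torus: "torus M" and meet: "cycles_meet M c"
begin

abbreviation "f \<equiv> face_next M"
abbreviation "c' \<equiv> dual_coloring M c"

text \<open>\<open>lab x\<close> and \<open>lab (f x)\<close> belong to the corners at the two ends
  of \<open>x\<close> in the face on its left. In each of the four cases \<open>c' x\<close> tells
  whether the label advances along \<open>x\<close>, and exactly three of the four values of
  \<open>c\<close> and \<open>c'\<close> are colors.\<close>

lemma edge_cases:
  assumes "x \<in> X"
  obtains i where "c x = Some i" "c (opp M x) = None" "c' x = Some (i + 1)" "c' (opp M x) = Some (i - 1)"
      "lab x = i - 1" "lab (f x) = i"
  | i where "c x = None" "c (opp M x) = Some i" "c' x = Some (i - 1)" "c' (opp M x) = Some (i + 1)"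
      "lab x = i" "lab (f x) = i + 1"
  | i where "c x = Some i" "c (opp M x) = Some (i + 1)" "c' x = None" "c' (opp M x) = Some (i - 1)"
      "lab x = i - 1" "lab (f x) = i - 1"
  | i where "c x = Some i" "c (opp M x) = Some (i - 1)" "c' x = Some (i + 1)" "c' (opp M x) = None"
      "lab x = i - 1" "lab (f x) = i"
proof (cases "c x")
  case None
  then obtain i where i: "c (opp M x) = Some i" using c_not_both_None[OF assms] by auto
  have "lab x = i" using lab_enter[OF assms None i] .
  moreover have "lab (f x) = i + 1" using lab_Some[of "f x" i] assms i by simp
  ultimately show thesis using that(2)[of i] None i assms by (simp add: dual_coloring_def)
next
  case (Some i)
  have lx: "lab x = i - 1" using lab_self[OF assms Some] .
  show thesis
  proof (cases "c (opp M x)")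
    case None
    have "lab (opp M x) = i" using lab_enter[of "opp M x" i] assms None Some by simp
    then have "lab (f x) = i" using lab_None[of "f x"] assms None by simp
    then show thesis using that(1)[of i] lx None Some assms by (simp add: dual_coloring_def)
  next
    case (Some j)
    have lf: "lab (f x) = j + 1" using lab_Some[of "f x" j] assms Some by simp
    have "j \<noteq> i" using c_opp_ne[OF assms \<open>c x = Some i\<close>] Some by auto
    then consider "j = i + 1" | "j = i - 1" by (cases rule: color_cases[of j i]) auto
    then show thesis
      by cases (use that(3,4)[of i] lx lf Some \<open>c x = Some i\<close> assms in \<open>simp_all add: dual_coloring_def\<close>)
  qed
qed

lemma dual_label:
  assumes "x \<in> X"
  shows "c' x = None \<Longrightarrow> lab (f x) = lab x" "c' x = Some i \<Longrightarrow> lab x = i + 1" "c' x = Some i \<Longrightarrow> lab (f x) = i - 1"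
  using assms by (cases rule: edge_cases, auto)+

text \<open>If all labels of the face are \<open>i - 1\<close>, its boundary darts have color
  \<open>i\<close> forwards and \<open>i + 1\<close> backwards. At each of its vertices, the sector
  in which color \<open>i - 1\<close> enters is then the corner of the face itself. No edge fits in
  there, so no cycle of color \<open>i - 1\<close> meets the boundary.\<close>

lemma face_has_out:
  assumes x: "x \<in> X"
  shows "\<exists>y\<in>orbit f x. c' y \<noteq> None"
proof (rule ccontr)
  assume "\<not> (\<exists>y\<in>orbit f x. c' y \<noteq> None)"
  then have None: "c' y = None" if "y \<in> orbit f x" for y using that by blast
  have perm: "permutation f" using face_next_perm finX permutation_permutes by blast
  have orbX: "y \<in> X" if "y \<in> orbit f x" for y
    using that x permutes_orbit_subset[OF face_next_perm] by blast
  have self: "x \<in> orbit f x" using perm by (rule permutation_self_in_orbit)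
  define i where "i = lab x + 1"
  have lab: "lab y = i - 1" if "y \<in> orbit f x" for y
    using that
  proof induction
    case base
    then show ?case using dual_label(1)[OF x None[OF self]] by (simp add: i_def)
  next
    case (step y)
    then show ?case using dual_label(1)[OF orbX None] by simp
  qed
  have cols: "c y = Some i \<and> c (opp M y) = Some (i + 1)" if y: "y \<in> orbit f x" for y
    using orbX[OF y] by (cases rule: edge_cases) (use None[OF y] lab[OF y] in simp_all)
  then have col: "c y = Some i" "c (opp M y) = Some (i + 1)" if "y \<in> orbit f x" for y
    using that by simp_all
  have nx: "nxt i y = f y" if "y \<in> orbit f x" for y
    using that by (intro nxt_eqI) (auto intro: orbX col orbit.step)
  have pow: "(nxt i ^^ n) x = (f ^^ n) x \<and> (f ^^ n) x \<in> orbit f x" for n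
    by (induction n) (use self nx in \<open>auto intro: orbit.step\<close>)
  obtain n where "n > 0" "(f ^^ n) x = x" using self by (auto simp: orbit_altdef)
  then have "rec i x" using x col[OF self] pow unfolding recurrent_def by auto
  then obtain n where n: "rec (i + - 1) (out_dart (i + - 1) ((nxt i ^^ n) x))"
    using meet unfolding cycles_meet_def by (metis color_ne(3) add_cancel_left_right diff_conv_add_uminus)
  define z where "z = (f ^^ n) x"
  have z: "z \<in> orbit f x" "rec (i - 1) (out_dart (i - 1) z)"
    using pow[of n] n by (auto simp: z_def)
  then obtain y where y: "rec (i - 1) y" "nxt (i - 1) y = out_dart (i - 1) z" by (auto elim: rec_pred)
  have zX: "z \<in> X" using orbX z by blast
  obtain z' where z': "z' \<in> orbit f x" "f z' = z"
    using z(1) self by (cases rule: orbit.cases) auto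
  \<comment> \<open>So \<open>z\<close> and \<open>rot M z\<close>, of colors \<open>i\<close> and
    \<open>i + 1\<close>, are consecutive at their vertex and border the corner of the face.\<close>
  have rz: "rot M z = opp M z'" using z'(2) by auto
  \<comment> \<open>The edge by which the cycle of color \<open>i - 1\<close> enters this vertex,
    seen from the vertex. It would have to lie strictly between \<open>z\<close> and
    \<open>rot M z\<close>, or be one of them, and these two are entered in other colors.\<close>
  define w where "w = opp M y"
  have yX: "y \<in> X" "c y = Some (i - 1)" using rec_in[OF y(1)] by auto
  have wX: "w \<in> X" "c (opp M w) = Some (i - 1)" using yX by (auto simp: w_def)
  have ow: "origin M w = origin M z"
    using nxt(3)[OF yX(1), of "i - 1"] out(1)[OF zX, of "i - 1"] y(2) by (simp add: w_def)
  show False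
  proof (cases "c w")
    case None
    then have "lab w = i - 1" using lab_enter wX by blast
    then obtain k where k: "w = (rot M ^^ k) (out_dart i w)" "\<forall>j\<le>k. lab ((rot M ^^ j) (out_dart i w)) = i - 1"
      using lab_sector[OF wX(1), of "i - 1"] by auto
    have oz: "out_dart i w = z" using out_unique[OF wX(1), of z i] ow col(1)[OF z(1)] by simp
    have "w \<noteq> z" using None col(1)[OF z(1)] by auto
    then have "k \<noteq> 0" using k(1)[unfolded oz] by (cases k) simp_all
    then have "lab (rot M z) = i - 1" using k(2)[unfolded oz] by (auto dest: spec[of _ "1::nat"])
    moreover have "lab (rot M z) = i" using lab_Some[OF zX, of "i + 1"] col(2)[OF z'(1)] rz by simp
    ultimately show False by simp
  next
    case (Some m)
    consider "m = i" | "m = i + 1" | "m = i - 1" by (rule color_cases)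
    then show False
    proof cases
      case 1
      then have "w = z" using out_eqI[OF wX(1) ow] Some col(1)[OF z(1)] by simp
      then show False using col(2)[OF z(1)] wX(2) by simp
    next
      case 2
      then have "w = rot M z"
        using out_eqI[OF wX(1), of "rot M z"] ow Some col(2)[OF z'(1)] rz origin_rot[of z] by simp
      then show False using col(1)[OF z'(1)] wX(2) rz by simp
    next
      case 3
      then show False using c_opp_ne[OF wX(1) Some] wX(2) by simp
    qed
  qed
qed

text \<open>Around a face the label \<open>k\<close> is entered as often as it is left. It is
  entered along darts of dual color \<open>k + 1\<close> and left along those of dual color
  \<open>k - 1\<close>.\<close>

lemma face_colors_equal:
  assumes x: "x \<in> X"
  shows "card {y \<in> orbit f x. c' y = Some i} = card {y \<in> orbit f x. c' y = Some j}"
proof -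
  let ?O = "orbit f x"
  have perm: "permutation f" using face_next_perm finX permutation_permutes by blast
  have orbX: "y \<in> X" if "y \<in> ?O" for y
    using that x permutes_orbit_subset[OF face_next_perm] by blast
  have fin: "finite ?O" by (rule finite_subset[OF _ finX]) (use orbX in blast)
  have img: "f ` ?O = ?O"
  proof -
    have "inj_on f ?O" using permutes_inj[OF face_next_perm] by (rule inj_on_subset) simp
    moreover have "f ` ?O \<subseteq> ?O" by (auto intro: orbit.step)
    ultimately show ?thesis using fin by (intro endo_inj_surj)
  qed
  have eq: "card {y \<in> ?O. c' y = Some (k + 1)} = card {y \<in> ?O. c' y = Some (k - 1)}" for k
  proof -
    have "card {y \<in> ?O. lab (f y) = k} = card (f ` {y \<in> ?O. lab (f y) = k})"
      by (rule card_image[symmetric], rule inj_on_subset[OF permutes_inj[OF face_next_perm]]) simp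
    also have "f ` {y \<in> ?O. lab (f y) = k} = {y \<in> ?O. lab y = k}" using img by auto
    finally have "card {y \<in> ?O. lab (f y) = k} = card {y \<in> ?O. lab y = k}" .
    moreover have "{y \<in> ?O. lab (f y) = k} = {y \<in> ?O. c' y = Some (k + 1)} \<union> {y \<in> ?O. c' y = None \<and> lab y = k}"
    proof -
      have "lab (f y) = k \<longleftrightarrow> c' y = Some (k + 1) \<or> (c' y = None \<and> lab y = k)" if "y \<in> ?O" for y
        using dual_label[OF orbX[OF that]] by (cases "c' y") auto
      then show ?thesis by auto
    qed
    moreover have "{y \<in> ?O. lab y = k} = {y \<in> ?O. c' y = Some (k - 1)} \<union> {y \<in> ?O. c' y = None \<and> lab y = k}"
    proof -
      have "lab y = k \<longleftrightarrow> c' y = Some (k - 1) \<or> (c' y = None \<and> lab y = k)" if "y \<in> ?O" for y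
        using dual_label[OF orbX[OF that]] by (cases "c' y") auto
      then show ?thesis by auto
    qed
    moreover have "card ({y \<in> ?O. c' y = Some m} \<union> {y \<in> ?O. c' y = None \<and> lab y = k}) =
        card {y \<in> ?O. c' y = Some m} + card {y \<in> ?O. c' y = None \<and> lab y = k}" for m
      using fin by (intro card_Un_disjoint) auto
    ultimately show ?thesis by simp
  qed
  consider "j = i" | "j = i + 1" | "j = i - 1" by (rule color_cases)
  moreover have "i - 1 + 1 = i" "i - 1 - 1 = i + 1" "i + 1 + 1 = i - 1" "i + 1 - 1 = i" by simp_all
  note eqs = eq[of "i - 1", unfolded this] eq[of "i + 1", unfolded this]
  ultimately show ?thesis by cases (use eqs in simp_all)
qed

lemma card_vertex_out: "card {x \<in> X. c x \<noteq> None} = 3 * card (classes X (fgraph X (rot M)))"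
proof -
  have "card {y \<in> K. c y \<noteq> None} = 3" if K: "K \<in> classes X (fgraph X (rot M))" for K
  proof -
    obtain x where x: "x \<in> X" "K = origin M x"
      using K classes_perm[OF finX rot_perm] by (auto simp: origin_def)
    have "y \<in> K \<and> c y \<noteq> None \<longleftrightarrow> y \<in> {out_dart 0 x, out_dart (0 + 1) x, out_dart (0 - 1) x}" for y
    proof
      assume y: "y \<in> K \<and> c y \<noteq> None"
      then obtain i where "c y = Some i" by auto
      then have "y = out_dart i x" using y x out_unique by (simp add: origin_eq)
      then show "y \<in> {out_dart 0 x, out_dart (0 + 1) x, out_dart (0 - 1) x}"
        by (cases rule: color_cases[of i 0]) auto
    qed (use out[OF x(1)] x(2) in \<open>auto simp: origin_eq\<close>)
    then have "{y \<in> K. c y \<noteq> None} = {out_dart 0 x, out_dart (0 + 1) x, out_dart (0 - 1) x}" by blast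
    moreover have "out_dart i x \<noteq> out_dart j x" if "i \<noteq> j" for i j
      using out(2)[OF x(1), of i] out(2)[OF x(1), of j] that by auto
    ultimately show ?thesis by (simp add: card_insert_if)
  qed
  then show ?thesis by (simp add: card_filter_orbits[OF finX rot_perm])
qed

text \<open>Every edge has three oriented colors in primal and dual together. The vertices take
  three each, and Euler's formula leaves three for each face.\<close>

lemma card_face_out: "card {x \<in> X. c' x \<noteq> None} = 3 * card (classes X (fgraph X f))"
proof -
  let ?n = "\<lambda>c x. if c x \<noteq> None then 1 else 0 :: nat"
  have reflect: "(\<Sum>x\<in>X. g (opp M x)) = (\<Sum>x\<in>X. g x)" for g :: "'d \<Rightarrow> nat"
    using sum.permute[OF opp_perm, of g] by (simp add: comp_def)
  have card: "card {x \<in> X. g x \<noteq> None} = (\<Sum>x\<in>X. ?n g x)" for g :: "'d \<Rightarrow> color option"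
    using finX by (simp add: sum.If_cases Int_def conj_commute)
  have "(\<Sum>x\<in>X. ?n c x + ?n c (opp M x) + ?n c' x + ?n c' (opp M x)) = (\<Sum>x\<in>X. 3)"
  proof (rule sum.cong)
    fix x assume "x \<in> X"
    then show "?n c x + ?n c (opp M x) + ?n c' x + ?n c' (opp M x) = 3"
      by (cases rule: edge_cases) simp_all
  qed simp
  then have "2 * card {x \<in> X. c x \<noteq> None} + 2 * card {x \<in> X. c' x \<noteq> None} = 3 * card X"
    unfolding card sum.distrib reflect[of "?n c"] reflect[of "?n c'"] by simp
  then show ?thesis using torus unfolding card_vertex_out torus_def by simp
qed

text \<open>In each face the three colors occur equally often and at least once; by the total of
  three for each face, no face can have more.\<close>

lemma face_unique:
  assumes "x \<in> X"
  shows "card {y \<in> orbit f x. c' y = Some i} = 1"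
proof -
  let ?O = "classes X (fgraph X f)"
  have O: "?O = orbit f ` X" by (rule classes_perm[OF finX face_next_perm])
  have fin: "finite K" if "K \<in> ?O" for K
    using that finX permutes_orbit_subset[OF face_next_perm] finite_subset unfolding O by blast
  have pos: "card {y \<in> K. c' y = Some i} > 0" if K: "K \<in> ?O" for K i
  proof -
    obtain x where x: "x \<in> X" "K = orbit f x" using K O by auto
    obtain y where "y \<in> orbit f x" "c' y \<noteq> None" using face_has_out[OF x(1)] by blast
    then obtain j where "y \<in> {y \<in> K. c' y = Some j}" using x by auto
    then have "card {y \<in> K. c' y = Some j} > 0" using fin[OF K] by (auto simp: card_gt_0_iff)
    then show ?thesis using face_colors_equal[OF x(1), of i j] x by simp
  qed
  have split: "card {y \<in> K. c' y \<noteq> None} = 3 * card {y \<in> K. c' y = Some i}" if K: "K \<in> ?O" for K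
  proof -
    obtain x where x: "x \<in> X" "K = orbit f x" using K O by auto
    let ?S = "\<lambda>j. {y \<in> K. c' y = Some j}"
    have "y \<in> {y \<in> K. c' y \<noteq> None} \<longleftrightarrow> y \<in> ?S i \<union> (?S (i + 1) \<union> ?S (i - 1))" for y
    proof (cases "c' y")
      case (Some j)
      then show ?thesis by (cases rule: color_cases[of j i]) auto
    qed auto
    then have "{y \<in> K. c' y \<noteq> None} = ?S i \<union> (?S (i + 1) \<union> ?S (i - 1))" by blast
    also have "card \<dots> = card (?S i) + (card (?S (i + 1)) + card (?S (i - 1)))"
      using fin[OF K] by (subst card_Un_disjoint; (subst card_Un_disjoint)?; auto)
    finally show ?thesis
      using face_colors_equal[OF x(1), of i "i + 1"] face_colors_equal[OF x(1), of i "i - 1"] x by simp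
  qed
  have "3 * card ?O = (\<Sum>K\<in>?O. 3 * card {y \<in> K. c' y = Some i})"
    using card_face_out split by (simp add: card_filter_orbits[OF finX face_next_perm])
  then have sum: "(\<Sum>K\<in>?O. card {y \<in> K. c' y = Some i}) = (\<Sum>K\<in>?O. 1)"
    by (simp flip: sum_distrib_left)
  have "card {y \<in> K. c' y = Some i} = 1" if K: "K \<in> ?O" for K
  proof (rule ccontr)
    assume "card {y \<in> K. c' y = Some i} \<noteq> 1"
    then have "1 < card {y \<in> K. c' y = Some i}" using pos[OF K, of i] by simp
    then have "(\<Sum>K\<in>?O. 1) < (\<Sum>K\<in>?O. card {y \<in> K. c' y = Some i})"
      using pos K finite_classes[OF finX]
      by (intro sum_strict_mono_ex1) (auto simp: Suc_le_eq)
    then show False using sum by simp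
  qed
  then show ?thesis using assms O by auto
qed

text \<open>Around the face, the corner between the dual darts \<open>x\<close> and
  \<open>f x\<close> is the one at the target of \<open>x\<close>, whose label is
  \<open>lab (f x)\<close>. This is the reason for the shift by \<open>f\<close>.\<close>

lemma dual_labelled: "labelled_map (dual_map M) c' (lab \<circ> f)"
proof -
  have sim: "darts (dual_map M) = X" "rot (dual_map M) = f" "opp (dual_map M) = opp M"
    by (simp_all add: dual_map_def)
  show ?thesis
  proof (unfold_locales, unfold sim)
    show "combinatorial_map (dual_map M)" by (rule comb_dual)
    have "c' d \<noteq> c' (opp M d)" if "d \<in> X" for d using that by (cases rule: edge_cases) auto
    then show "colored_orientation (dual_map M) c'"
      unfolding colored_orientation_def sim by (auto simp: dual_coloring_def)
    fix x :: 'd and i :: color assume x: "x \<in> X"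
    obtain y where "{y \<in> orbit f x. c' y = Some i} = {y}"
      using face_unique[OF x, of i] by (metis card_1_singletonE)
    then have "z \<in> orbit f x \<and> c' z = Some i \<longleftrightarrow> z = y" for z by blast
    then show "\<exists>!y. y \<in> origin (dual_map M) x \<and> c' y = Some i"
      unfolding origin_def sim by simp
    show "(lab \<circ> f) (f x) = (lab \<circ> f) x" if "c' (f x) = None"
      using dual_label[of "f x"] x that by simp
    show "(lab \<circ> f) x = i + 1 \<and> (lab \<circ> f) (f x) = i - 1" if "c' (f x) = Some i"
      using dual_label[of "f x"] x that by simp
    show "(lab \<circ> f) x = i" if "c' x = None" "c' (opp M x) = Some i"
      using x that by (cases rule: edge_cases) auto
  qed
qed

end

section \<open>Cutting the torus along cycles\<close>

lemma swap_on_Un: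
  assumes "h ` S \<subseteq> S" "S \<inter> T = {}" "h ` T \<subseteq> T"
  shows "swap_on h S \<circ> swap_on h T = swap_on h (S \<union> T)"
  using assms by (auto simp: swap_on_def fun_eq_iff)

context cut
begin

lemma cutset_closed: "cutset \<subseteq> X" "h ` cutset \<subseteq> cutset"
  using W h by auto

lemma card_cutset: "card cutset = 2 * card W"
proof -
  have fin: "finite W" using finX W finite_subset by blast
  have "inj_on h W" using W h by (metis inj_onI subsetD)
  then have "card (h ` W) = card W" by (rule card_image)
  moreover have "W \<inter> h ` W = {}" using W by auto
  ultimately show ?thesis using fin by (simp add: card_Un_disjoint)
qed

lemma orbit_h: "d \<in> W \<Longrightarrow> orbit r (h d) = orbit r (nx d)"
  using h_orbit orbit_eq_iff[OF perm] by blast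

end

text \<open>Cutting along \<open>W1\<close> does not touch the cycles through \<open>W2\<close>, so
  \<open>W2\<close> can be cut afterwards and each family contributes 2. Applying
  \<open>card_cut\<close> to the union would yield only 2 in total.\<close>

lemma cut_Un:
  assumes "cut X r h n1 W1" "cut X r h n2 W2"
    and disj: "\<And>x y. x \<in> W1 \<Longrightarrow> y \<in> W2 \<Longrightarrow> orbit r x \<noteq> orbit r y"
  shows "cut X r h (\<lambda>d. if d \<in> W1 then n1 d else n2 d) (W1 \<union> W2)"
    and "W1 \<noteq> {} \<Longrightarrow> W2 \<noteq> {} \<Longrightarrow> card (classes X (fgraph X r)) + 4 \<le>
      card (classes X (fgraph X (r \<circ> swap_on h ((W1 \<union> W2) \<union> h ` (W1 \<union> W2))))) + card (W1 \<union> W2)"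
    and "((W1 \<union> h ` W1) \<inter> (W2 \<union> h ` W2)) = {}"
proof -
  interpret c1: cut X r h n1 W1 by fact
  interpret c2: cut X r h n2 W2 by fact
  have eq: "orbit r x = orbit r y \<longleftrightarrow> y \<in> orbit r x" for x y by (rule orbit_eq_iff[OF c1.perm])
  have o1: "\<exists>y\<in>W1. orbit r x = orbit r y" if "x \<in> c1.cutset" for x
    using that c1.orbit_h c1.nx_in by blast
  have o2: "\<exists>y\<in>W2. orbit r x = orbit r y" if "x \<in> c2.cutset" for x
    using that c2.orbit_h c2.nx_in by blast
  show dis: "c1.cutset \<inter> c2.cutset = {}"
  proof (rule ccontr)
    assume "c1.cutset \<inter> c2.cutset \<noteq> {}"
    then obtain x where "x \<in> c1.cutset" "x \<in> c2.cutset" by blast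
    then show False using o1 o2 disj by metis
  qed
  have W12: "W1 \<inter> W2 = {}" using dis by blast
  let ?nx = "\<lambda>d. if d \<in> W1 then n1 d else n2 d"
  have nx2: "?nx d = n2 d" if "d \<in> W2" for d using that W12 by auto
  show "cut X r h ?nx (W1 \<union> W2)"
  proof
    show "finite X" "r permutes X" by (rule c1.finX c1.r)+
    show "h (h x) = x" "h x \<in> X" if "x \<in> X" for x using that by (rule c1.h)+
    show "W1 \<union> W2 \<subseteq> X" using c1.W c2.W by blast
    show "h d \<notin> W1 \<union> W2" if "d \<in> W1 \<union> W2" for d using that c1.W c2.W dis by blast
    have "?nx ` W2 = n2 ` W2" by (rule image_cong) (use W12 in auto)
    moreover have "?nx ` W1 = n1 ` W1" by (rule image_cong) auto
    ultimately have "?nx ` W2 = W2" "?nx ` W1 = W1" unfolding c1.nx c2.nx by blast+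
    then show "?nx ` (W1 \<union> W2) = W1 \<union> W2" by (simp only: image_Un)
    show "h d \<in> orbit r (?nx d)" if "d \<in> W1 \<union> W2" for d
      using that c1.h_orbit c2.h_orbit nx2 by auto
    show "d' = d" if "d \<in> W1 \<union> W2" "d' \<in> W1 \<union> W2" "d' \<in> orbit r d" for d d'
      using that c1.inj c2.inj disj[of d d'] disj[of d' d] eq[of d d'] by auto
  qed
  have orb: "orbit c1.cut_perm x = orbit r x" if "x \<in> W2" for x
  proof (rule c1.orbit_cut_perm)
    show "orbit r x \<inter> W1 = {}" using disj that eq[of x] by fastforce
  qed
  have "cut X c1.cut_perm h n2 W2"
  proof
    show "finite X" "c1.cut_perm permutes X" by (rule c1.finX c1.cut_perm_permutes)+
    show "h (h x) = x" "h x \<in> X" if "x \<in> X" for x using that by (rule c1.h)+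
    show "W2 \<subseteq> X" "n2 ` W2 = W2" by (rule c2.W c2.nx)+
    show "h d \<notin> W2" if "d \<in> W2" for d using that by (rule c2.W)
    show "h d \<in> orbit c1.cut_perm (n2 d)" if "d \<in> W2" for d
      using c2.h_orbit[OF that] orb[OF c2.nx_in[OF that]] by simp
    show "d' = d" if "d \<in> W2" "d' \<in> W2" "d' \<in> orbit c1.cut_perm d" for d d'
      using c2.inj[OF that(1,2)] that(3) orb[OF that(1)] by simp
  qed
  then interpret c3: cut X c1.cut_perm h n2 W2 .
  assume ne: "W1 \<noteq> {}" "W2 \<noteq> {}"
  have le: "card (classes X (fgraph X r)) + 2 \<le> card (classes X (fgraph X c1.cut_perm)) + card W1"
    "card (classes X (fgraph X c1.cut_perm)) + 2 \<le> card (classes X (fgraph X (c1.cut_perm \<circ> swap_on h c2.cutset))) + card W2"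
    using c1.card_cut[OF ne(1)] c3.card_cut[OF ne(2)] by blast+
  have perm_eq: "c1.cut_perm \<circ> swap_on h c2.cutset = r \<circ> swap_on h ((W1 \<union> W2) \<union> h ` (W1 \<union> W2))"
  proof -
    have "c1.cut_perm \<circ> swap_on h c2.cutset = r \<circ> swap_on h (c1.cutset \<union> c2.cutset)"
      unfolding comp_assoc using swap_on_Un[OF c1.cutset_closed(2) dis c2.cutset_closed(2)] by simp
    also have "c1.cutset \<union> c2.cutset = (W1 \<union> W2) \<union> h ` (W1 \<union> W2)" by blast
    finally show ?thesis .
  qed
  have "card (W1 \<union> W2) = card W1 + card W2"
    using W12 c1.W c2.W c1.finX finite_subset by (intro card_Un_disjoint) blast+
  then show "card (classes X (fgraph X r)) + 4 \<le>
      card (classes X (fgraph X (r \<circ> swap_on h ((W1 \<union> W2) \<union> h ` (W1 \<union> W2))))) + card (W1 \<union> W2)"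
    using le unfolding perm_eq by linarith
qed

lemma classes_inv:
  assumes "finite X" "f permutes X"
  shows "classes X (fgraph X (inv f)) = classes X (fgraph X f)"
proof -
  have "permutation f" using assms permutation_permutes by blast
  then have "orbit (inv f) x = orbit f x" for x by (rule orbit_inv_eq)
  then show ?thesis
    using classes_perm[OF assms] classes_perm[OF assms(1) permutes_inv[OF assms(2)]] by simp
qed

context labelled_map
begin

text \<open>Since \<open>nxt i\<close> permutes the finite set \<open>W\<close>, this describes the
  dart sets of unions of disjoint monochromatic cycles of color \<open>i\<close>.\<close>

definition fam :: "color \<Rightarrow> 'd set \<Rightarrow> bool" where
  "fam i W \<longleftrightarrow> W \<subseteq> X \<and> (\<forall>x\<in>W. c x = Some i) \<and> nxt i ` W = W"

abbreviation bd :: "'d set \<Rightarrow> 'd set" where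
  "bd W \<equiv> W \<union> opp M ` W"

lemma fam_cyc: "rec i x \<Longrightarrow> fam i (cyc i x)"
  unfolding fam_def using nxt_cyc cyc_rec rec_in by blast

lemma fam_Un: "fam i W \<Longrightarrow> fam i W' \<Longrightarrow> fam i (W \<union> W')"
  unfolding fam_def by (auto simp: image_Un)

lemma fam_empty [simp]: "fam i {}"
  by (simp add: fam_def)

lemma famD:
  assumes "fam i W" "d \<in> W"
  shows "d \<in> X" "c d = Some i" "nxt i d \<in> W" "origin M (nxt i d) = origin M (opp M d)"
  using assms nxt(3) unfolding fam_def by blast+

text \<open>The version for \<open>rot M\<close> is applied in the dual, where the rotation is
  \<open>f\<close>. Primal cuts use \<open>inv (rot M)\<close>, because \<open>cut_perm\<close> has
  the swap on the right and \<open>sigma\<close> has it on the left.\<close>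

lemma fam_cut:
  assumes W: "fam i W"
  shows "cut X (rot M) (opp M) (nxt i) W" "cut X (inv (rot M)) (opp M) (nxt i) W"
proof -
  have 1: "opp M d \<notin> W" if "d \<in> W" for d
    using c_opp_ne famD[OF W] that by blast
  have 2: "opp M d \<in> orbit (rot M) (nxt i d)" if "d \<in> W" for d
    using famD(4)[OF W that] origin_eq[of "opp M d" "nxt i d"] by (simp add: origin_def)
  have 3: "d' = d" if "d \<in> W" "d' \<in> W" "d' \<in> orbit (rot M) d" for d d'
    using out_eqI[of d' d i] famD[OF W] that origin_eq[of d' d] by (auto simp: origin_def)
  show "cut X (rot M) (opp M) (nxt i) W"
    by unfold_locales (use W 1 2 3 finX rot_perm in \<open>auto simp: fam_def\<close>)
  show "cut X (inv (rot M)) (opp M) (nxt i) W"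
    by unfold_locales
      (use W 1 2 3 finX permutes_inv[OF rot_perm] in \<open>auto simp: fam_def orbit_inv_eq[OF perm_rot]\<close>)
qed

lemma fam_prev:
  assumes "fam i W" "e \<in> W" "d \<in> W" "origin M (opp M d) = origin M e"
  shows "nxt i d = e"
  using assms famD by (intro nxt_eqI) auto

lemma bd_origin:
  assumes "fam i W" "x \<in> bd W"
  shows "\<exists>e\<in>W. origin M e = origin M x"
  using assms famD(3,4)[OF assms(1)] by auto

end

sublocale torus_wood \<subseteq> dual: labelled_map "dual_map M" "dual_coloring M c" "lab \<circ> face_next M"
  by (rule dual_labelled)

context torus_wood
begin

lemma dual_simps [simp]:
  "darts (dual_map M) = X" "rot (dual_map M) = f" "opp (dual_map M) = opp M"
  by (simp_all add: dual_map_def)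

text \<open>
  The torus is cut along the dual cycles that cross the edges of \<open>A\<close> and along the primal cycles with
  edges in \<open>B\<close>. The cycles of \<open>sigma B\<close> and \<open>phi A\<close> are the vertices and faces after cutting, and the
  classes of \<open>gen A B\<close> are the components.
\<close>

definition sigma :: "'d set \<Rightarrow> 'd \<Rightarrow> 'd" where
  "sigma B = swap_on (opp M) B \<circ> rot M"

definition phi :: "'d set \<Rightarrow> 'd \<Rightarrow> 'd" where
  "phi A = f \<circ> swap_on (opp M) A"

definition gen :: "'d set \<Rightarrow> 'd set \<Rightarrow> ('d \<times> 'd) set" where
  "gen A B = fgraph X (sigma B) \<union> fgraph X (phi A)"

abbreviation "R A B \<equiv> conn (gen A B)"

definition sep :: "'d set \<Rightarrow> 'd set \<Rightarrow> bool" where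
  "sep A B \<longleftrightarrow> A \<subseteq> X \<and> B \<subseteq> X \<and> opp M ` A \<subseteq> A \<and> opp M ` B \<subseteq> B \<and> A \<inter> B = {}"

lemma sepD:
  assumes "sep A B"
  shows "opp M x \<in> A \<longleftrightarrow> x \<in> A" "opp M x \<in> B \<longleftrightarrow> x \<in> B" "x \<in> A \<Longrightarrow> x \<notin> B"
  using assms unfolding sep_def by (metis image_subset_iff opp_opp, metis image_subset_iff opp_opp, blast)

lemma sigma_perm: "sep A B \<Longrightarrow> sigma B permutes X"
  unfolding sigma_def sep_def by (intro permutes_compose[OF rot_perm] swap_on_permutes) auto

lemma phi_perm: "sep A B \<Longrightarrow> phi A permutes X"
  unfolding phi_def sep_def by (intro permutes_compose[OF _ face_next_perm] swap_on_permutes) auto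

text \<open>This relates vertices, faces and edges in the map that remains after cutting: its edges
  are the uncut ones.\<close>

lemma sigma_phi: "sep A B \<Longrightarrow> x \<in> X \<Longrightarrow> sigma B (phi A x) = swap_on (opp M) (X - A - B) x"
  using sepD[of A B] by (auto simp: sigma_def phi_def swap_on_def)

lemma R_sigma: "x \<in> X \<Longrightarrow> (x, sigma B x) \<in> R A B"
  unfolding gen_def by (auto intro!: conn_base fgraphI)

lemma R_phi: "x \<in> X \<Longrightarrow> (x, phi A x) \<in> R A B"
  unfolding gen_def by (auto intro!: conn_base fgraphI)

lemma R_rot: "x \<in> X \<Longrightarrow> rot M x \<notin> B \<Longrightarrow> (x, rot M x) \<in> R A B"
  using R_sigma[of x B A] by (simp add: sigma_def swap_on_def)

lemma R_rot_cut: "x \<in> X \<Longrightarrow> rot M x \<in> B \<Longrightarrow> (x, opp M (rot M x)) \<in> R A B"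
  using R_sigma[of x B A] by (simp add: sigma_def swap_on_def)

lemma R_swap:
  assumes "sep A B" "x \<in> X"
  shows "(x, swap_on (opp M) (X - A - B) x) \<in> R A B"
proof -
  have "phi A x \<in> X" using phi_perm[OF assms(1)] assms(2) by (simp add: permutes_in_image)
  then show ?thesis
    using R_phi[OF assms(2), of A B] R_sigma[of "phi A x" B A] sigma_phi[OF assms] by (auto dest: conn_trans)
qed

lemma R_opp: "sep A B \<Longrightarrow> x \<in> X \<Longrightarrow> x \<notin> A \<Longrightarrow> x \<notin> B \<Longrightarrow> (x, opp M x) \<in> R A B"
  using R_swap[of A B x] by (simp add: swap_on_def)

text \<open>By \<open>sigma_phi\<close>, the vertex and the face permutation determine each other
  through the uncut edges. So if one of them stays the same, connectivity after a new cut has to be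
  checked only across the newly uncut edges. Cuts are undone in this way.\<close>

lemma R_recut:
  assumes "sep A B" "sep A' B'" and "A = A' \<or> B = B'" and sub: "gen A B \<subseteq> conn S"
    and uncut: "\<And>x. x \<in> X \<Longrightarrow> x \<notin> A' \<Longrightarrow> x \<notin> B' \<Longrightarrow> (x, opp M x) \<in> conn S"
  shows "gen A' B' \<subseteq> conn S"
proof -
  have RS: "R A B \<subseteq> conn S" using sub by (rule conn_least)
  have sw: "(x, swap_on (opp M) (X - A' - B') x) \<in> conn S" if "x \<in> X" for x
    using uncut[of x] that by (auto simp: swap_on_def)
  have both: "(x, sigma B' (phi A' x)) \<in> conn S" if "x \<in> X" for x
    using sw[OF that] sigma_phi[OF assms(2) that] by simp
  show ?thesis
  proof (cases "A = A'")
    case True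
    have phi: "(y, phi A' y) \<in> conn S" if "y \<in> X" for y
      using RS R_phi[OF that, of A B] True by blast
    have "(y, sigma B' y) \<in> conn S" if y: "y \<in> X" for y
    proof -
      have "phi A permutes X" using phi_perm assms(1) by blast
      then obtain x where x: "x \<in> X" "y = phi A x" using y by (metis imageE permutes_image)
      have "(y, x) \<in> conn S" using conn_sym[OF phi[OF x(1)]] x(2) True by simp
      also have "(x, sigma B' y) \<in> conn S" using both[OF x(1)] x(2) True by simp
      finally show ?thesis .
    qed
    then show ?thesis using phi by (auto simp: gen_def fgraph_def)
  next
    case False
    then have B: "B = B'" using assms(3) by simp
    have sigma: "(y, sigma B' y) \<in> conn S" if "y \<in> X" for y
      using RS R_sigma[OF that, of B A] B by blast
    have "(x, phi A' x) \<in> conn S" if "x \<in> X" for x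
    proof -
      have "phi A' x \<in> X" using phi_perm[OF assms(2)] that by (simp add: permutes_in_image)
      then have "(sigma B' (phi A' x), phi A' x) \<in> conn S" by (intro conn_sym[OF sigma])
      with both[OF that] show ?thesis by (rule conn_trans)
    qed
    then show ?thesis using sigma by (auto simp: gen_def fgraph_def)
  qed
qed

lemma gen_connected: "x \<in> X \<Longrightarrow> y \<in> X \<Longrightarrow> (x, y) \<in> R {} {}"
proof -
  have sep: "sep {} {}" by (simp add: sep_def)
  have "fgraph X (rot M) \<union> fgraph X (opp M) \<subseteq> R {} {}"
    using R_rot[of _ "{}" "{}"] R_opp[OF sep] by (auto simp: fgraph_def)
  then show "x \<in> X \<Longrightarrow> y \<in> X \<Longrightarrow> (x, y) \<in> R {} {}"
    using torus conn_least unfolding torus_def by blast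
qed

lemma card_classes_connected:
  assumes "\<And>x y. x \<in> X \<Longrightarrow> y \<in> X \<Longrightarrow> (x, y) \<in> conn S"
  shows "card (classes X S) \<le> 1"
proof -
  have "K = L" if KL: "K \<in> classes X S" "L \<in> classes X S" for K L
  proof -
    obtain x y where "K = conn S `` {x}" "L = conn S `` {y}" "x \<in> X" "y \<in> X"
      using KL unfolding classes_def by blast
    then show ?thesis using assms conn_class_eq[of S x y] by simp
  qed
  then show ?thesis using card_le_Suc0_iff_eq[OF finite_classes[OF finX, of S]] by auto
qed

text \<open>For \<open>m\<close> primal and \<open>n\<close> dual cycles, \<open>a + b\<close> edges
  are removed, while the vertices decrease by at most \<open>b - 2 * m\<close> and the faces by at
  most \<open>a - 2 * n\<close>. The Euler characteristic rises from 0 to at least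
  \<open>2 * (m + n)\<close>, and a component accounts for at most 2.\<close>

lemma components_after_cut:
  assumes sep: "sep A B"
    and "card A = 2 * a" "card B = 2 * b"
    and "card (classes X (fgraph X (rot M))) + 2 * m \<le> card (classes X (fgraph X (sigma B))) + b"
    and "card (classes X (fgraph X f)) + 2 * n \<le> card (classes X (fgraph X (phi A))) + a"
  shows "m + n \<le> card (classes X (gen A B))"
proof -
  let ?S = "X - A - B"
  let ?e = "swap_on (opp M) ?S"
  have sub: "?S \<subseteq> X" "opp M ` ?S \<subseteq> ?S" using sepD[OF sep] by auto
  have "inv (sigma B) \<circ> ?e = phi A"
  proof
    fix x
    show "(inv (sigma B) \<circ> ?e) x = phi A x"
    proof (cases "x \<in> X")
      case True
      then show ?thesis
        using sigma_phi[OF sep True] permutes_inverses(2)[OF sigma_perm[OF sep], of "phi A x"] by simp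
    next
      case False
      have "inv (sigma B) \<circ> ?e permutes X"
        using sub sigma_perm[OF sep]
        by (intro permutes_compose[of _ X] swap_on_permutes permutes_inv) auto
      then show ?thesis using phi_perm[OF sep] False by (metis permutes_not_in)
    qed
  qed
  moreover have "opp M (opp M x) = x \<and> opp M x \<noteq> x" if "x \<in> X" for x using that opp_ne by simp
  ultimately have euler: "2 * (card (classes X (fgraph X (sigma B))) + card (classes X (fgraph X (phi A))))
      \<le> card ?S + 4 * card (classes X (fgraph X (sigma B) \<union> fgraph X ?e))"
    using euler_inequality[OF finX sigma_perm[OF sep] _ sub] by simp
  have "fgraph X (sigma B) \<union> fgraph X ?e \<subseteq> R A B"
    using R_sigma R_swap[OF sep] by (auto simp: fgraph_def)
  moreover have "gen A B \<subseteq> conn (fgraph X (sigma B) \<union> fgraph X ?e)" (is "_ \<subseteq> ?C")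
  proof -
    have s: "(x, sigma B x) \<in> ?C" "(x, ?e x) \<in> ?C" if "x \<in> X" for x
      using that by (auto intro!: conn_base fgraphI)
    have "(x, phi A x) \<in> ?C" if x: "x \<in> X" for x
    proof -
      have "phi A x \<in> X" using phi_perm[OF sep] x by (simp add: permutes_in_image)
      then have "(phi A x, ?e x) \<in> ?C" using s(1) sigma_phi[OF sep x] by metis
      then show ?thesis using s(2)[OF x] by (meson conn_sym conn_trans)
    qed
    then show ?thesis using s(1) by (auto simp: gen_def fgraph_def)
  qed
  then have comp: "card (classes X (fgraph X (sigma B) \<union> fgraph X ?e)) \<le> card (classes X (gen A B))"
    by (rule card_classes_antimono[OF finX])
  have "card ?S + 2 * a + 2 * b = card X"
  proof -
    have AB: "A \<subseteq> X" "B \<subseteq> X - A" using sep unfolding sep_def by auto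
    have "card (X - A) + card A = card X"
      using AB finX by (metis card_Diff_subset card_mono finite_subset le_add_diff_inverse2)
    moreover have "card (X - A - B) + card B = card (X - A)"
      using AB finX by (metis card_Diff_subset card_mono finite_Diff finite_subset le_add_diff_inverse2)
    ultimately show ?thesis using assms(2,3) by simp
  qed
  moreover have "2 * card (classes X (fgraph X (rot M))) + 2 * card (classes X (fgraph X f)) = card X"
    using torus unfolding torus_def by simp
  ultimately show ?thesis using euler comp assms(4,5) by (simp add: algebra_simps)
qed

end

section \<open>Sides of monochromatic cycles\<close>

lemma conn_join: "(x, z) \<in> conn R \<Longrightarrow> (y, z) \<in> conn R \<Longrightarrow> (x, y) \<in> conn R"
  using conn_sym conn_trans by metis

lemma conn_fork: "(z, x) \<in> conn R \<Longrightarrow> (z, y) \<in> conn R \<Longrightarrow> (x, y) \<in> conn R"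
  using conn_sym conn_trans by metis

context torus_wood
begin

text \<open>
  The sides are left for \<open>s = 1\<close> and right for \<open>s = - 1\<close>. An edge of color \<open>i + s\<close> leaves a primal cycle of
  color \<open>i\<close> on side \<open>s\<close> and enters it on side \<open>- s\<close>, but it crosses a dual cycle of color \<open>i\<close> from side
  \<open>s\<close> to side \<open>- s\<close>.
\<close>

definition pside :: "color \<Rightarrow> 'd \<Rightarrow> 'd" where
  "pside s e = (if s = 1 then e else opp M e)"

definition dside :: "color \<Rightarrow> 'd \<Rightarrow> 'd" where
  "dside s d = (if s = 1 then opp M d else d)"

lemma sign_cases:
  assumes "(s::color) \<noteq> 0"
  obtains "s = 1" | "s = - 1"
  using assms by (cases rule: color_cases[of s 0]) auto

lemma color_third:
  fixes m i s :: color
  assumes "m \<noteq> i" "m \<noteq> i + s" "s \<noteq> 0"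
  shows "m = i + - s"
  using assms(3)
proof (cases rule: sign_cases)
  case 1
  then show ?thesis using assms by (cases rule: color_cases[of m i]) auto
next
  case 2
  then show ?thesis using assms by (cases rule: color_cases[of m i]) auto
qed

lemma inv_sigma: "inv (sigma B) = inv (rot M) \<circ> swap_on (opp M) B" if "opp M ` B \<subseteq> B" for B
proof (rule inv_unique_comp)
  have sw: "swap_on (opp M) B (swap_on (opp M) B x) = x" for x
    using that by (auto simp: swap_on_def)
  show "sigma B \<circ> (inv (rot M) \<circ> swap_on (opp M) B) = id"
    using sw by (simp add: sigma_def fun_eq_iff)
  show "inv (rot M) \<circ> swap_on (opp M) B \<circ> sigma B = id"
    using sw by (simp add: sigma_def fun_eq_iff)
qed

lemma conn_inv_sigma:
  assumes "sep A B"
  shows "conn (fgraph X (inv (sigma B))) \<subseteq> R A B"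
proof (rule conn_least)
  have "(x, inv (sigma B) x) \<in> R A B" if "x \<in> X" for x
  proof -
    have "inv (sigma B) x \<in> X"
      using permutes_inv[OF sigma_perm[OF assms]] that by (simp add: permutes_in_image)
    from R_sigma[OF this, of B A] show ?thesis
      using permutes_inverses(1)[OF sigma_perm[OF assms]] by (simp add: conn_sym)
  qed
  then show "fgraph X (inv (sigma B)) \<subseteq> R A B" by (auto simp: fgraph_def)
qed

lemma conn_phi: "conn (fgraph X (phi A)) \<subseteq> R A B"
  unfolding gen_def by (rule conn_mono) simp

lemma primal_same_side:
  assumes "cut X (inv (rot M)) (opp M) nx W" "sep A (bd W)" "d \<in> W"
  shows "(pside s d, pside s (nx d)) \<in> R A (bd W)"
proof -
  interpret cut X "inv (rot M)" "opp M" nx W by fact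
  have "inv (sigma (bd W)) = cut_perm" by (rule inv_sigma) auto
  then show ?thesis
    using same_side[OF assms(3)] conn_inv_sigma[OF assms(2)] by (auto simp: pside_def)
qed

lemma dual_same_side:
  assumes "cut X f (opp M) nx W" "d \<in> W"
  shows "(dside s d, dside s (nx d)) \<in> R (bd W) B"
proof -
  interpret cut X f "opp M" nx W by fact
  have "phi (bd W) = cut_perm" by (simp add: phi_def)
  then show ?thesis
    using same_side[OF assms(2)] conn_phi[of "bd W" B] by (auto simp: dside_def)
qed

lemma primal_cut_card:
  assumes "cut X (inv (rot M)) (opp M) nx W" "W \<noteq> {}" "sep A (bd W)"
  shows "card (classes X (fgraph X (rot M))) + 2 \<le> card (classes X (fgraph X (sigma (bd W)))) + card W"
    "card (bd W) = 2 * card W"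
proof -
  interpret cut X "inv (rot M)" "opp M" nx W by fact
  have "inv (sigma (bd W)) = cut_perm" by (rule inv_sigma) auto
  then show "card (classes X (fgraph X (rot M))) + 2 \<le> card (classes X (fgraph X (sigma (bd W)))) + card W"
    using card_cut[OF assms(2)] classes_inv[OF finX rot_perm] classes_inv[OF finX sigma_perm[OF assms(3)]]
    by simp
  show "card (bd W) = 2 * card W" by (rule card_cutset)
qed

lemma sign_neg: "s \<noteq> 0 \<Longrightarrow> - s \<noteq> (0 :: color)"
  by simp

lemma dside_opp: "s \<noteq> 0 \<Longrightarrow> dside (- s) e = opp M (dside s e)"
  by (cases s rule: sign_cases) (auto simp: dside_def)

lemma out_opp_prev:
  assumes W: "fam i W" and "z \<in> bd W" "c z = Some j" "j \<noteq> i"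
  obtains d where "d \<in> W" "z = opp M d" "origin M (nxt i d) = origin M z"
proof -
  have "z \<notin> W" using assms(3,4) famD(2)[OF W] by auto
  then obtain d where "d \<in> W" "z = opp M d" using assms(2) by auto
  then show thesis using that famD(4)[OF W] by metis
qed

text \<open>Such a dart is the reverse of a cycle edge and so lies in the corner opposite to the
  outgoing cycle edge. A rotation through the corners \<open>i - 1\<close> and \<open>i + 1\<close>
  therefore meets no uncolored cut dart.\<close>

lemma bd_None:
  assumes W: "fam i W" and z: "z \<in> bd W" "c z = None"
  shows "lab z = i" "\<exists>d\<in>W. z = opp M d"
proof -
  have "z \<notin> W" using z famD(2)[OF W] by auto
  then obtain d where d: "d \<in> W" "z = opp M d" using z by auto
  then show "\<exists>d\<in>W. z = opp M d" by blast
  show "lab z = i" using lab_enter[of z i] d famD(1,2)[OF W d(1)] z(2) by simp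
qed

section \<open>Following colored paths in the cut torus\<close>

context
  fixes i :: color and W A :: "'d set"
  assumes W: "fam i W" and sep: "sep A (bd W)"
begin

abbreviation "RW \<equiv> R A (bd W)"

text \<open>The corner \<open>i - 1\<close> starts at \<open>e\<close> and runs counterclockwise; no
  cut dart is met in it, so it lies on the left of \<open>e\<close>.\<close>

lemma left_corner:
  assumes e: "e \<in> W" and x: "x \<in> X" "origin M x = origin M e" "lab x = i - 1"
  shows "(e, x) \<in> RW"
proof -
  have eX: "e \<in> X" "c e = Some i" using famD[OF W e] by auto
  have o: "out_dart i x = e" using out_unique[OF x(1), of e i] eX x(2) by simp
  obtain k where k: "x = (rot M ^^ k) e" "\<forall>j\<le>k. lab ((rot M ^^ j) e) = i - 1"
    using lab_sector[OF x(1,3)] o by auto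
  have "(e, (rot M ^^ j) e) \<in> RW" if "j \<le> k" for j
    using that
  proof (induction j)
    case (Suc j)
    let ?y = "(rot M ^^ j) e"
    have yX: "?y \<in> X" using eX by (simp add: funpow_closed)
    have labr: "lab (rot M ?y) = i - 1" using k(2) Suc.prems by (metis comp_apply funpow.simps(2))
    show ?case
    proof (cases "c (rot M ?y)")
      case None
      have "rot M ?y \<notin> bd W" using bd_None(1)[OF W _ None] labr by auto
      then have "(?y, rot M ?y) \<in> RW" by (rule R_rot[OF yX])
      moreover have "(e, ?y) \<in> RW" using Suc by simp
      ultimately have "(e, rot M ?y) \<in> RW" by (rule conn_trans[rotated])
      then show ?thesis by simp
    next
      case (Some m)
      then have "m = i" using lab_self[of "rot M ?y" m] yX labr by simp
      then have "rot M ?y = e" by (intro out_eqI) (use Some yX eX in simp_all)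
      then show ?thesis by simp
    qed
  qed simp
  from this[of k] show ?thesis using k(1) by simp
qed

text \<open>The corner \<open>i + 1\<close> ends at \<open>e\<close>. In the cut torus the last
  rotation, instead of reaching \<open>e\<close>, leads to \<open>opp M e\<close>, which stands for
  the right side.\<close>

lemma right_corner:
  assumes e: "e \<in> W" and x: "x \<in> X" "origin M x = origin M e" "lab x = i + 1"
  shows "(opp M e, x) \<in> RW"
proof -
  have eX: "e \<in> X" "c e = Some i" using famD[OF W e] by auto
  obtain n where "e = (rot M ^^ n) x" using origin_funpowE[OF x(2)[symmetric]] by blast
  then show ?thesis using x
  proof (induction n arbitrary: x)
    case 0
    then show ?case using lab_self[OF eX] by simp
  next
    case (Suc n)
    let ?y = "rot M x"
    have n: "e = (rot M ^^ n) ?y" using Suc.prems(1) by (simp add: funpow_swap1)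
    show ?case
    proof (cases "c ?y")
      case None
      have l: "lab ?y = i + 1" using lab_None[OF Suc.prems(2) None] Suc.prems(4) by simp
      then have "?y \<notin> bd W" using bd_None(1)[OF W _ None] by auto
      then have "(x, ?y) \<in> RW" by (rule R_rot[OF Suc.prems(2)])
      moreover have "(opp M e, ?y) \<in> RW" by (rule Suc.IH[OF n]) (use Suc.prems(2,3) l in simp_all)
      ultimately show ?thesis by (rule conn_join[rotated])
    next
      case (Some m)
      then have "m = i" using lab_Some[OF Suc.prems(2) Some] Suc.prems(4) by simp
      then have y: "?y = e" by (intro out_eqI) (use Some Suc.prems(2,3) eX in simp_all)
      then have "(x, opp M e) \<in> RW" using R_rot_cut[OF Suc.prems(2), of "bd W" A] e by simp
      then show ?thesis by (rule conn_sym)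
    qed
  qed
qed

text \<open>The edge of color \<open>i + 1\<close> ends the corner that follows \<open>e\<close>,
  and the edge of color \<open>i - 1\<close> starts the corner that precedes
  \<open>e\<close>.\<close>

lemma leave_side:
  assumes e: "e \<in> W" and s: "s \<noteq> 0" and y: "out_dart (i + s) e \<notin> bd W"
  shows "(pside s e, out_dart (i + s) e) \<in> RW"
  using s
proof (cases rule: sign_cases)
  case 1
  have eX: "e \<in> X" using famD[OF W e] by auto
  let ?y = "out_dart (i + s) e" and ?z = "inv (rot M) (out_dart (i + s) e)"
  have yX: "?y \<in> X" "origin M ?y = origin M e" "c ?y = Some (i + s)" using out[OF eX] by auto
  have "lab ?z = i - 1" using lab_Some[of ?z "i + s"] yX 1 by simp
  then have "(e, ?z) \<in> RW" using left_corner[OF e, of ?z] yX by simp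
  also have "(?z, ?y) \<in> RW" using R_rot[of ?z "bd W" A] yX(1) y by simp
  finally show ?thesis using 1 by (simp add: pside_def)
next
  case 2
  have eX: "e \<in> X" using famD[OF W e] by auto
  let ?y = "out_dart (i + s) e"
  have yX: "?y \<in> X" "origin M ?y = origin M e" "c ?y = Some (i + s)" using out[OF eX] by auto
  have "lab ?y = i + 1" using lab_self[OF yX(1,3)] 2 by simp
  then have "(opp M e, ?y) \<in> RW" using right_corner[OF e yX(1,2)] by simp
  then show ?thesis using 2 by (simp add: pside_def)
qed

text \<open>An edge that only enters lies in the corner \<open>i + s\<close>, which is next to
  \<open>e\<close> on side \<open>- s\<close>. An edge that also leaves the vertex can do so only in
  color \<open>i + - s\<close>, and \<open>leave_side\<close> applies to it.\<close>

lemma enter_side: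
  assumes e: "e \<in> W" and s: "s \<noteq> 0"
    and x: "x \<in> X" "origin M x = origin M e" "c (opp M x) = Some (i + s)" "x \<notin> bd W"
  shows "(pside (- s) e, x) \<in> RW"
proof (cases "c x")
  case None
  then have l: "lab x = i + s" using lab_enter x by blast
  show ?thesis using s
  proof (cases rule: sign_cases)
    case 1
    then show ?thesis using right_corner[OF e x(1,2)] l by (simp add: pside_def)
  next
    case 2
    then show ?thesis using left_corner[OF e x(1,2)] l by (simp add: pside_def)
  qed
next
  case (Some m)
  have eX: "e \<in> X" "c e = Some i" using famD[OF W e] by auto
  have xm: "x = out_dart m e" using out_unique[OF eX(1) x(2) Some] .
  have "m \<noteq> i + s" using c_opp_ne[OF x(1) Some] x(3) by auto
  moreover have "m \<noteq> i"
  proof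
    assume "m = i"
    then have "x = e" using out_eqI[OF x(1,2)] Some eX by simp
    then show False using x(4) e by simp
  qed
  ultimately have "m = i + - s" using s by (intro color_third)
  then show ?thesis using leave_side[OF e sign_neg[OF s]] xm x(4) by simp
qed

lemma vertex_connected:
  assumes "x \<in> X" "origin M y = origin M x" "\<And>e. e \<in> W \<Longrightarrow> origin M e \<noteq> origin M x"
  shows "(x, y) \<in> RW"
proof -
  obtain n where n: "y = (rot M ^^ n) x" using origin_funpowE[OF assms(2)] by blast
  have "(x, (rot M ^^ n) x) \<in> RW" for n
  proof (induction n)
    case (Suc n)
    let ?y = "(rot M ^^ n) x"
    have "?y \<in> X" using assms(1) by (simp add: funpow_closed)
    moreover have "rot M ?y \<notin> bd W" using bd_origin[OF W, of "rot M ?y"] assms(3) by auto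
    ultimately have "(?y, rot M ?y) \<in> RW" by (rule R_rot)
    with Suc have "(x, rot M ?y) \<in> RW" by (rule conn_trans)
    then show ?case by simp
  qed simp
  then show ?thesis unfolding n .
qed

text \<open>Color \<open>i\<close> enters in the corner opposite to \<open>e\<close>, which the
  incoming cycle edge in general divides between the two sides. Here that edge is the outgoing one
  of color \<open>i + s\<close> and lies on the border, so the whole corner is on side
  \<open>- s\<close>.\<close>

lemma enter_cycle_side:
  assumes e: "e \<in> W" and s: "s \<noteq> 0" and p: "out_dart (i + s) e \<in> bd W"
    and x: "x \<in> X" "origin M x = origin M e" "c (opp M x) = Some i" "x \<notin> bd W"
  shows "(pside (- s) e, x) \<in> RW"
proof -
  have eX: "e \<in> X" "c e = Some i" using famD[OF W e] by auto
  let ?p = "out_dart (i + s) e"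
  have pX: "?p \<in> X" "origin M ?p = origin M e" "c ?p = Some (i + s)" using out[OF eX(1)] by auto
  obtain d where d: "d \<in> W" "?p = opp M d" using out_opp_prev[OF W p pX(3)] s by auto
  have nd: "nxt i d = e" using fam_prev[OF W e d(1)] d(2) pX(2) by simp
  interpret k: cut X "inv (rot M)" "opp M" "nxt i" W by (rule fam_cut(2)[OF W])
  have bdp: "y = ?p" if y: "y \<in> bd W" "c y = None" "origin M y = origin M e" for y
  proof -
    obtain d2 where d2: "d2 \<in> W" "y = opp M d2" using bd_None(2)[OF W y(1,2)] by blast
    then have "nxt i d2 = e" using fam_prev[OF W e d2(1)] y(3) by simp
    then have "d2 = d" using k.inj_nx[OF d2(1) d(1)] nd by simp
    then show ?thesis using d d2 by simp
  qed
  have notbd: "y \<notin> bd W" if "c y = None" "origin M y = origin M e" for y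
    using bdp[of y] that pX(3) by auto
  have same: "(pside t d, pside t e) \<in> RW" for t
    using primal_same_side[OF fam_cut(2)[OF W] sep d(1), of t] nd by simp
  show ?thesis
  proof (cases "c x")
    case (Some m)
    have xm: "x = out_dart m e" using out_unique[OF eX(1) x(2) Some] .
    have "m \<noteq> i" using c_opp_ne[OF x(1) Some] x(3) by auto
    moreover have "m \<noteq> i + s" using xm p x(4) by auto
    ultimately have "m = i + - s" using s by (intro color_third)
    then show ?thesis using leave_side[OF e sign_neg[OF s]] xm x(4) by simp
  next
    case None
    have lx: "lab x = i" using lab_enter[OF x(1) None x(3)] .
    show ?thesis using s
    proof (cases rule: sign_cases)
      case 1
      have o: "out_dart (i + 1) x = ?p" using out_unique[OF x(1), of ?p "i + 1"] pX x(2) 1 by simp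
      obtain k where k: "x = (rot M ^^ k) ?p" "\<forall>j\<le>k. lab ((rot M ^^ j) ?p) = i"
        using lab_sector[OF x(1) lx] o by auto
      have "(?p, (rot M ^^ j) ?p) \<in> RW" if "j \<le> k" for j
        using that
      proof (induction j)
        case (Suc j)
        let ?y = "(rot M ^^ j) ?p"
        have yX: "?y \<in> X" "origin M ?y = origin M e" using pX by (simp_all add: funpow_closed)
        have labr: "lab (rot M ?y) = i" using k(2) Suc.prems by (metis comp_apply funpow.simps(2))
        show ?case
        proof (cases "c (rot M ?y)")
          case None
          have "rot M ?y \<notin> bd W" using notbd[OF None] yX by simp
          then have "(?y, rot M ?y) \<in> RW" by (rule R_rot[OF yX(1)])
          moreover have "(?p, ?y) \<in> RW" using Suc by simp
          ultimately have "(?p, rot M ?y) \<in> RW" by (rule conn_trans[rotated])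
          then show ?thesis by simp
        next
          case (Some m)
          then have "m = i + 1" using lab_self[of "rot M ?y" m] yX labr by simp
          then have "rot M ?y = ?p" by (intro out_eqI) (use Some yX pX 1 in simp_all)
          then show ?thesis by simp
        qed
      qed simp
      from this[of k] have "(?p, x) \<in> RW" using k(1) by simp
      moreover have "(opp M d, opp M e) \<in> RW" using same[of "- 1"] by (simp add: pside_def)
      ultimately have "(opp M e, x) \<in> RW" unfolding d(2) by (rule conn_fork[rotated])
      then show ?thesis using 1 by (simp add: pside_def)
    next
      case 2
      obtain n where "?p = (rot M ^^ n) x"
        using origin_funpowE[of ?p x] pX(2) x(2) by metis
      then have "(x, d) \<in> RW" using x(1,2) lx
      proof (induction n arbitrary: x)
        case 0
        then show ?case using lab_self[OF pX(1,3)] 2 by simp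
      next
        case (Suc n)
        let ?y = "rot M x"
        have n: "?p = (rot M ^^ n) ?y" using Suc.prems(1) by (simp add: funpow_swap1)
        show ?case
        proof (cases "c ?y")
          case None
          have "?y \<notin> bd W" using notbd[OF None] Suc.prems(3) by simp
          then have "(x, ?y) \<in> RW" by (rule R_rot[OF Suc.prems(2)])
          moreover have "(?y, d) \<in> RW"
            by (rule Suc.IH[OF n]) (use Suc.prems(2-4) lab_None[OF Suc.prems(2) None] in simp_all)
          ultimately show ?thesis by (rule conn_trans)
        next
          case (Some m)
          then have "m = i + s" using lab_Some[OF Suc.prems(2) Some] Suc.prems(4) 2 by auto
          then have y: "?y = ?p" by (intro out_eqI) (use Some Suc.prems(2,3) pX in simp_all)
          then have "?y \<in> bd W" using p by simp
          from R_rot_cut[OF Suc.prems(2) this, of A] show ?thesis using y d(2) by simp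
        qed
      qed
      moreover have "(d, e) \<in> RW" using same[of 1] by (simp add: pside_def)
      ultimately have "(e, x) \<in> RW" by (rule conn_sym[OF conn_trans])
      then show ?thesis using 2 by (simp add: pside_def)
    qed
  qed
qed

lemma trace:
  assumes y: "y \<in> X" "c y = Some j" "y \<notin> bd W"
    and free: "\<And>m. m < n \<Longrightarrow> (nxt j ^^ m) y \<notin> A"
      "\<And>m e. m < n \<Longrightarrow> e \<in> W \<Longrightarrow> origin M e \<noteq> origin M (opp M ((nxt j ^^ m) y))"
  shows "(y, (nxt j ^^ n) y) \<in> RW \<and> (nxt j ^^ n) y \<notin> bd W"
  using free
proof (induction n)
  case (Suc n)
  let ?y = "(nxt j ^^ n) y"
  have IH: "(y, ?y) \<in> RW" "?y \<notin> bd W" using Suc by auto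
  have yX: "?y \<in> X" using nxt_funpow[OF y(1,2)] by blast
  have "(?y, opp M ?y) \<in> RW" using R_opp[OF sep yX] Suc.prems(1)[of n] IH(2) by blast
  moreover have "(opp M ?y, nxt j ?y) \<in> RW"
    using Suc.prems(2)[of n] nxt(3)[OF yX] yX by (intro vertex_connected) auto
  ultimately have "(y, nxt j ?y) \<in> RW" by (rule conn_trans[OF IH(1) conn_trans])
  moreover have "nxt j ?y \<notin> bd W"
    using bd_origin[OF W, of "nxt j ?y"] nxt(3)[OF yX, of j] Suc.prems(2)[of n] by auto
  ultimately show ?case by simp
qed (use y in simp)

text \<open>Before the least such index the path neither uses a cut edge nor visits a vertex of
  \<open>W\<close>, so it stays in one component.\<close>

lemma first_event:
  assumes y: "y \<in> X" "c y = Some j" "y \<notin> bd W"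
    and ev: "(nxt j ^^ N) y \<in> A \<or> (\<exists>e\<in>W. origin M e = origin M (opp M ((nxt j ^^ N) y)))"
  obtains n where "(y, (nxt j ^^ n) y) \<in> RW" "(nxt j ^^ n) y \<in> A"
  | n e where "e \<in> W" "origin M (opp M ((nxt j ^^ n) y)) = origin M e"
    "(y, opp M ((nxt j ^^ n) y)) \<in> RW" "opp M ((nxt j ^^ n) y) \<notin> bd W"
proof -
  let ?P = "\<lambda>n. (nxt j ^^ n) y \<in> A \<or> (\<exists>e\<in>W. origin M e = origin M (opp M ((nxt j ^^ n) y)))"
  define n where "n = (LEAST n. ?P n)"
  have P: "?P n" unfolding n_def using ev by (rule LeastI)
  have least: "\<not> ?P m" if "m < n" for m using not_less_Least that unfolding n_def by blast
  have tr: "(y, (nxt j ^^ n) y) \<in> RW" "(nxt j ^^ n) y \<notin> bd W"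
    using trace[OF y, of n] least by blast+
  show thesis
  proof (cases "(nxt j ^^ n) y \<in> A")
    case True
    then show ?thesis using that(1) tr by blast
  next
    case False
    then obtain e where e: "e \<in> W" "origin M e = origin M (opp M ((nxt j ^^ n) y))" using P by blast
    have "((nxt j ^^ n) y, opp M ((nxt j ^^ n) y)) \<in> RW"
      using R_opp[OF sep _ False tr(2)] nxt_funpow[OF y(1,2)] by blast
    with tr(1) have "(y, opp M ((nxt j ^^ n) y)) \<in> RW" by (rule conn_trans)
    moreover have "opp M ((nxt j ^^ n) y) \<notin> bd W" using tr(2) sepD(2)[OF sep] by blast
    ultimately show ?thesis using that(2)[OF e(1) e(2)[symmetric]] by blast
  qed
qed

text \<open>The cycle of color \<open>i + s\<close> leaves \<open>W\<close> on side \<open>s\<close>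
  and finally returns to the vertex of \<open>e\<close>. Unless it uses an edge of \<open>A\<close>
  before, its first return to \<open>W\<close> is on side \<open>- s\<close>, which joins a left and
  a right side.\<close>

lemma crossing:
  assumes e: "e \<in> W" and s: "s \<noteq> 0" and y: "rec (i + s) (out_dart (i + s) e)" "out_dart (i + s) e \<notin> bd W"
  obtains z where "z \<in> cyc (i + s) (out_dart (i + s) e)" "z \<in> A" "(pside s e, z) \<in> RW"
  | e' where "e' \<in> W" "(pside s e, pside (- s) e') \<in> RW"
proof -
  let ?y = "out_dart (i + s) e" and ?n = "nxt (i + s)"
  have eX: "e \<in> X" using famD[OF W e] by auto
  have yX: "?y \<in> X" "c ?y = Some (i + s)" using rec_in[OF y(1)] by auto
  have start: "(pside s e, ?y) \<in> RW" using leave_side[OF e s y(2)] .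
  obtain k where k: "k > 0" "(?n ^^ k) ?y = ?y" using y(1) by (auto simp: recurrent_def)
  have kX: "(?n ^^ m) ?y \<in> X" "c ((?n ^^ m) ?y) = Some (i + s)" for m
    using nxt_funpow[OF yX] by auto
  have "?n ((?n ^^ (k - 1)) ?y) = ?y" using k by (cases k) auto
  then have "origin M e = origin M (opp M ((?n ^^ (k - 1)) ?y))"
    using nxt(3)[OF kX(1)[of "k - 1"], of "i + s"] out(1)[OF eX, of "i + s"] by simp
  then have "(?n ^^ (k - 1)) ?y \<in> A \<or> (\<exists>e\<in>W. origin M e = origin M (opp M ((?n ^^ (k - 1)) ?y)))"
    using e by blast
  from yX y(2) this show thesis
  proof (cases rule: first_event)
    case (1 n)
    have "(?n ^^ n) ?y \<in> cyc (i + s) ?y" by (auto simp: cyc_def)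
    moreover have "(pside s e, (?n ^^ n) ?y) \<in> RW" using start 1(1) by (rule conn_trans)
    ultimately show ?thesis using that(1) 1(2) by blast
  next
    case (2 n e')
    have "(pside (- s) e', opp M ((?n ^^ n) ?y)) \<in> RW"
      using 2 kX[of n] by (intro enter_side[OF 2(1) s]) auto
    moreover have "(pside s e, opp M ((?n ^^ n) ?y)) \<in> RW" using start 2(3) by (rule conn_trans)
    ultimately have "(pside s e, pside (- s) e') \<in> RW" by (rule conn_join[rotated])
    then show ?thesis using that(2) 2(1) by blast
  qed
qed

end

section \<open>Crossing and reversed cycles of neighbouring colors\<close>

lemma cyc_pside:
  assumes W: "fam i W" and sep: "sep A (bd W)" and e: "rec i e" "cyc i e \<subseteq> W" "e' \<in> cyc i e"
  shows "(pside s e, pside s e') \<in> R A (bd W)"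
proof -
  obtain n where n: "e' = (nxt i ^^ n) e" using e(3) by (auto simp: cyc_def)
  have "(pside s e, pside s ((nxt i ^^ n) e)) \<in> R A (bd W)" for n
  proof (induction n)
    case (Suc n)
    have "(nxt i ^^ n) e \<in> W" using e(2) by (auto simp: cyc_def)
    then have "(pside s ((nxt i ^^ n) e), pside s (nxt i ((nxt i ^^ n) e))) \<in> R A (bd W)"
      by (rule primal_same_side[OF fam_cut(2)[OF W] sep])
    with Suc have "(pside s e, pside s (nxt i ((nxt i ^^ n) e))) \<in> R A (bd W)" by (rule conn_trans)
    then show ?case by simp
  qed simp
  then show ?thesis unfolding n .
qed

text \<open>Suppose no recurrent edge of color \<open>i + s\<close> leaves the cycle. Then a
  recurrent one at a vertex of the cycle is the reverse of the incoming cycle edge and leads to the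
  preceding vertex, where the next one is recurrent again. (T2) provides a first one, so all cycle
  edges are reversed in color \<open>i + s\<close>.\<close>

lemma cross_or_reverse:
  assumes e: "rec i e" and s: "s \<noteq> 0"
  obtains e1 where "e1 \<in> cyc i e" "rec (i + s) (out_dart (i + s) e1)" "out_dart (i + s) e1 \<notin> bd (cyc i e)"
  | "\<And>e1. e1 \<in> cyc i e \<Longrightarrow> out_dart (i + s) e1 \<in> bd (cyc i e)"
proof (cases "\<exists>e1\<in>cyc i e. rec (i + s) (out_dart (i + s) e1) \<and> out_dart (i + s) e1 \<notin> bd (cyc i e)")
  case False
  let ?C = "cyc i e"
  define P where "P e1 \<longleftrightarrow> rec (i + s) (out_dart (i + s) e1)" for e1
  have W: "fam i ?C" using e by (rule fam_cyc)
  have no: "out_dart (i + s) e1 \<in> bd ?C" if "e1 \<in> ?C" "P e1" for e1 using False that by (auto simp: P_def)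
  have prev: "P d" if d: "d \<in> ?C" "P (nxt i d)" for d
  proof -
    have dX: "d \<in> X" using famD[OF W d(1)] by auto
    have nX: "nxt i d \<in> ?C" "nxt i d \<in> X" using famD[OF W] d(1) by blast+
    let ?p = "out_dart (i + s) (nxt i d)"
    have p: "?p \<in> bd ?C" using no nX d by blast
    then obtain d2 where d2: "d2 \<in> ?C" "?p = opp M d2" "origin M (nxt i d2) = origin M ?p"
      using out_opp_prev[OF W p out(2)[OF nX(2)]] s by auto
    have "origin M (opp M d2) = origin M (nxt i d)" using d2 out(1)[OF nX(2)] by metis
    then have "nxt i d2 = nxt i d" by (rule fam_prev[OF W nX(1) d2(1)])
    then have "d2 = d" using cut.inj_nx[OF fam_cut(1)[OF W]] d2(1) d(1) by blast
    then have "nxt (i + s) ?p = out_dart (i + s) d" using d2(2) by (simp add: step_def)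
    then show ?thesis using rec_funpow[OF d(2)[unfolded P_def], of 1] by (simp add: P_def)
  qed
  obtain n where n: "P ((nxt i ^^ n) e)" using meet e s unfolding cycles_meet_def P_def by blast
  have all: "P e1" if e1: "e1 \<in> ?C" for e1
  proof -
    have "(nxt i ^^ n) e \<in> cyc i e1" using cyc_eq[OF e e1] by (auto simp: cyc_def)
    then obtain k where k: "P ((nxt i ^^ k) e1)" using n by (auto simp: cyc_def)
    have in_C: "(nxt i ^^ m) e1 \<in> ?C" for m using cyc_eq[OF e e1] by (auto simp: cyc_def)
    have "P ((nxt i ^^ m) e1) \<Longrightarrow> P e1" for m
    proof (induction m)
      case (Suc m)
      then show ?case using prev[OF in_C[of m]] by simp
    qed simp
    then show ?thesis using k by blast
  qed
  show thesis using that(2) no all by blast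
qed (use that in blast)

text \<open>Both darts would be the reverse of the single cycle edge that enters at
  \<open>e\<close>, which has only one color.\<close>

lemma not_both_reverse:
  assumes W: "fam i W" and e: "e \<in> W" and s: "s \<noteq> 0" and p: "out_dart (i + s) e \<in> bd W"
  shows "out_dart (i + - s) e \<notin> bd W"
proof
  assume q: "out_dart (i + - s) e \<in> bd W"
  have eX: "e \<in> X" using famD[OF W e] by auto
  have prev: "\<exists>d\<in>W. out_dart j e = opp M d \<and> nxt i d = e" if j: "out_dart j e \<in> bd W" "j \<noteq> i" for j
  proof -
    obtain d where d: "d \<in> W" "out_dart j e = opp M d"
      using out_opp_prev[OF W j(1) out(2)[OF eX] j(2)] by auto
    have "origin M (opp M d) = origin M e" using d out(1)[OF eX] by metis
    then have "nxt i d = e" using fam_prev[OF W e d(1)] by simp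
    then show ?thesis using d by blast
  qed
  obtain d1 where d1: "d1 \<in> W" "out_dart (i + s) e = opp M d1" "nxt i d1 = e" using prev[OF p] s by auto
  obtain d2 where d2: "d2 \<in> W" "out_dart (i + - s) e = opp M d2" "nxt i d2 = e" using prev[OF q] s by auto
  have "d1 = d2" using cut.inj_nx[OF fam_cut(1)[OF W] d1(1) d2(1)] d1 d2 by simp
  then have "i + s = i + - s" using d1 d2 out(2)[OF eX, of "i + s"] out(2)[OF eX, of "i + - s"] by simp
  with s show False by (cases rule: sign_cases) auto
qed

text \<open>The cycle can be reversed in only one of the two other colors, so a cycle of the
  remaining color crosses it.\<close>

lemma some_cross:
  assumes e: "rec i e"
  obtains s e1 where "s \<noteq> 0" "e1 \<in> cyc i e" "rec (i + s) (out_dart (i + s) e1)"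
    "out_dart (i + s) e1 \<notin> bd (cyc i e)"
proof (rule ccontr)
  assume no: "\<not> thesis"
  note intro = that
  have "out_dart (i + s) e \<in> bd (cyc i e)" if "s \<noteq> 0" for s
    using e that
  proof (cases rule: cross_or_reverse)
    case (1 e1)
    then show ?thesis using intro[OF that 1] no by blast
  qed simp
  from this[of 1] this[of "- 1"] show False
    using not_both_reverse[OF fam_cyc[OF e] cyc_self, of 1] by simp
qed

end

section \<open>Dual cycles do not separate\<close>

context torus_wood
begin

lemma dual_cut: "dual.fam i W \<Longrightarrow> cut X f (opp M) (dual.nxt i) W"
  using dual.fam_cut(1) by simp

text \<open>By \<open>edge_cases\<close>, a dart of dual color \<open>i\<close> has neither color
  \<open>i\<close> nor \<open>i + 1\<close>, and its reverse has neither color \<open>i\<close> nor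
  \<open>i - 1\<close>. So each of the other two colors crosses the dual cycle in one direction
  only.\<close>

lemma dual_fam_color:
  assumes W: "dual.fam i W" and z: "z \<in> bd W"
  shows "c z \<noteq> Some i" and "s \<noteq> 0 \<Longrightarrow> c z = Some (i + s) \<Longrightarrow> \<exists>d\<in>W. z = dside s d"
proof -
  have WX: "d \<in> X \<and> c' d = Some i" if "d \<in> W" for d
    using dual.famD(1,2)[OF W that] by simp
  consider "z \<in> W" | d where "d \<in> W" "z = opp M d" using z by auto
  note z_cases = this
  show "c z \<noteq> Some i"
    using z_cases
  proof cases
    case 1
    then have "z \<in> X" "c' z = Some i" using WX by auto
    then show ?thesis by (cases rule: edge_cases) auto
  next
    case (2 d)
    then have "d \<in> X" "c' d = Some i" using WX by auto
    then show ?thesis unfolding 2(2) by (cases rule: edge_cases) auto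
  qed
  assume s: "s \<noteq> 0" "c z = Some (i + s)"
  show "\<exists>d\<in>W. z = dside s d"
    using z_cases
  proof cases
    case 1
    then have "z \<in> X" "c' z = Some i" using WX by auto
    then have "c z \<noteq> Some (i + 1)" by (cases rule: edge_cases) auto
    then have "s \<noteq> 1" using s by auto
    then show ?thesis using 1 by (auto simp: dside_def)
  next
    case (2 d)
    then have "d \<in> X" "c' d = Some i" using WX by auto
    then have "c z \<noteq> Some (i + - 1)" unfolding 2(2) by (cases rule: edge_cases) auto
    then have "s \<noteq> - 1" using s by auto
    with s(1) have "s = 1" by (cases rule: sign_cases) auto
    then show ?thesis using 2 by (auto simp: dside_def)
  qed
qed

lemma dual_cyc_side:
  assumes x: "dual.rec i x" and W: "cut X f (opp M) nx W" "dual.cyc i x \<subseteq> W"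
    "\<And>d. d \<in> dual.cyc i x \<Longrightarrow> nx d = dual.nxt i d" and d: "d \<in> dual.cyc i x"
  shows "(dside s x, dside s d) \<in> R (bd W) B"
proof -
  obtain n where n: "d = (dual.nxt i ^^ n) x" using d by (auto simp: dual.cyc_def)
  have "(dside s x, dside s ((dual.nxt i ^^ n) x)) \<in> R (bd W) B" for n
  proof (induction n)
    case (Suc n)
    let ?y = "(dual.nxt i ^^ n) x"
    have y: "?y \<in> dual.cyc i x" by (auto simp: dual.cyc_def)
    then have "?y \<in> W" using W(2) by blast
    from dual_same_side[OF W(1) this] have "(dside s ?y, dside s (dual.nxt i ?y)) \<in> R (bd W) B"
      by (simp add: W(3)[OF y])
    with Suc have "(dside s x, dside s (dual.nxt i ?y)) \<in> R (bd W) B" by (rule conn_trans)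
    then show ?case by simp
  qed simp
  then show ?thesis unfolding n .
qed

text \<open>Each side of a cut cycle is connected, so one link between the sides joins the two darts
  of every crossed edge. The cut may contain further cycles, even of another color, hence its own
  successor function \<open>nx\<close>.\<close>

lemma dual_joined:
  assumes x: "dual.rec i x" and W: "cut X f (opp M) nx W" "dual.cyc i x \<subseteq> W"
    "\<And>d. d \<in> dual.cyc i x \<Longrightarrow> nx d = dual.nxt i d"
    and s: "s \<noteq> 0" and d: "d1 \<in> dual.cyc i x" "d2 \<in> dual.cyc i x" "(dside s d1, dside (- s) d2) \<in> R (bd W) B"
    and z: "z \<in> bd (dual.cyc i x)"
  shows "(z, opp M z) \<in> R (bd W) B"
proof -
  have side: "(dside s x, dside s d) \<in> R (bd W) B" if "d \<in> dual.cyc i x" for s d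
    using x W that by (rule dual_cyc_side)
  have "(dside s d, dside (- s) d) \<in> R (bd W) B" if "d \<in> dual.cyc i x" for d
  proof -
    have "(dside s d, dside s d1) \<in> R (bd W) B"
      using side[OF that] side[OF d(1)] by (rule conn_fork)
    also note d(3)
    also have "(dside (- s) d2, dside (- s) d) \<in> R (bd W) B"
      using side[OF d(2)] side[OF that] by (rule conn_fork)
    finally show ?thesis .
  qed
  then have sd: "(dside s d, dside (- s) d) \<in> R (bd W) B" if "d \<in> dual.cyc i x" for d
    using that .
  have "(d, opp M d) \<in> R (bd W) B" if "d \<in> dual.cyc i x" for d
    using s by (cases rule: sign_cases) (use sd[OF that] in \<open>auto simp: dside_def dest: conn_sym\<close>)
  then show ?thesis using z conn_sym by fastforce
qed

lemma primal_joined: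
  assumes W: "fam i W" and sep: "sep A (bd W)" and e: "rec i e" "cyc i e \<subseteq> W"
    and s: "s \<noteq> 0" and e12: "e1 \<in> cyc i e" "e2 \<in> cyc i e" "(pside s e1, pside (- s) e2) \<in> R A (bd W)"
    and z: "z \<in> bd (cyc i e)"
  shows "(z, opp M z) \<in> R A (bd W)"
proof -
  have side: "(pside s e, pside s d) \<in> R A (bd W)" if "d \<in> cyc i e" for s d
    using W sep e that by (rule cyc_pside)
  have "(pside s d, pside (- s) d) \<in> R A (bd W)" if "d \<in> cyc i e" for d
  proof -
    have "(pside s d, pside s e1) \<in> R A (bd W)"
      using side[OF that] side[OF e12(1)] by (rule conn_fork)
    also note e12(3)
    also have "(pside (- s) e2, pside (- s) d) \<in> R A (bd W)"
      using side[OF e12(2)] side[OF that] by (rule conn_fork)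
    finally show ?thesis .
  qed
  then have sd: "(pside s d, pside (- s) d) \<in> R A (bd W)" if "d \<in> cyc i e" for d
    using that .
  have "(d, opp M d) \<in> R A (bd W)" if "d \<in> cyc i e" for d
    using s by (cases rule: sign_cases) (use sd[OF that] in \<open>auto simp: pside_def dest: conn_sym\<close>)
  then show ?thesis using z conn_sym by fastforce
qed

lemma sep_bd:
  assumes "dual.fam i W" "fam j V" "bd W \<inter> bd V = {}"
  shows "sep (bd W) (bd V)"
  using assms dual.famD(1)[OF assms(1)] famD(1)[OF assms(2)] unfolding sep_def by auto

lemma same_color_disjoint:
  assumes W: "dual.fam i W" and V: "fam i V"
  shows "bd W \<inter> bd V = {}"
proof -
  have "z \<notin> bd W" if "z \<in> V" for z
    using dual_fam_color(1)[OF W, of z] famD(2)[OF V that] by blast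
  moreover have "opp M z \<in> bd W" if "z \<in> bd W" for z using that by auto
  ultimately show ?thesis by fastforce
qed

text \<open>After using \<open>z\<close> the cycle uses an edge of \<open>A\<close> again, at the
  latest \<open>z\<close> itself, and the stretch in between is not cut.\<close>

lemma dual_crossing:
  assumes sep: "sep A {}" and z: "rec j z" "z \<in> A"
  obtains z' where "z' \<in> cyc j z" "z' \<in> A" "(opp M z, z') \<in> R A {}"
proof -
  let ?y = "nxt j z"
  have zX: "z \<in> X" "c z = Some j" using rec_in[OF z(1)] by auto
  have yX: "?y \<in> X" "c ?y = Some j" using nxt[OF zX(1)] by auto
  obtain k where k: "k > 0" "(nxt j ^^ k) z = z" using z(1) by (auto simp: recurrent_def)
  have "(nxt j ^^ (k - 1)) ?y = (nxt j ^^ Suc (k - 1)) z" by (simp only: funpow_Suc_right comp_apply)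
  then have N: "(nxt j ^^ (k - 1)) ?y \<in> A" using k z(2) by simp
  have sep': "sep A (bd {})" using sep by simp
  have opp_y: "(opp M z, ?y) \<in> R A {}"
    using vertex_connected[OF fam_empty sep', where x = "opp M z" and y = ?y] zX nxt(3)[OF zX(1)] by simp
  have "?y \<notin> bd {}" by simp
  from fam_empty sep' yX this disjI1[OF N] show thesis
  proof (cases rule: first_event)
    case (1 n)
    have "(nxt j ^^ n) ?y = (nxt j ^^ Suc n) z" by (simp only: funpow_Suc_right comp_apply)
    then have "(nxt j ^^ n) ?y \<in> cyc j z" unfolding cyc_def by blast
    moreover have "(opp M z, (nxt j ^^ n) ?y) \<in> R A {}" using conn_trans[OF opp_y] 1(1) by simp
    ultimately show ?thesis using that 1(2) by blast
  qed simp
qed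

lemma connected_recut:
  assumes "\<And>x y. x \<in> X \<Longrightarrow> y \<in> X \<Longrightarrow> (x, y) \<in> R A' B'" "gen A' B' \<subseteq> conn S"
  shows "card (classes X S) \<le> 1"
proof (rule card_classes_connected)
  show "(x, y) \<in> conn S" if "x \<in> X" "y \<in> X" for x y
    using assms(1)[OF that] conn_least[OF assms(2)] by blast
qed

lemma gen_refl: "gen A B \<subseteq> R A B"
  by (auto intro: conn_base)

lemma dual_cut_card:
  assumes "cut X f (opp M) nx W" "W \<noteq> {}"
  shows "card (classes X (fgraph X f)) + 2 \<le> card (classes X (fgraph X (phi (bd W)))) + card W"
    "card (bd W) = 2 * card W"
proof -
  interpret cut X f "opp M" nx W by fact
  show "card (classes X (fgraph X f)) + 2 \<le> card (classes X (fgraph X (phi (bd W)))) + card W"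
    using card_cut[OF assms(2)] by (simp add: phi_def)
  show "card (bd W) = 2 * card W" by (rule card_cutset)
qed

lemma dual_primal_cut:
  assumes "cut X f (opp M) nx W" "W \<noteq> {}" "fam j V" "V \<noteq> {}" "sep (bd W) (bd V)"
  shows "2 \<le> card (classes X (gen (bd W) (bd V)))"
  using components_after_cut[OF assms(5) dual_cut_card(2)[OF assms(1,2)]
      primal_cut_card(2)[OF fam_cut(2)[OF assms(3)] assms(4,5)], of 1 1]
    primal_cut_card(1)[OF fam_cut(2)[OF assms(3)] assms(4,5)] dual_cut_card(1)[OF assms(1,2)]
  by simp

text \<open>
  If the dual cycle separated, there would be primal cycles of color \<open>i\<close> on both sides, as edges of
  color \<open>i\<close> do not cross it. By (T2), each of them is crossed by a cycle of another color, which also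
  stays on its side, so cutting along both yields no further components. But three
  disjoint cycles cut the torus into at least three components.
\<close>

lemma dual_connected:
  assumes x: "dual.rec i x" and u: "u \<in> X" "v \<in> X"
  shows "(u, v) \<in> R (bd (dual.cyc i x)) {}"
proof -
  let ?D = "dual.cyc i x"
  let ?A = "bd ?D"
  have D: "dual.fam i ?D" using x by (rule dual.fam_cyc)
  have cutD: "cut X f (opp M) (dual.nxt i) ?D" using D by (rule dual_cut)
  have xX: "x \<in> X" using dual.rec_in(1)[OF x] by simp
  have sep: "sep ?A {}" using sep_bd[OF D fam_empty] by simp
  have sep0: "sep {} {}" by (simp add: sep_def)
  have joined: "(z, opp M z) \<in> R ?A B"
    if "s \<noteq> 0" "d1 \<in> ?D" "d2 \<in> ?D" "(dside s d1, dside (- s) d2) \<in> R ?A B" "z \<in> ?A" for s d1 d2 z B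
    using x cutD subset_refl HOL.refl that by (rule dual_joined)
  have "gen {} {} \<subseteq> R ?A {}" if "(x, opp M x) \<in> R ?A {}"
  proof (rule R_recut[OF sep sep0])
    fix z assume z: "z \<in> X"
    have "(dside (- 1) x, dside (- (- 1)) x) \<in> R ?A {}" using that by (simp add: dside_def)
    then have "z \<in> ?A \<Longrightarrow> (z, opp M z) \<in> R ?A {}" by (intro joined[of "- 1" x x]) simp_all
    then show "(z, opp M z) \<in> R ?A {}" using R_opp[OF sep z] by blast
  qed (simp_all add: gen_refl)
  moreover have "(x, opp M x) \<in> R ?A {}"
  proof (rule ccontr)
    assume nc: "(x, opp M x) \<notin> R ?A {}"
    have ncs: "(dside s d1, dside (- s) d2) \<notin> R ?A {}" if "s \<noteq> 0" "d1 \<in> ?D" "d2 \<in> ?D" for s d1 d2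
      using joined[OF that, of "{}" x] nc by auto
    have color_A: "z \<notin> ?A" if "c z = Some i" for z
      using dual_fam_color(1)[OF D, of z] that by blast
    have sepe: "sep ?A (bd {})" using sep by simp
    \<comment> \<open>Edges of color \<open>i\<close> do not cross the dual cycle, so the path of
      color \<open>i\<close> from \<open>z\<close> stays in the component of \<open>z\<close> until
      it runs around a cycle.\<close>
    have ray: "\<exists>e. rec i e \<and> (\<forall>e'\<in>cyc i e. (z, e') \<in> R ?A {})" if z: "z \<in> X" for z
    proof -
      let ?y = "out_dart i z"
      have y: "?y \<in> X" "c ?y = Some i" "origin M ?y = origin M z" using out[OF z] by auto
      have zy: "(z, ?y) \<in> R ?A {}"
        using vertex_connected[OF fam_empty sepe z y(3)] by simp
      have all: "(z, (nxt i ^^ n) ?y) \<in> R ?A {}" for n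
      proof -
        have "(?y, (nxt i ^^ n) ?y) \<in> R ?A (bd {})"
          using trace[OF fam_empty sepe y(1,2), where n = n] color_A nxt_funpow(2)[OF y(1,2)] by simp
        then show ?thesis using conn_trans[OF zy] by simp
      qed
      obtain n where n: "rec i ((nxt i ^^ n) ?y)" using eventually_rec[OF y(1,2)] by blast
      have "(z, e') \<in> R ?A {}" if e': "e' \<in> cyc i ((nxt i ^^ n) ?y)" for e'
      proof -
        obtain m where "e' = (nxt i ^^ m) ((nxt i ^^ n) ?y)" using e' by (auto simp: cyc_def)
        then have "e' = (nxt i ^^ (m + n)) ?y" by (simp add: funpow_add)
        then show ?thesis using all by simp
      qed
      then show ?thesis using n by blast
    qed
    have sX: "dside s x \<in> X" for s using xX by (simp add: dside_def)
    obtain e1 where e1: "rec i e1" "\<forall>e'\<in>cyc i e1. (dside 1 x, e') \<in> R ?A {}" using ray[OF sX] by blast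
    obtain e2 where e2: "rec i e2" "\<forall>e'\<in>cyc i e2. (dside (- 1) x, e') \<in> R ?A {}" using ray[OF sX] by blast
    let ?C1 = "cyc i e1" and ?C2 = "cyc i e2"
    have far: "(u, v) \<notin> R ?A {}" if "u \<in> ?C1" "v \<in> ?C2" for u v
    proof
      assume uv: "(u, v) \<in> R ?A {}"
      have "(dside 1 x, v) \<in> R ?A {}" using bspec[OF e1(2) that(1)] uv by (rule conn_trans)
      then have "(dside 1 x, dside (- 1) x) \<in> R ?A {}" using bspec[OF e2(2) that(2)] by (rule conn_join)
      then show False using ncs[of 1 x x] by simp
    qed
    have C: "fam i ?C1" "fam i ?C2" using e1 e2 fam_cyc by auto
    have CX: "u \<in> X" if "u \<in> ?C1 \<union> ?C2" for u using that C famD(1) by blast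
    have far_origin: "origin M u \<noteq> origin M v" if uv: "u \<in> ?C1" "v \<in> ?C2" for u v
    proof
      assume "origin M u = origin M v"
      then have "(u, v) \<in> R ?A {}" using vertex_connected[OF fam_empty sepe, where x = u and y = v] CX uv by simp
      then show False using far[OF uv] by simp
    qed
    let ?W = "?C1 \<union> ?C2"
    let ?B = "bd ?W"
    have W: "fam i ?W" using C by (rule fam_Un)
    have sepW: "sep ?A ?B" using sep_bd[OF D W same_color_disjoint[OF D W]] .
    have finer: "R ?A ?B \<subseteq> R ?A {}"
      by (rule conn_least[OF R_recut[OF sep sepW]]) (use R_opp[OF sep] gen_refl in auto)
    \<comment> \<open>Here \<open>C'\<close> is the other primal cycle. Take the crossing cycle from
      \<open>some_cross\<close>. If it crossed the dual cycle, it would have to do so again from the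
      same side and thereby join the sides. It cannot reach \<open>C'\<close>, which is in another
      component. So it returns to the cycle of \<open>e\<close> and joins the two sides of that
      cycle.\<close>
    have cross: "(z, opp M z) \<in> R ?A ?B"
      if e: "rec i e" "?W = cyc i e \<union> C'" "fam i C'"
        and far: "\<And>u v. u \<in> cyc i e \<Longrightarrow> v \<in> C' \<Longrightarrow> (u, v) \<notin> R ?A {}"
        and far_origin: "\<And>u v. u \<in> cyc i e \<Longrightarrow> v \<in> C' \<Longrightarrow> origin M u \<noteq> origin M v"
        and z: "z \<in> bd (cyc i e)" for e C' z
    proof -
      have sub: "cyc i e \<subseteq> ?W" using e(2) by blast
      obtain s e1 where s: "s \<noteq> 0" and e1: "e1 \<in> cyc i e" "rec (i + s) (out_dart (i + s) e1)"
        "out_dart (i + s) e1 \<notin> bd (cyc i e)" using e(1) by (rule some_cross)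
      have e1W: "e1 \<in> ?W" using e1(1) sub by blast
      have "out_dart (i + s) e1 \<notin> bd C'"
      proof
        assume "out_dart (i + s) e1 \<in> bd C'"
        then obtain v where "v \<in> C'" "origin M v = origin M (out_dart (i + s) e1)"
          using bd_origin[OF e(3)] by blast
        then show False using far_origin[OF e1(1)] out(1)[OF CX[OF e1W]] by metis
      qed
      then have "out_dart (i + s) e1 \<notin> ?B" using e1(3) unfolding e(2) by blast
      with W sepW e1W s e1(2) show ?thesis
      proof (cases rule: crossing)
        case (1 z)
        have rz: "rec (i + s) z" using cyc_rec[OF e1(2) 1(1)] .
        obtain d where d: "d \<in> ?D" "z = dside s d"
          using dual_fam_color(2)[OF D 1(2) s] rec_in(2)[OF rz] by blast
        obtain z' where z': "z' \<in> cyc (i + s) z" "z' \<in> ?A" "(opp M z, z') \<in> R ?A {}"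
          using sep rz 1(2) by (rule dual_crossing)
        obtain d' where d': "d' \<in> ?D" "z' = dside s d'"
          using dual_fam_color(2)[OF D z'(2) s] rec_in(2)[OF cyc_rec[OF rz z'(1)]] by blast
        have "(dside (- s) d, dside (- (- s)) d') \<in> R ?A {}"
          using z'(3) d(2) d'(2) dside_opp[OF s, of d] by simp
        then show ?thesis using ncs[OF sign_neg[OF s] d(1) d'(1)] by simp
      next
        case (2 e2)
        have ps: "(u, pside t u) \<in> R ?A {}" if "u \<in> ?W" for u t
          using R_opp[OF sep CX[OF that]] color_A famD(2)[OF W that] by (simp add: pside_def)
        have "(e1, e2) \<in> R ?A {}"
        proof -
          have "(e1, pside s e1) \<in> R ?A {}" using ps[OF e1W] .
          also have "(pside s e1, pside (- s) e2) \<in> R ?A {}" using 2(2) finer by blast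
          also have "(pside (- s) e2, e2) \<in> R ?A {}" using conn_sym[OF ps[OF 2(1)]] .
          finally show ?thesis .
        qed
        then have "e2 \<notin> C'" using far[OF e1(1)] by blast
        then have "e2 \<in> cyc i e" using 2(1) e(2) by blast
        from W sepW e(1) sub s e1(1) this 2(2) z show ?thesis by (rule primal_joined)
      qed
    qed
    have "(z, opp M z) \<in> R ?A ?B" if z: "z \<in> ?B" for z
    proof -
      consider "z \<in> bd ?C1" | "z \<in> bd ?C2" using z by blast
      then show ?thesis
      proof cases
        case 1
        show ?thesis using e1(1) HOL.refl C(2) far far_origin 1 by (rule cross)
      next
        case 2
        have "?W = ?C2 \<union> ?C1" by blast
        then show ?thesis
          using e2(1) C(1) far far_origin 2 by (intro cross[of e2 ?C1]) (metis conn_sym)+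
      qed
    qed
    then have "(z, opp M z) \<in> R ?A ?B" if "z \<in> X" "z \<notin> ?A" "z \<notin> {}" for z
      using R_opp[OF sepW that(1,2)] by blast
    then have "gen ?A {} \<subseteq> R ?A ?B"
      by (intro R_recut[OF sepW sep _ gen_refl]; blast)
    then have le: "card (classes X (gen ?A ?B)) \<le> card (classes X (gen ?A {}))"
      by (rule card_classes_antimono[OF finX])
    have "3 \<le> card (classes X (gen ?A ?B))"
    proof -
      have ne: "?D \<noteq> {}" "?C1 \<noteq> {}" "?C2 \<noteq> {}" "?W \<noteq> {}" using cyc_self dual.cyc_self by blast+
      have cut12: "cut X (inv (rot M)) (opp M) (nxt i) ?C1" "cut X (inv (rot M)) (opp M) (nxt i) ?C2"
        using fam_cut(2) C by blast+
      have "orbit (inv (rot M)) u \<noteq> orbit (inv (rot M)) v" if "u \<in> ?C1" "v \<in> ?C2" for u v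
        using far_origin[OF that] by (simp add: orbit_inv_eq[OF perm_rot] origin_def)
      from cut_Un(2)[OF cut12 this ne(2,3)]
      have "card (classes X (fgraph X (inv (rot M)))) + 4
          \<le> card (classes X (fgraph X (inv (rot M) \<circ> swap_on (opp M) ?B))) + card ?W" .
      moreover have "inv (rot M) \<circ> swap_on (opp M) ?B = inv (sigma ?B)"
        by (rule inv_sigma[symmetric]) auto
      ultimately have 4: "card (classes X (fgraph X (rot M))) + 2 * 2
          \<le> card (classes X (fgraph X (sigma ?B))) + card ?W"
        by (simp add: classes_inv[OF finX rot_perm] classes_inv[OF finX sigma_perm[OF sepW]])
      have 2: "card ?B = 2 * card ?W" using primal_cut_card(2)[OF fam_cut(2)[OF W] ne(4) sepW] .
      show ?thesis
        using components_after_cut[OF sepW dual_cut_card(2)[OF cutD ne(1)] 2 4, of 1]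
          dual_cut_card(1)[OF cutD ne(1)] by simp
    qed
    \<comment> \<open>A single additional link between the sides of the dual cycle reconnects the
      whole torus, and one link merges at most two components.\<close>
    moreover have "card (classes X (gen ?A {})) \<le> 2"
    proof -
      let ?S = "insert (x, opp M x) (gen ?A {})"
      have RS: "R ?A {} \<subseteq> conn ?S" by (rule conn_mono) blast
      have xS: "(x, opp M x) \<in> conn ?S" by (rule conn_base) simp
      have side: "(dside s x, dside s d) \<in> conn ?S" if "d \<in> ?D" for s d
        using dual_cyc_side[OF x cutD subset_refl HOL.refl that, of s "{}"] RS by blast
      have dS: "(d, opp M d) \<in> conn ?S" if "d \<in> ?D" for d
      proof -
        have "(d, x) \<in> conn ?S" using conn_sym[OF side[OF that, of "- 1"]] by (simp add: dside_def)
        also note xS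
        also have "(opp M x, opp M d) \<in> conn ?S" using side[OF that, of 1] by (simp add: dside_def)
        finally show ?thesis .
      qed
      have "(z, opp M z) \<in> conn ?S" if "z \<in> X" for z
      proof (cases "z \<in> ?A")
        case True
        then show ?thesis using dS conn_sym[OF dS] by auto
      next
        case False
        then show ?thesis using R_opp[OF sep that] RS by blast
      qed
      then have "gen {} {} \<subseteq> conn ?S"
        using RS gen_refl by (intro R_recut[OF sep sep0]) blast+
      then have "card (classes X ?S) \<le> 1" using gen_connected by (intro connected_recut)
      moreover have "opp M x \<in> X" using xX by simp
      ultimately show ?thesis using card_classes_insert_le[OF finX xX, of "opp M x" "gen ?A {}"] by simp
    qed
    ultimately show False using le by simp
  qed
  ultimately have "gen {} {} \<subseteq> R ?A {}" by blast
  then show ?thesis using conn_least gen_connected[OF u] by blast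
qed

end

section \<open>Intersections of dual cycles\<close>

context torus_wood
begin

text \<open>If the dual cycles were disjoint, cutting along both would give two components. But the
  cycle of color \<open>i + s\<close> through the crossing joins the two sides of the dual cycle of
  color \<open>i\<close>, so only the cut along the other one counts, and that alone does not
  separate.\<close>

lemma crossing_meets:
  assumes e: "rec i e" "e1 \<in> cyc i e" and s: "s \<noteq> 0"
    and y: "rec (i + s) (out_dart (i + s) e1)" "out_dart (i + s) e1 \<notin> bd (cyc i e)"
    and x: "dual.rec i x" and x': "dual.rec (i + s) x'"
  shows "\<exists>d\<in>dual.cyc i x. \<exists>d'\<in>dual.cyc (i + s) x'. origin (dual_map M) d = origin (dual_map M) d'"
proof (rule ccontr)
  assume no: "\<not> ?thesis"
  let ?C = "cyc i e" and ?D = "dual.cyc i x" and ?D' = "dual.cyc (i + s) x'"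
  let ?A = "bd ?D" and ?A' = "bd ?D'" and ?U = "?D \<union> ?D'"
  have C: "fam i ?C" using e(1) by (rule fam_cyc)
  have D: "dual.fam i ?D" "dual.fam (i + s) ?D'" using x x' dual.fam_cyc by blast+
  note cutD = dual_cut[OF D(1)] dual_cut[OF D(2)]
  have ne: "?C \<noteq> {}" "?D \<noteq> {}" "?D' \<noteq> {}" using cyc_self dual.cyc_self by blast+
  have sep: "sep ?A (bd ?C)" using sep_bd[OF D(1) C same_color_disjoint[OF D(1) C]] .
  have sepA: "sep ?A {}" "sep ?A' {}" using sep_bd[OF D(1) fam_empty] sep_bd[OF D(2) fam_empty] by simp_all
  \<comment> \<open>If the crossing cycle avoided the dual cycle of color \<open>i\<close>, it would
    join the two sides of \<open>?C\<close>. Cutting along both would then leave one component, as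
    cutting along the dual cycle alone does.\<close>
  from C sep e(2) s y obtain z where z: "z \<in> cyc (i + s) (out_dart (i + s) e1)" "z \<in> ?A"
  proof (cases rule: crossing)
    case (2 e2)
    have join: "(z, opp M z) \<in> R ?A (bd ?C)" if "z \<in> bd ?C" for z
      using C sep e(1) subset_refl s e(2) 2 that by (rule primal_joined)
    have "(z, opp M z) \<in> R ?A (bd ?C)" if "z \<in> X" "z \<notin> ?A" "z \<notin> {}" for z
      using join R_opp[OF sep that(1,2)] by blast
    then have "gen ?A {} \<subseteq> R ?A (bd ?C)"
      by (intro R_recut[OF sep sepA(1) _ gen_refl]; blast)
    then have "card (classes X (gen ?A (bd ?C))) \<le> 1"
      using dual_connected[OF x] by (intro connected_recut)
    then show ?thesis using dual_primal_cut[OF cutD(1) ne(2) C ne(1) sep] by simp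
  qed
  have disj: "orbit f u \<noteq> orbit f v" if "u \<in> ?D" "v \<in> ?D'" for u v
    using no that by (auto simp: origin_def)
  let ?nx = "\<lambda>d. if d \<in> ?D then dual.nxt i d else dual.nxt (i + s) d"
  have cutU: "cut X f (opp M) ?nx ?U" using cut_Un(1)[OF cutD disj] .
  have bdU: "bd ?U = ?A \<union> ?A'" by blast
  have sepU: "sep (bd ?U) {}" using sepA unfolding sep_def bdU by auto
  have rz: "rec (i + s) z" using cyc_rec[OF y(1) z(1)] .
  have zU: "z \<in> bd ?U" using z(2) by blast
  obtain z' where z': "z' \<in> cyc (i + s) z" "z' \<in> bd ?U" "(opp M z, z') \<in> R (bd ?U) {}"
    using sepU rz zU by (rule dual_crossing)
  have cz: "c z = Some (i + s)" "c z' = Some (i + s)"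
    using rec_in(2)[OF rz] rec_in(2)[OF cyc_rec[OF rz z'(1)]] .
  \<comment> \<open>Color \<open>i + s\<close> never crosses the dual cycle of the same color, so
    the next crossing is with \<open>?D\<close> again, and from the same side as at
    \<open>z\<close>.\<close>
  have "z' \<in> ?A" using z'(2) dual_fam_color(1)[OF D(2), of z'] cz(2) unfolding bdU by blast
  then obtain d' where d': "d' \<in> ?D" "z' = dside s d'" using dual_fam_color(2)[OF D(1) _ s cz(2)] by blast
  obtain d where d: "d \<in> ?D" "z = dside s d" using dual_fam_color(2)[OF D(1) z(2) s cz(1)] by blast
  have dd: "(dside (- s) d, dside (- (- s)) d') \<in> R (bd ?U) {}"
    using z'(3) d d' dside_opp[OF s, of d] by simp
  have nxU: "?nx d = dual.nxt i d" if "d \<in> ?D" for d using that by simp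
  have join: "(z, opp M z) \<in> R (bd ?U) {}" if "z \<in> ?A" for z
    using x cutU Un_upper1 nxU sign_neg[OF s] d(1) d'(1) dd that by (rule dual_joined)
  have "(z, opp M z) \<in> R (bd ?U) {}" if "z \<in> X" "z \<notin> ?A'" "z \<notin> {}" for z
  proof (cases "z \<in> ?A")
    case False
    then show ?thesis using that(2) R_opp[OF sepU that(1) _ that(3)] unfolding bdU by blast
  qed (rule join)
  then have "gen ?A' {} \<subseteq> R (bd ?U) {}"
    by (intro R_recut[OF sepU sepA(2) _ gen_refl]; blast)
  then have "card (classes X (gen (bd ?U) {})) \<le> 1"
    using dual_connected[OF x'] by (intro connected_recut)
  moreover have "2 \<le> card (classes X (gen (bd ?U) {}))"
  proof -
    have "card (classes X (fgraph X f)) + 2 * 2 \<le> card (classes X (fgraph X (phi (bd ?U)))) + card ?U"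
      using cut_Un(2)[OF cutD disj ne(2,3)] by (simp add: phi_def)
    moreover have "sigma {} = rot M" by (simp add: sigma_def swap_on_def fun_eq_iff)
    moreover have "card (bd ?U) = 2 * card ?U" using dual_cut_card(2)[OF cutU] ne(2) by blast
    ultimately show ?thesis using components_after_cut[OF sepU, of "card ?U" 0 0 2] by simp
  qed
  ultimately show False by simp
qed

text \<open>At a dual edge not reversed in color \<open>i + s\<close>, the primal edge
  \<open>?z\<close> of color \<open>i + s\<close> starts on side \<open>s\<close> of the dual cycle.
  The path of color \<open>i\<close> from there ends on side \<open>- s\<close> of a primal cycle,
  and a cycle of color \<open>i + - s\<close> leaves that side. Wherever the latter goes, it undoes
  one of the two cuts, although both together must give two components.\<close>

lemma dual_reversed:
  assumes rev: "\<And>e e1. rec i e \<Longrightarrow> e1 \<in> cyc i e \<Longrightarrow> out_dart (i + s) e1 \<in> bd (cyc i e)"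
    and s: "s \<noteq> 0" and x: "dual.rec i x" and d: "d \<in> dual.cyc i x"
  shows "c' (opp M d) = Some (i + s)"
proof (rule ccontr)
  assume nd: "c' (opp M d) \<noteq> Some (i + s)"
  let ?D = "dual.cyc i x"
  let ?A = "bd ?D"
  have D: "dual.fam i ?D" using x by (rule dual.fam_cyc)
  have dX: "d \<in> X" "c' d = Some i" using dual.famD(1,2)[OF D d] by simp_all
  let ?z = "dside s d"
  have cz: "c ?z = Some (i + s)"
    using s
  proof (cases rule: sign_cases)
    case 1
    then show ?thesis using nd dX(2) unfolding dside_def by (cases rule: edge_cases[OF dX(1)]) auto
  next
    case 2
    then show ?thesis using nd dX(2) unfolding dside_def by (cases rule: edge_cases[OF dX(1)]) auto
  qed
  have zA: "?z \<in> ?A" using d by (simp add: dside_def)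
  have zX: "?z \<in> X" using dX by (simp add: dside_def)
  let ?y = "out_dart i ?z"
  have y: "?y \<in> X" "c ?y = Some i" "origin M ?y = origin M ?z" using out[OF zX] by auto
  obtain N where e: "rec i ((nxt i ^^ N) ?y)" using eventually_rec[OF y(1,2)] by blast
  define e where "e = (nxt i ^^ N) ?y"
  have e: "rec i e" using e by (simp add: e_def)
  let ?C = "cyc i e"
  have C: "fam i ?C" using e by (rule fam_cyc)
  have disj: "?A \<inter> bd ?C = {}" using D C by (rule same_color_disjoint)
  have sep: "sep ?A (bd ?C)" using sep_bd[OF D C disj] .
  have sepA: "sep ?A {}" "sep {} (bd ?C)" "sep {} {}" using sep by (auto simp: sep_def)
  have color_A: "z \<notin> ?A" if "c z = Some i" for z
    using dual_fam_color(1)[OF D, of z] that by blast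
  have ne: "?C \<noteq> {}" "?D \<noteq> {}" using cyc_self dual.cyc_self by blast+
  have two: "2 \<le> card (classes X (gen ?A (bd ?C)))"
    using dual_primal_cut[OF dual_cut[OF D] ne(2) C ne(1) sep] .
  have z_off: "origin M e1 \<noteq> origin M ?z" if "e1 \<in> ?C" for e1
  proof
    assume o: "origin M e1 = origin M ?z"
    have "?z = out_dart (i + s) e1" using out_unique[OF famD(1)[OF C that] o[symmetric] cz] .
    then show False using rev[OF e that] zA disj by (metis disjoint_iff)
  qed
  have zy: "(?z, ?y) \<in> R ?A (bd ?C)" using vertex_connected[OF C sep zX y(3) z_off] .
  have y_off: "?y \<notin> bd ?C" using bd_origin[OF C, of ?y] z_off y(3) by metis
  \<comment> \<open>The path of color \<open>i\<close> from \<open>?z\<close> cannot cross the dual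
    cycle, so its first event is to enter \<open>?C\<close>, on side \<open>- s\<close>.\<close>
  have "nxt i e \<in> ?C" unfolding cyc_def by (rule range_eqI[of _ _ 1]) simp
  moreover have "origin M (nxt i e) = origin M (opp M ((nxt i ^^ N) ?y))"
    using nxt(3)[OF rec_in(1)[OF e]] unfolding e_def .
  ultimately have "(nxt i ^^ N) ?y \<in> ?A \<or> (\<exists>e1\<in>?C. origin M e1 = origin M (opp M ((nxt i ^^ N) ?y)))" by blast
  with C sep y(1,2) y_off obtain e2 where e2: "e2 \<in> ?C" "(?z, pside (- s) e2) \<in> R ?A (bd ?C)"
  proof (cases rule: first_event)
    case (1 n)
    then show ?thesis using color_A nxt_funpow(2)[OF y(1,2)] by blast
  next
    case (2 n e')
    let ?w = "opp M ((nxt i ^^ n) ?y)"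
    have w: "?w \<in> X" "c (opp M ?w) = Some i" using nxt_funpow[OF y(1,2), of n] by simp_all
    have "(pside (- s) e', ?w) \<in> R ?A (bd ?C)"
      using enter_cycle_side[OF C sep 2(1) s rev[OF e 2(1)] w(1) 2(2) w(2) 2(4)] .
    moreover have "(?z, ?w) \<in> R ?A (bd ?C)" using zy 2(3) by (rule conn_trans)
    ultimately have "(?z, pside (- s) e') \<in> R ?A (bd ?C)" by (rule conn_join[rotated])
    then show ?thesis using that 2(1) by blast
  qed
  obtain n where n: "rec (i + - s) (out_dart (i + - s) ((nxt i ^^ n) e))"
    using meet e sign_neg[OF s] unfolding cycles_meet_def by blast
  define e1 where "e1 = (nxt i ^^ n) e"
  have e1: "e1 \<in> ?C" "rec (i + - s) (out_dart (i + - s) e1)" using n by (auto simp: e1_def cyc_def)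
  have e1_off: "out_dart (i + - s) e1 \<notin> bd ?C"
    using not_both_reverse[OF C e1(1) s rev[OF e e1(1)]] .
  have sides: "(pside t u, pside t v) \<in> R ?A (bd ?C)" if "u \<in> ?C" "v \<in> ?C" for t u v
    using cyc_pside[OF C sep e subset_refl that(1)] cyc_pside[OF C sep e subset_refl that(2)]
    by (rule conn_fork)
  have join: "(z, opp M z) \<in> R B (bd ?C)"
    if "sep B (bd ?C)" "u \<in> ?C" "(pside (- s) e1, pside (- (- s)) u) \<in> R B (bd ?C)" "z \<in> bd ?C" for B u z
    using C that(1) e subset_refl sign_neg[OF s] e1(1) that(2-4) by (rule primal_joined)
  \<comment> \<open>Either the cycle of color \<open>i + - s\<close> reaches the dual cycle, on its
    side \<open>- s\<close>, so that the sides of the dual cycle are joined to each other via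
    \<open>?C\<close> and \<open>?z\<close>; or it returns to \<open>?C\<close> on the other
    side.\<close>
  from C sep e1(1) sign_neg[OF s] e1(2) e1_off show False
  proof (cases rule: crossing)
    case (1 z)
    have "c z = Some (i + - s)" using rec_in(2)[OF cyc_rec[OF e1(2) 1(1)]] .
    then obtain d' where d': "d' \<in> ?D" "z = dside (- s) d'"
      using dual_fam_color(2)[OF D 1(2) sign_neg[OF s]] by blast
    have "(?z, dside (- s) d') \<in> R ?A (bd ?C)"
    proof -
      note e2(2)
      also have "(pside (- s) e2, pside (- s) e1) \<in> R ?A (bd ?C)" using sides e2(1) e1(1) .
      also have "(pside (- s) e1, dside (- s) d') \<in> R ?A (bd ?C)" using 1(3) d'(2) by simp
      finally show ?thesis .
    qed
    from x dual_cut[OF D] subset_refl HOL.refl s d d'(1) this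
    have joinA: "(z, opp M z) \<in> R ?A (bd ?C)" if "z \<in> ?A" for z
      using that by (rule dual_joined)
    have "(z, opp M z) \<in> R ?A (bd ?C)" if "z \<in> X" "z \<notin> {}" "z \<notin> bd ?C" for z
      using joinA R_opp[OF sep that(1) _ that(3)] by blast
    then have recutA: "gen {} (bd ?C) \<subseteq> R ?A (bd ?C)"
      by (intro R_recut[OF sep sepA(2) _ gen_refl]; blast)
    \<comment> \<open>With the dual cut undone, the same cycle is followed once more. Now nothing
      but \<open>?C\<close> can stop it, so it joins the sides of \<open>?C\<close> as well.\<close>
    from C sepA(2) e1(1) sign_neg[OF s] e1(2) e1_off
    have "gen {} {} \<subseteq> R {} (bd ?C)"
    proof (cases rule: crossing)
      case (2 u)
      have "(z, opp M z) \<in> R {} (bd ?C)" if "z \<in> X" "z \<notin> {}" "z \<notin> {}" for z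
        using join[OF sepA(2) 2] R_opp[OF sepA(2) that(1,2)] by blast
      then show ?thesis
        by (intro R_recut[OF sepA(2,3) _ gen_refl]; blast)
    qed simp
    then have "gen {} {} \<subseteq> R ?A (bd ?C)" using conn_least[OF recutA] by blast
    then have "card (classes X (gen ?A (bd ?C))) \<le> 1" using gen_connected by (intro connected_recut)
    then show False using two by simp
  next
    case (2 u)
    have "(z, opp M z) \<in> R ?A (bd ?C)" if "z \<in> X" "z \<notin> ?A" "z \<notin> {}" for z
      using join[OF sep 2] R_opp[OF sep that(1,2)] by blast
    then have "gen ?A {} \<subseteq> R ?A (bd ?C)"
      by (intro R_recut[OF sep sepA(1) _ gen_refl]; blast)
    then have "card (classes X (gen ?A (bd ?C))) \<le> 1"
      using dual_connected[OF x] by (intro connected_recut)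
    then show False using two by simp
  qed
qed

lemma dual_cycles_meet: "cycles_meet (dual_map M) c'"
  unfolding cycles_meet_def
proof (intro allI impI, elim conjE)
  fix i s :: color and x assume s: "s \<noteq> 0" and x: "dual.rec i x"
  have xX: "x \<in> X" "c' x = Some i" using dual.rec_in[OF x] by simp_all
  show "\<exists>n. dual.rec (i + s) (dual.out_dart (i + s) ((dual.nxt i ^^ n) x))"
  proof (cases "\<exists>e e1. rec i e \<and> e1 \<in> cyc i e \<and> rec (i + s) (out_dart (i + s) e1) \<and>
      out_dart (i + s) e1 \<notin> bd (cyc i e)")
    case True
    then obtain e e1 where e: "rec i e" "e1 \<in> cyc i e" "rec (i + s) (out_dart (i + s) e1)"
      "out_dart (i + s) e1 \<notin> bd (cyc i e)" by blast
    let ?y = "dual.out_dart (i + s) x"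
    have "?y \<in> darts (dual_map M)" "c' ?y = Some (i + s)" using dual.out[of x "i + s"] xX by simp_all
    then obtain n where x': "dual.rec (i + s) ((dual.nxt (i + s) ^^ n) ?y)"
      using dual.eventually_rec by blast
    obtain d d' where d: "d \<in> dual.cyc i x" "d' \<in> dual.cyc (i + s) ((dual.nxt (i + s) ^^ n) ?y)"
      "origin (dual_map M) d = origin (dual_map M) d'"
      using crossing_meets[OF e(1,2) s e(3,4) x x'] by blast
    have "d \<in> darts (dual_map M)" using dual.rec_in(1)[OF dual.cyc_rec[OF x d(1)]] .
    moreover have rd': "dual.rec (i + s) d'" using dual.cyc_rec[OF x' d(2)] .
    ultimately have "d' = dual.out_dart (i + s) d"
      using dual.out_unique[of d d' "i + s"] d(3) dual.rec_in(2)[OF rd'] by simp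
    moreover obtain m where "d = (dual.nxt i ^^ m) x" using d(1) by (auto simp: dual.cyc_def)
    ultimately show ?thesis using rd' by auto
  next
    case False
    have rev: "out_dart (i + s) e1 \<in> bd (cyc i e)" if e: "rec i e" "e1 \<in> cyc i e" for e e1
      using e(1) s
    proof (cases rule: cross_or_reverse)
      case (1 e1)
      then show ?thesis using False e(1) by blast
    qed (use e(2) in blast)
    have opp_c: "c' (opp M d) = Some (i + s)" if "d \<in> dual.cyc i x" for d
      using rev s x that by (rule dual_reversed)
    have iter: "(dual.nxt i ^^ n) x \<in> dual.cyc i x" for n by (auto simp: dual.cyc_def)
    have iterX: "(dual.nxt i ^^ n) x \<in> X" for n
      using dual.rec_in(1)[OF dual.cyc_rec[OF x iter]] by simp
    have prev: "dual.nxt (i + s) (opp M (dual.nxt i d)) = opp M d" if d: "d \<in> dual.cyc i x" "d \<in> X" for d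
      using dual.nxt[of d i] d by (intro dual.nxt_eqI) (simp_all add: opp_c)
    \<comment> \<open>In color \<open>i + s\<close> the reversed darts are traversed backwards along
      the dual cycle, so \<open>opp M x\<close> inherits the period of \<open>x\<close>.\<close>
    have "(dual.nxt (i + s) ^^ n) (opp M ((dual.nxt i ^^ n) x)) = opp M x" for n
    proof (induction n)
      case (Suc n)
      have "(dual.nxt (i + s) ^^ Suc n) (opp M ((dual.nxt i ^^ Suc n) x)) =
          (dual.nxt (i + s) ^^ n) (dual.nxt (i + s) (opp M (dual.nxt i ((dual.nxt i ^^ n) x))))"
        by (simp only: funpow_Suc_right[of n "dual.nxt (i + s)"] funpow.simps(2)[of n "dual.nxt i"] comp_apply)
      then show ?case using Suc prev[OF iter iterX] by simp
    qed simp
    moreover obtain k where "k > 0" "(dual.nxt i ^^ k) x = x" using x by (auto simp: recurrent_def)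
    ultimately have "(dual.nxt (i + s) ^^ k) (opp M x) = opp M x" "k > 0" by metis+
    then have "dual.rec (i + s) (opp M x)"
      using xX opp_c[of x] unfolding recurrent_def by auto
    \<comment> \<open>One step along the cycle is made because \<open>opp M x\<close> leaves the
      target of \<open>x\<close>, not its origin.\<close>
    moreover have "dual.out_dart (i + s) ((dual.nxt i ^^ 1) x) = opp M x"
      using dual.out_unique[of "dual.nxt i x" "opp M x" "i + s"] dual.nxt[of x i] xX opp_c[of x] by simp
    ultimately show ?thesis by metis
  qed
qed

lemma dual_wood: "schnyder_wood (dual_map M) c'"
  using dual.co dual.schnyder_T1 dual.cycles_meetD[OF dual_cycles_meet] by (simp add: schnyder_wood_def)

end

section \<open>Iterated duality and the bijection\<close>

lemma dual_coloring_wood: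
  assumes "torus M" "schnyder_wood M c"
  shows "schnyder_wood (dual_map M) (dual_coloring M c)"
proof -
  interpret comb_map M using assms(1) by (simp add: comb_map_def torus_def)
  obtain lab where "labelled_map M c lab"
    using labelled_map_exists assms(2) unfolding schnyder_wood_def by blast
  then interpret labelled_map M c lab .
  interpret torus_wood M c lab
    using assms cycles_meetI unfolding schnyder_wood_def by unfold_locales auto
  show ?thesis by (rule dual_wood)
qed

lemma dual_coloring_twice:
  assumes "combinatorial_map M" "colored_orientation M c"
  shows "dual_coloring (dual_map M) (dual_coloring M c) = c \<circ> opp M"
proof
  interpret comb_map M using assms(1) by (simp add: comb_map_def)
  fix d
  show "dual_coloring (dual_map M) (dual_coloring M c) d = (c \<circ> opp M) d"
  proof (cases "d \<in> X")
    case True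
    then have ne: "c d \<noteq> c (opp M d)" using assms(2) by (simp add: colored_orientation_def)
    show ?thesis
    proof (cases "c d")
      case None
      then obtain b where "c (opp M d) = Some b" using ne by (metis not_None_eq)
      then show ?thesis using None True by (simp add: dual_coloring_def dual_map_def)
    next
      case (Some a)
      note a = this
      show ?thesis
      proof (cases "c (opp M d)")
        case None
        then show ?thesis using a True by (simp add: dual_coloring_def dual_map_def)
      next
        case (Some b)
        then have "b \<noteq> a" using a ne by auto
        then consider "b = a + 1" | "b = a - 1" by (cases rule: color_cases[of b a]) auto
        then show ?thesis by cases (use a Some True in \<open>simp_all add: dual_coloring_def dual_map_def\<close>)
      qed
    qed
  next
    case False
    then have "opp M d \<notin> X" by simp
    then show ?thesis
      using False assms(2) by (simp add: dual_coloring_def dual_map_def colored_orientation_def)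
  qed
qed

text \<open>The double dual has the rotation conjugated by \<open>opp M\<close>, and conjugating
  twice by an involution changes nothing.\<close>

lemma dual_map_four:
  assumes "combinatorial_map M"
  shows "dual_map (dual_map (dual_map (dual_map M))) = M"
proof -
  interpret comb_map M using assms by (simp add: comb_map_def)
  have two: "dual_map (dual_map M) = \<lparr>darts = X, rot = opp M \<circ> rot M \<circ> opp M, opp = opp M\<rparr>"
    using face_next_dual by (simp add: dual_map_def[of "dual_map M"]) (simp add: dual_map_def)
  interpret d: comb_map "dual_map M" using comb_dual by (simp add: comb_map_def)
  interpret dd: comb_map "dual_map (dual_map M)" using d.comb_dual by (simp add: comb_map_def)
  have "rot (dual_map (dual_map (dual_map (dual_map M)))) = opp M \<circ> (opp M \<circ> rot M \<circ> opp M) \<circ> opp M"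
    using dd.face_next_dual by (simp add: dual_map_def[of "dual_map (dual_map (dual_map M))"]) (simp add: two)
  also have "\<dots> = rot M" by (simp add: fun_eq_iff)
  finally show ?thesis by (intro cmap.equality) (simp_all add: dual_map_def)
qed

theorem theorem7:
  fixes G :: "'d cmap"
  assumes "toroidal_map G"
  shows "\<exists>f. bij_betw f {c. schnyder_wood G c} {c. schnyder_wood (dual_map G) c}"
proof -
  let ?d = "dual_map :: 'd cmap \<Rightarrow> 'd cmap"
  define D where "D c = dual_coloring G c" for c
  define D1 where "D1 c = dual_coloring (?d G) c" for c
  define D2 where "D2 c = dual_coloring (?d (?d G)) c" for c
  define D3 where "D3 c = dual_coloring (?d (?d (?d G))) c" for c
  have "map_on_torus G" using assms by (simp add: toroidal_map_def)
  then have "combinatorial_map G" "torus G"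
    using comb_map.torusI by (auto simp: map_on_torus_def comb_map_def)
  have torus_d: "torus (?d M)" if "torus M" for M
    using comb_map.torus_dual[of M] that by (simp add: torus_def comb_map_def)
  have torus: "torus G" "torus (?d G)" "torus (?d (?d G))" "torus (?d (?d (?d G)))"
    using \<open>torus G\<close> torus_d by blast+
  then have comb: "combinatorial_map G" "combinatorial_map (?d G)" "combinatorial_map (?d (?d G))"
    "combinatorial_map (?d (?d (?d G)))" by (simp_all add: torus_def)
  have four: "?d (?d (?d (?d G))) = G" using comb(1) by (rule dual_map_four)
  have opp: "opp (?d M) = opp M" for M by (simp add: dual_map_def)
  have invol: "opp G \<circ> opp G = id"
    using comb_map.opp_opp[of G] comb(1) by (simp add: comb_map_def fun_eq_iff)
  have wood: "schnyder_wood (?d G) (D c)" if "schnyder_wood G c" for c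
    using dual_coloring_wood torus that unfolding D_def by blast
  have wood1: "schnyder_wood (?d (?d G)) (D1 c)" if "schnyder_wood (?d G) c" for c
    using dual_coloring_wood torus that unfolding D1_def by blast
  have wood2: "schnyder_wood (?d (?d (?d G))) (D2 c)" if "schnyder_wood (?d (?d G)) c" for c
    using dual_coloring_wood torus that unfolding D2_def by blast
  have wood3: "schnyder_wood G (D3 c)" if "schnyder_wood (?d (?d (?d G))) c" for c
    using dual_coloring_wood[OF torus(4) that] unfolding D3_def four .
  have co: "colored_orientation M c" if "schnyder_wood M c" for M c
    using that by (simp add: schnyder_wood_def)
  have twice: "D1 (D c) = c \<circ> opp G" if "schnyder_wood G c" for c
    using dual_coloring_twice[OF comb(1) co[OF that]] unfolding D_def D1_def .
  have twice1: "D2 (D1 c) = c \<circ> opp G" if "schnyder_wood (?d G) c" for c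
    using dual_coloring_twice[OF comb(2) co[OF that]] unfolding D1_def D2_def opp .
  have twice2: "D3 (D2 c) = c \<circ> opp G" if "schnyder_wood (?d (?d G)) c" for c
    using dual_coloring_twice[OF comb(3) co[OF that]] unfolding D2_def D3_def opp .
  have twice3: "D (D3 c) = c \<circ> opp G" if "schnyder_wood (?d (?d (?d G))) c" for c
    using dual_coloring_twice[OF comb(4) co[OF that]] unfolding D3_def D_def opp four .
  have "bij_betw D {c. schnyder_wood G c} {c. schnyder_wood (?d G) c}"
  \<comment> \<open>Two dualizations reverse all darts and two more reverse them back, so the three
    remaining dualizations of the four are inverse to \<open>D\<close> on either side.\<close>
  proof (rule bij_betw_byWitness[where f' = "\<lambda>c. D3 (D2 (D1 c))"])
    show "\<forall>c\<in>{c. schnyder_wood G c}. D3 (D2 (D1 (D c))) = c"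
    proof
      fix c assume "c \<in> {c. schnyder_wood G c}"
      then have c: "schnyder_wood G c" by simp
      have "D3 (D2 (D1 (D c))) = D1 (D c) \<circ> opp G" using twice2[OF wood1[OF wood[OF c]]] .
      also have "\<dots> = c" unfolding twice[OF c] comp_assoc invol by simp
      finally show "D3 (D2 (D1 (D c))) = c" .
    qed
    show "\<forall>c\<in>{c. schnyder_wood (?d G) c}. D (D3 (D2 (D1 c))) = c"
    proof
      fix c assume "c \<in> {c. schnyder_wood (?d G) c}"
      then have c: "schnyder_wood (?d G) c" by simp
      have "D (D3 (D2 (D1 c))) = D2 (D1 c) \<circ> opp G" using twice3[OF wood2[OF wood1[OF c]]] .
      also have "\<dots> = c" unfolding twice1[OF c] comp_assoc invol by simp
      finally show "D (D3 (D2 (D1 c))) = c" .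
    qed
  qed (use wood wood1 wood2 wood3 in blast)+
  then show ?thesis by blast
qed

end
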